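(* Let $k\ge1$ and $a_1,\ldots,a_k,h_1,\ldots,h_k\in\mathbb{N}$ be fixed with $a_ih_j\ne a_jh_i$ whenever $i\ne j$, and let Dirichlet characters $\chi_1,\ldots,\chi_k$ and real numbers $t_1,\ldots,t_k$ be fixed. Then for any $x\ge3$, any $\varepsilon\in(1/\log\log x,1/2)$ and any multiplicative functions $f_1,\ldots,f_k:\mathbb{N}\to\mathbb{D}$ satisfying $$\max_{1\le j\le k}\mathbb{D}(f_j,\chi_j(n)n^{it_j};x^{\varepsilon},x)\le\varepsilon\quad\text{and}\quad\max_{1\le j\le k}\mathbb{D}(f_j,\chi_j(n)n^{it_j};x^{\varepsilon})\ge1/\varepsilon,$$ we have $$\left|\frac1x\sum_{n\le x}f_1(a_1n+h_1)\cdots f_k(a_kn+h_k)\right|\ll\left(\log\frac1\varepsilon\right)^{1/2}\varepsilon,$$ where the implied constant may depend on the fixed quantities $k,a_j,h_j,\chi_j,t_j$.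
   Context: $\mathbb{D}$ is the closed unit disc. $\mathbb{D}(f,g;x)=\big(\sum_{p\le x}\frac{1-\mathrm{Re}(f(p)\overline{g(p)})}{p}\big)^{1/2}$ and the truncated distance $\mathbb{D}(f,g;y,x)=\big(\sum_{y\le p\le x}\frac{1-\mathrm{Re}(f(p)\overline{g(p)})}{p}\big)^{1/2}$, sums over primes. *)

theory Defs
  imports "HOL-Analysis.Analysis" "HOL-Computational_Algebra.Primes"
begin

text \<open>
  Arithmetic functions are modelled as functions on \<^typ>\<open>nat\<close>. Their domain is the set of positive
  integers: the value at \<open>0\<close> is never constrained here, except for Dirichlet characters, which are
  periodic and so have a natural value at \<open>0\<close>.
\<close>

definition multiplicative_fun :: "(nat \<Rightarrow> complex) \<Rightarrow> bool" where
  "multiplicative_fun f \<longleftrightarrow>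
     f 1 = 1 \<and> (\<forall>m>0. \<forall>n>0. coprime m n \<longrightarrow> f (m * n) = f m * f n)"

text \<open>
  A Dirichlet character modulo \<open>q\<close>, not necessarily primitive or non-principal: a character of
  the unit group modulo \<open>q\<close>, extended by zero.
\<close>

definition dirichlet_character :: "nat \<Rightarrow> (nat \<Rightarrow> complex) \<Rightarrow> bool" where
  "dirichlet_character q chi \<longleftrightarrow>
     q > 0 \<and> chi 1 = 1 \<and>
     (\<forall>m n. chi (m * n) = chi m * chi n) \<and>
     (\<forall>n. chi (n + q) = chi n) \<and>
     (\<forall>n. chi n = 0 \<longleftrightarrow> \<not> coprime n q)"

definition twisted_character :: "(nat \<Rightarrow> complex) \<Rightarrow> real \<Rightarrow> nat \<Rightarrow> complex" where
  "twisted_character chi t n = chi n * of_nat n powr (\<i> * of_real t)"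

definition pretentious_dist :: "(nat \<Rightarrow> complex) \<Rightarrow> (nat \<Rightarrow> complex) \<Rightarrow> real \<Rightarrow> real" where
  "pretentious_dist f g x =
     sqrt (\<Sum>p | prime p \<and> real p \<le> x. (1 - Re (f p * cnj (g p))) / real p)"

definition pretentious_dist_trunc ::
    "(nat \<Rightarrow> complex) \<Rightarrow> (nat \<Rightarrow> complex) \<Rightarrow> real \<Rightarrow> real \<Rightarrow> real" where
  "pretentious_dist_trunc f g y x =
     sqrt (\<Sum>p | prime p \<and> y \<le> real p \<and> real p \<le> x. (1 - Re (f p * cnj (g p))) / real p)"

end

theory Submission
  imports Defs "HOL-Number_Theory.Number_Theory" "HOL-Real_Asymp.Real_Asymp"
begin

text \<open>
  Write \<open>F j p\<close> for \<open>f j p\<close> times the conjugate of the twisted character at \<open>p\<close>, and let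
  \<open>w\<close> be about \<open>1 / \<epsilon>\<close> and \<open>y = x powr \<epsilon>\<close>. Primes above \<open>y\<close> may be removed at a cost controlled by
  Cauchy--Schwarz: the sum of \<open>|1 - F j p| / p\<close> over \<open>y < p \<le> x\<close> is at most
  \<open>\<epsilon>\<close> times the square root of the sum of \<open>1 / p\<close>, and this is where
  \<open>\<epsilon> (log (1 / \<epsilon>))\<^sup>1\<^sup>/\<^sup>2\<close> comes from. All other errors are \<open>O(\<epsilon>)\<close>.

  What remains is a slowly varying factor, a factor that is periodic modulo \<open>Q\<close>, and a product over
  \<open>w < p \<le> y\<close> of functions \<open>X p\<close> on residues modulo \<open>p\<close> with values in the unit disc. On a
  progression modulo \<open>Q\<close> in a short interval only the last product matters. It is evaluated in the
  manner of the Brun--Hooley sieve: the primes are cut into the blocks \<open>2^2^i < p \<le> 2^2^(i+1)\<close>, on each of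
  which the sum of \<open>1 / p\<close> is bounded, and in each block the expansion of the product of the
  \<open>1 + (X p - 1)\<close> is truncated at a degree that grows slowly as \<open>i\<close> decreases. Since all products
  stay in the unit disc, the truncation error is small in absolute terms, so no lower bound for a
  sieve density is needed. The mean is then close to an Euler product which the hypothesis on
  the distance up to \<open>y\<close> makes at most about \<open>exp (- 1 / \<epsilon>\<^sup>2)\<close>.
\<close>

section \<open>Truncated expansions of products\<close>

text \<open>The lower bound on \<open>\<epsilon>\<close> says that \<open>ln x\<close> exceeds
  \<open>exp (1 / \<epsilon>)\<close>. With \<open>w\<close> about \<open>1 / \<epsilon>\<close>
  this keeps the period \<open>Q\<close>, at most a constant times \<open>w\<close> to the power
  \<open>w\<^sup>2\<close>, below a small power of \<open>x\<close>, so progressions modulo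
  \<open>Q\<close> remain long. The size of \<open>w\<close> is constrained from both sides: values
  divisible by some \<open>p ^ w\<close> with \<open>p \<le> w\<close>, or by the square of a larger
  prime, have density \<open>O(1 / w)\<close>, which must be \<open>O(\<epsilon>)\<close>; and
  leaving the primes up to \<open>w\<close> out of the Euler product removes at most
  \<open>w\<close> from a sum of size \<open>1 / \<epsilon>\<^sup>2\<close>. The truncated expansion
  has level \<open>y\<close> to a power \<open>O(B)\<close>, where \<open>B\<close> is the degree in
  the top block. Since \<open>y = x powr \<epsilon>\<close>, a degree \<open>B\<close> that is a
  small multiple of \<open>1 / \<epsilon>\<close> is affordable, and then truncation errors of order
  \<open>2 ^ (- B)\<close> are far below \<open>\<epsilon>\<close>. The mean of \<open>X p\<close>
  is \<open>1\<close> plus the sum over \<open>j\<close> of \<open>(F j p - 1) / p\<close>. Each of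
  these terms has nonpositive real part, so a single index at large distance already makes the Euler
  product small; the other functions cannot undo it.\<close>

definition trunc_poly :: "nat \<Rightarrow> 'a set \<Rightarrow> ('a \<Rightarrow> 'b::comm_semiring_1) \<Rightarrow> 'b" where
  "trunc_poly b A v = (\<Sum>S | S \<subseteq> A \<and> card S \<le> b. \<Prod>p\<in>S. v p)"

definition elem_sym :: "nat \<Rightarrow> 'a set \<Rightarrow> ('a \<Rightarrow> 'b::comm_semiring_1) \<Rightarrow> 'b" where
  "elem_sym m A v = (\<Sum>S | S \<subseteq> A \<and> card S = m. \<Prod>p\<in>S. v p)"

text \<open>Subsets containing \<open>x\<close> correspond to subsets of \<open>A\<close> with one
  element fewer. The size condition is an arbitrary predicate so that one splitting gives the
  recursions of both \<open>elem_sym\<close> and \<open>trunc_poly\<close>.\<close>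

lemma sum_subsets_insert:
  fixes g :: "'a set \<Rightarrow> 'b::comm_monoid_add"
  assumes "finite A" "x \<notin> A"
  shows "(\<Sum>S | S \<subseteq> insert x A \<and> P (card S). g S) =
    (\<Sum>S | S \<subseteq> A \<and> P (card S). g S) + (\<Sum>S | S \<subseteq> A \<and> P (Suc (card S)). g (insert x S))"
proof -
  have inj: "inj_on (insert x) {S. S \<subseteq> A \<and> P (Suc (card S))}"
    using assms by (auto simp: inj_on_def)
  have card: "card (insert x S) = Suc (card S)" if "S \<subseteq> A" for S
    using that assms by (meson card_insert_disjoint finite_subset subsetD)
  have "{S. S \<subseteq> insert x A \<and> P (card S)} =
      {S. S \<subseteq> A \<and> P (card S)} \<union> insert x ` {S. S \<subseteq> A \<and> P (Suc (card S))}" (is "?L = ?R")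
  proof (intro equalityI subsetI)
    fix S assume S: "S \<in> ?L"
    show "S \<in> ?R"
    proof (cases "x \<in> S")
      case True
      then have eq: "insert x (S - {x}) = S" and sub: "S - {x} \<subseteq> A" using S by auto
      have "P (card S)" using S by simp
      then have "S - {x} \<in> {S. S \<subseteq> A \<and> P (Suc (card S))}"
        using card[OF sub] sub unfolding eq by simp
      then have "insert x (S - {x}) \<in> insert x ` {S. S \<subseteq> A \<and> P (Suc (card S))}"
        by (rule imageI)
      then show ?thesis unfolding eq by (rule UnI2)
    next
      case False
      then show ?thesis using S by auto
    qed
  next
    fix S assume "S \<in> ?R"
    then show "S \<in> ?L"
    proof
      assume "S \<in> insert x ` {S. S \<subseteq> A \<and> P (Suc (card S))}"
      then obtain T where "S = insert x T" "T \<subseteq> A" "P (Suc (card T))" by blast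
      then show ?thesis using card[of T] by auto
    qed auto
  qed
  moreover have "{S. S \<subseteq> A \<and> P (card S)} \<inter> insert x ` {S. S \<subseteq> A \<and> P (Suc (card S))} = {}"
    using assms by auto
  ultimately show ?thesis
    using assms inj by (simp add: sum.union_disjoint sum.reindex)
qed

lemma prod_insert_subset:
  assumes "finite A" "x \<notin> A" "S \<subseteq> A"
  shows "(\<Prod>p\<in>insert x S. v p) = v x * (\<Prod>p\<in>S. v p)"
  using assms by (meson finite_subset prod.insert subsetD)

lemma elem_sym_insert:
  assumes "finite A" "x \<notin> A"
  shows "elem_sym (Suc m) (insert x A) v = elem_sym (Suc m) A v + v x * elem_sym m A v"
  unfolding elem_sym_def sum_subsets_insert[OF assms, where P = "\<lambda>c. c = Suc m"]
  using assms by (simp add: prod_insert_subset sum_distrib_left)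

lemma trunc_poly_insert:
  assumes "finite A" "x \<notin> A"
  shows "trunc_poly (Suc b) (insert x A) v = trunc_poly (Suc b) A v + v x * trunc_poly b A v"
  unfolding trunc_poly_def sum_subsets_insert[OF assms, where P = "\<lambda>c. c \<le> Suc b"]
  using assms by (simp add: prod_insert_subset sum_distrib_left)

lemma trunc_poly_0:
  assumes "finite A"
  shows "trunc_poly 0 A v = 1"
proof -
  have "{S. S \<subseteq> A \<and> card S \<le> 0} = {{}}"
    using assms by (auto dest: finite_subset)
  then show ?thesis by (simp add: trunc_poly_def)
qed

lemma elem_sym_0:
  assumes "finite A"
  shows "elem_sym 0 A v = 1"
proof -
  have "{S. S \<subseteq> A \<and> card S = 0} = {{}}"
    using assms by (auto dest: finite_subset)
  then show ?thesis by (simp add: elem_sym_def)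
qed

lemma elem_sym_empty: "elem_sym (Suc m) ({} :: 'a set) v = 0"
proof -
  have "{S :: 'a set. S \<subseteq> {} \<and> card S = Suc m} = {}" by auto
  then show ?thesis by (simp only: elem_sym_def sum.empty)
qed

lemma elem_sym_nonneg:
  fixes v :: "'a \<Rightarrow> real"
  assumes "\<And>p. p \<in> A \<Longrightarrow> 0 \<le> v p"
  shows "0 \<le> elem_sym m A v"
  unfolding elem_sym_def using assms by (intro sum_nonneg prod_nonneg) auto

lemma elem_sym_mono:
  fixes v :: "'a \<Rightarrow> real"
  assumes "\<And>p. p \<in> A \<Longrightarrow> 0 \<le> v p" "\<And>p. p \<in> A \<Longrightarrow> v p \<le> w p"
  shows "elem_sym m A v \<le> elem_sym m A w"
  unfolding elem_sym_def using assms by (intro sum_mono prod_mono) auto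

lemma norm_prod_le_1:
  fixes z :: "'a \<Rightarrow> complex"
  assumes "\<And>p. p \<in> A \<Longrightarrow> norm (z p) \<le> 1"
  shows "norm (\<Prod>p\<in>A. z p) \<le> 1"
  unfolding prod_norm[symmetric] using assms by (intro prod_le_1) auto

text \<open>A Bonferroni inequality for complex factors in the unit disc. Adding \<open>x\<close>
  turns the error at degree \<open>b\<close> into itself plus \<open>u x\<close> times the error at
  degree \<open>b - 1\<close>, which is the recursion of \<open>elem_sym (Suc b)\<close>. At
  \<open>b = 0\<close>, where there is no lower degree, the bound \<open>1\<close> on the full
  product takes its place.\<close>

lemma norm_prod_minus_trunc_poly:
  fixes u :: "'a \<Rightarrow> complex"
  assumes "finite A" "\<And>p. p \<in> A \<Longrightarrow> norm (1 + u p) \<le> 1"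
  shows "norm ((\<Prod>p\<in>A. 1 + u p) - trunc_poly b A u) \<le> elem_sym (Suc b) A (\<lambda>p. norm (u p))"
  using assms
proof (induction A arbitrary: b rule: finite_induct)
  case empty
  have "{S :: 'a set. S = {} \<and> card S \<le> b} = {{}}" by auto
  then show ?case by (simp add: trunc_poly_def elem_sym_empty)
next
  case (insert x A)
  have IH: "norm ((\<Prod>p\<in>A. 1 + u p) - trunc_poly b A u) \<le> elem_sym (Suc b) A (\<lambda>p. norm (u p))" for b
    using insert by auto
  show ?case
  proof (cases b)
    case 0
    have "(\<Prod>p\<in>insert x A. 1 + u p) - trunc_poly 0 (insert x A) u
        = ((\<Prod>p\<in>A. 1 + u p) - trunc_poly 0 A u) + u x * (\<Prod>p\<in>A. 1 + u p)"
      using insert by (simp add: trunc_poly_0 algebra_simps)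
    also have "norm \<dots> \<le> elem_sym (Suc 0) A (\<lambda>p. norm (u p)) + norm (u x) * 1"
      unfolding norm_mult using insert.prems
      by (intro order_trans[OF norm_triangle_ineq] add_mono IH[of 0])
         (auto simp: norm_mult intro!: mult_left_le norm_prod_le_1)
    finally show ?thesis
      using insert 0 by (simp add: elem_sym_insert elem_sym_0)
  next
    case (Suc c)
    have "(\<Prod>p\<in>insert x A. 1 + u p) - trunc_poly (Suc c) (insert x A) u
        = ((\<Prod>p\<in>A. 1 + u p) - trunc_poly (Suc c) A u) + u x * ((\<Prod>p\<in>A. 1 + u p) - trunc_poly c A u)"
      using insert by (simp add: trunc_poly_insert algebra_simps)
    also have "norm \<dots> \<le> elem_sym (Suc (Suc c)) A (\<lambda>p. norm (u p))
        + norm (u x) * elem_sym (Suc c) A (\<lambda>p. norm (u p))"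
      by (intro norm_triangle_le add_mono IH[of "Suc c"])
         (auto simp: norm_mult intro: mult_left_mono IH)
    finally show ?thesis
      using insert Suc by (simp add: elem_sym_insert)
  qed
qed

text \<open>Factors are exchanged one at a time. Only the \<open>W i\<close> lie in the disc; the
  \<open>T i\<close> are controlled through \<open>1 + R i\<close>, which is why the bound is a
  product and not a sum of the \<open>R i\<close>.\<close>

lemma norm_prod_diff_le_prod:
  fixes W T :: "'i \<Rightarrow> complex" and R :: "'i \<Rightarrow> real"
  assumes "finite I" "\<And>i. i \<in> I \<Longrightarrow> norm (W i) \<le> 1" "\<And>i. i \<in> I \<Longrightarrow> norm (T i - W i) \<le> R i"
  shows "norm ((\<Prod>i\<in>I. T i) - (\<Prod>i\<in>I. W i)) \<le> (\<Prod>i\<in>I. 1 + R i) - 1"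
  using assms
proof (induction I rule: finite_induct)
  case empty
  then show ?case by simp
next
  case (insert x I)
  let ?T = "\<Prod>i\<in>I. T i" and ?W = "\<Prod>i\<in>I. W i" and ?R = "\<Prod>i\<in>I. 1 + R i"
  have IH: "norm (?T - ?W) \<le> ?R - 1" using insert by auto
  have R: "norm (T x - W x) \<le> R x" using insert by auto
  have W: "norm ?W \<le> 1" using insert by (intro norm_prod_le_1) auto
  have T: "norm ?T \<le> ?R" using norm_triangle_sub[of ?T ?W] IH W by linarith
  have "T x * ?T - W x * ?W = (T x - W x) * ?T + W x * (?T - ?W)"
    by (simp add: algebra_simps)
  also have "norm \<dots> \<le> norm (T x - W x) * norm ?T + norm (W x) * norm (?T - ?W)"
    by (metis norm_triangle_ineq norm_mult)
  also have "\<dots> \<le> R x * ?R + 1 * (?R - 1)"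
    using insert.prems R T IH order_trans[OF norm_ge_zero R]
    by (intro add_mono mult_mono) auto
  finally show ?case using insert by (simp add: algebra_simps)
qed

text \<open>Rankin's trick: each subset of size \<open>m\<close> is weighted by \<open>2 ^ (card S - m)\<close>.\<close>

lemma elem_sym_le_exp:
  fixes v :: "'a \<Rightarrow> real"
  assumes "finite A" "\<And>p. p \<in> A \<Longrightarrow> 0 \<le> v p"
  shows "elem_sym m A v \<le> exp (2 * (\<Sum>p\<in>A. v p)) / 2 ^ m"
proof -
  have "2 ^ m * elem_sym m A v = (\<Sum>S | S \<subseteq> A \<and> card S = m. \<Prod>p\<in>S. 2 * v p)"
    unfolding elem_sym_def sum_distrib_left by (intro sum.cong) (auto simp: prod.distrib)
  also have "\<dots> \<le> (\<Sum>S\<in>Pow A. \<Prod>p\<in>S. 2 * v p)"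
    using assms by (intro sum_mono2 prod_nonneg) auto
  also have "\<dots> = (\<Prod>p\<in>A. 2 * v p + 1)"
    using assms by (subst prod_add) auto
  also have "\<dots> \<le> (\<Prod>p\<in>A. exp (2 * v p))"
    using assms by (intro prod_mono) (auto intro: exp_ge_add_one_self simp: add.commute add_nonneg_nonneg)
  also have "\<dots> = exp (2 * (\<Sum>p\<in>A. v p))"
    using assms by (simp add: exp_sum sum_distrib_left)
  finally show ?thesis by (simp add: field_simps)
qed

text \<open>Rankin's trick in the other direction: as \<open>t \<ge> 1\<close> and
  \<open>card S \<le> b\<close>, each term may be multiplied by \<open>t ^ (b - card S)\<close>. The
  sum then runs over all subsets with weight \<open>\<kappa> / t\<close> per element, of total
  weight at most \<open>1\<close>.\<close>

lemma sum_subsets_power_card_le: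
  fixes \<kappa> t :: real
  assumes "finite A" "\<kappa> \<ge> 0" "t \<ge> 1" "\<kappa> * real (card A) \<le> t"
  shows "(\<Sum>S | S \<subseteq> A \<and> card S \<le> b. \<kappa> ^ card S) \<le> t ^ b * exp 1"
proof -
  have "(\<Sum>S | S \<subseteq> A \<and> card S \<le> b. \<kappa> ^ card S)
      \<le> (\<Sum>S | S \<subseteq> A \<and> card S \<le> b. t ^ b * (\<kappa> / t) ^ card S)"
  proof (intro sum_mono)
    fix S assume "S \<in> {S. S \<subseteq> A \<and> card S \<le> b}"
    then have "t ^ card S \<le> t ^ b" using assms by (intro power_increasing) auto
    then have "\<kappa> ^ card S * t ^ card S \<le> \<kappa> ^ card S * t ^ b"
      using assms by (intro mult_left_mono) auto
    then show "\<kappa> ^ card S \<le> t ^ b * (\<kappa> / t) ^ card S"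
      using assms by (simp add: power_divide field_simps)
  qed
  also have "\<dots> \<le> (\<Sum>S\<in>Pow A. t ^ b * (\<kappa> / t) ^ card S)"
    using assms by (intro sum_mono2) auto
  also have "\<dots> = t ^ b * (\<Sum>S\<in>Pow A. \<Prod>p\<in>S. \<kappa> / t)"
    by (simp only: sum_distrib_left prod_constant)
  also have "(\<Sum>S\<in>Pow A. \<Prod>p\<in>S. \<kappa> / t) = (\<Prod>p\<in>A. \<kappa> / t + 1)"
    using assms by (subst prod_add) auto
  also have "\<dots> \<le> (\<Prod>p\<in>A. exp (\<kappa> / t))"
    using assms by (intro prod_mono) (auto intro: exp_ge_add_one_self simp: add.commute add_nonneg_nonneg)
  also have "\<dots> = exp (\<kappa> * real (card A) / t)"
    by (simp flip: exp_of_nat_mult add: algebra_simps)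
  also have "\<dots> \<le> exp 1" using assms by (simp add: field_simps)
  finally show ?thesis using assms by (simp add: mult_left_mono)
qed

section \<open>Means of products of periodic functions\<close>

text \<open>Chinese remainder theorem: the pair of residues is injective on
  \<open>{..<c * d}\<close>, hence by counting onto all pairs.\<close>

lemma sum_lessThan_mult_coprime:
  fixes u v :: "nat \<Rightarrow> 'b::comm_semiring_1"
  assumes "coprime c d" "c > 0" "d > 0"
    and u: "\<And>m. u (m mod c) = u m" and v: "\<And>m. v (m mod d) = v m"
  shows "(\<Sum>m<c * d. u m * v m) = (\<Sum>m<c. u m) * (\<Sum>m<d. v m)"
proof -
  let ?g = "\<lambda>m. (m mod c, m mod d)"
  have inj: "inj_on ?g {..<c * d}"
  proof (rule inj_onI)
    fix m n assume *: "m \<in> {..<c * d}" "n \<in> {..<c * d}" "?g m = ?g n"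
    then have "[m = n] (mod c * d)"
      using assms by (intro coprime_cong_mult_nat) (auto simp: cong_def)
    then show "m = n" using * by (auto simp: cong_def)
  qed
  have "?g ` {..<c * d} = {..<c} \<times> {..<d}"
    using assms by (intro card_subset_eq) (auto simp: card_image[OF inj])
  then have "(\<Sum>m<c * d. u (m mod c) * v (m mod d)) = (\<Sum>(i, j)\<in>{..<c} \<times> {..<d}. u i * v j)"
    using sum.reindex[OF inj, of "\<lambda>(i, j). u i * v j"] by (simp add: o_def)
  also have "\<dots> = (\<Sum>m<c. u m) * (\<Sum>m<d. v m)"
    by (simp add: sum_product sum.cartesian_product)
  finally show ?thesis by (simp add: u v)
qed

lemma prod_primes_coprime:
  assumes "finite S" "prime p" "p \<notin> S" "\<And>r. r \<in> S \<Longrightarrow> prime r"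
  shows "coprime p (\<Prod>S :: nat)"
  using assms by (intro prod_coprime_right) (auto intro: primes_coprime)

lemma prod_periodic:
  fixes u :: "nat \<Rightarrow> nat \<Rightarrow> 'b::comm_semiring_1"
  assumes "finite S" "\<And>p m. p \<in> S \<Longrightarrow> u p (m mod p) = u p m"
  shows "(\<Prod>p\<in>S. u p (m mod \<Prod>S)) = (\<Prod>p\<in>S. u p m)"
proof (rule prod.cong[OF refl])
  fix p assume "p \<in> S"
  then have "p dvd \<Prod>S" using assms by (auto intro: dvd_prodI[of S p "\<lambda>x. x", simplified])
  then show "u p (m mod \<Prod>S) = u p m"
    using assms(2)[OF \<open>p \<in> S\<close>] by (metis mod_mod_cancel)
qed

lemma sum_prod_full_period:
  fixes u :: "nat \<Rightarrow> nat \<Rightarrow> 'b::comm_semiring_1"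
  assumes "finite S" "\<And>p. p \<in> S \<Longrightarrow> prime p" "\<And>p m. p \<in> S \<Longrightarrow> u p (m mod p) = u p m"
  shows "(\<Sum>m<\<Prod>S. \<Prod>p\<in>S. u p m) = (\<Prod>p\<in>S. \<Sum>m<p. u p m)"
  using assms
proof (induction S rule: finite_induct)
  case empty
  then show ?case by simp
next
  case (insert q S)
  have "(\<Sum>m<q * \<Prod>S. u q m * (\<Prod>p\<in>S. u p m)) = (\<Sum>m<q. u q m) * (\<Sum>m<\<Prod>S. \<Prod>p\<in>S. u p m)"
    using insert
    by (intro sum_lessThan_mult_coprime prod_primes_coprime prod_periodic)
       (auto intro!: prime_gt_0_nat prod_pos)
  then show ?case using insert by simp
qed

lemma sum_periodic_blocks:
  fixes g :: "nat \<Rightarrow> 'b::comm_semiring_1"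
  assumes "\<And>m. g (m mod d) = g m"
  shows "(\<Sum>m<c * d. g m) = of_nat c * (\<Sum>m<d. g m)"
proof -
  have "(\<Sum>m<c * d. g m) = (\<Sum>m<d * c. g m)" by (simp add: mult.commute)
  also have "\<dots> = (\<Sum>i<c. \<Sum>m<d. g m)"
  proof (induction c)
    case (Suc c)
    have "(\<Sum>m<d * Suc c. g m) = (\<Sum>m<d * c + d. g m)" by (simp add: add.commute)
    also have "\<dots> = (\<Sum>m<d * c. g m) + (\<Sum>m<d. g (d * c + m))"
    proof -
      have "(\<Sum>m<d * c + d. g m) = (\<Sum>m=0..<d * c. g m) + (\<Sum>m=0 + d * c..<d + d * c. g m)"
        by (simp add: lessThan_atLeast0 sum.atLeastLessThan_concat add.commute)
      also have "(\<Sum>m=0 + d * c..<d + d * c. g m) = (\<Sum>m=0..<d. g (m + d * c))"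
        by (rule sum.shift_bounds_nat_ivl)
      finally show ?thesis by (simp add: lessThan_atLeast0 add.commute)
    qed
    also have "(\<Sum>m<d. g (d * c + m)) = (\<Sum>m<d. g m)"
      by (intro sum.cong refl) (metis assms mod_mult_self4 mult.commute)
    finally show ?case using Suc by (simp add: distrib_right add.commute)
  qed simp
  finally show ?thesis by simp
qed

text \<open>Complete periods are evaluated exactly. The remainder and the matching fraction of a
  period in the main term are each at most the sum of norms over one period, whence the factor 2 and
  an error independent of \<open>H\<close>.\<close>

lemma sum_prod_periodic_approx:
  fixes u :: "nat \<Rightarrow> nat \<Rightarrow> 'a::real_normed_field"
  assumes S: "finite S" "\<And>p. p \<in> S \<Longrightarrow> prime p"
    and per: "\<And>p m. p \<in> S \<Longrightarrow> u p (m mod p) = u p m"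
  shows "norm ((\<Sum>m<H. \<Prod>p\<in>S. u p m) - of_nat H * (\<Prod>p\<in>S. (\<Sum>m<p. u p m) / of_nat p))
    \<le> 2 * (\<Prod>p\<in>S. \<Sum>m<p. norm (u p m))"
proof -
  define d where "d = \<Prod>S"
  define g where "g m = (\<Prod>p\<in>S. u p m)" for m
  have d: "d > 0" using S by (auto simp: d_def intro!: prod_pos prime_gt_0_nat)
  have g: "g (m mod d) = g m" for m
    unfolding g_def d_def using S per by (intro prod_periodic)
  define G where "G = (\<Sum>m<d. g m)"
  define A where "A = (\<Sum>m<d. norm (g m))"
  have G: "G = (\<Prod>p\<in>S. \<Sum>m<p. u p m)"
    unfolding G_def d_def g_def using S per by (intro sum_prod_full_period)
  have A: "A = (\<Prod>p\<in>S. \<Sum>m<p. norm (u p m))"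
    unfolding A_def d_def g_def prod_norm[symmetric] using S per by (intro sum_prod_full_period) auto
  have GA: "norm G \<le> A" unfolding G_def A_def by (rule norm_sum)
  have H: "H = (H div d) * d + H mod d" by simp
  have "(\<Sum>m<H. g m) = (\<Sum>m<(H div d) * d. g m) + (\<Sum>m=(H div d) * d..<H. g m)"
    using div_times_less_eq_dividend by (simp add: lessThan_atLeast0 sum.atLeastLessThan_concat)
  also have "(\<Sum>m<(H div d) * d. g m) = of_nat (H div d) * G"
    unfolding G_def by (rule sum_periodic_blocks) (rule g)
  also have "(\<Sum>m=(H div d) * d..<H. g m) = (\<Sum>m<H mod d. g m)"
  proof -
    have "(\<Sum>m=(H div d) * d..<H. g m) = (\<Sum>m=0+(H div d) * d..<H mod d + (H div d) * d. g m)"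
      by (simp add: add.commute)
    also have "\<dots> = (\<Sum>m=0..<H mod d. g (m + (H div d) * d))"
      by (rule sum.shift_bounds_nat_ivl)
    also have "\<dots> = (\<Sum>m<H mod d. g m)"
      unfolding lessThan_atLeast0 by (intro sum.cong refl) (metis g mod_mult_self1)
    finally show ?thesis .
  qed
  finally have eq: "(\<Sum>m<H. g m) = of_nat (H div d) * G + (\<Sum>m<H mod d. g m)" .
  have "of_nat H * (G / of_nat d) = of_nat (H div d) * G + of_nat (H mod d) / of_nat d * G"
  proof -
    have "(of_nat H :: 'a) = of_nat (H div d) * of_nat d + of_nat (H mod d)"
      by (metis H of_nat_add of_nat_mult)
    then show ?thesis using d by (simp add: field_simps)
  qed
  then have "(\<Sum>m<H. g m) - of_nat H * (G / of_nat d)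
      = (\<Sum>m<H mod d. g m) - of_nat (H mod d) / of_nat d * G"
    unfolding eq by (simp only: add_diff_add diff_self add_0_left)
  also have "norm \<dots> \<le> A + 1 * A"
  proof (intro norm_triangle_le_diff add_mono)
    show "norm (\<Sum>m<H mod d. g m) \<le> A"
      unfolding A_def using d
      by (intro order_trans[OF norm_sum] sum_mono2) (auto dest: less_trans[OF _ mod_less_divisor])
    show "norm (of_nat (H mod d) / of_nat d * G) \<le> 1 * A"
      using GA d mod_less_divisor[of d H] unfolding norm_mult norm_divide norm_of_nat
      by (intro mult_mono) auto
  qed
  also have "of_nat H * (G / of_nat d) = of_nat H * (\<Prod>p\<in>S. (\<Sum>m<p. u p m) / of_nat p)"
    unfolding G d_def by (simp add: prod_dividef)
  finally show ?thesis unfolding g_def A by simp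
qed

text \<open>Choosing one subset in each of the disjoint sets \<open>P i\<close> amounts to choosing
  their union, so the expanded product is again a sum of monomials in distinct primes.\<close>

lemma prod_sum_families:
  fixes v :: "'a \<Rightarrow> 'b::comm_semiring_1"
  assumes "finite I" "\<And>i. i \<in> I \<Longrightarrow> finite (P i)" "\<And>i. i \<in> I \<Longrightarrow> F i \<subseteq> Pow (P i)"
    and "disjoint_family_on P I"
  shows "(\<Prod>i\<in>I. \<Sum>S\<in>F i. \<Prod>p\<in>S. v p) = (\<Sum>\<sigma>\<in>PiE I F. \<Prod>p\<in>(\<Union>i\<in>I. \<sigma> i). v p)"
proof -
  have "(\<Prod>i\<in>I. \<Sum>S\<in>F i. \<Prod>p\<in>S. v p) = (\<Sum>\<sigma>\<in>PiE I F. \<Prod>i\<in>I. \<Prod>p\<in>\<sigma> i. v p)"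
    using assms by (intro prod_sum_PiE) (auto intro: finite_subset)
  also have "\<dots> = (\<Sum>\<sigma>\<in>PiE I F. \<Prod>p\<in>(\<Union>i\<in>I. \<sigma> i). v p)"
  proof (intro sum.cong refl)
    fix \<sigma> assume "\<sigma> \<in> PiE I F"
    then have \<sigma>: "\<sigma> i \<subseteq> P i" if "i \<in> I" for i using assms(3) that by (auto simp: PiE_def)
    show "(\<Prod>i\<in>I. \<Prod>p\<in>\<sigma> i. v p) = (\<Prod>p\<in>(\<Union>i\<in>I. \<sigma> i). v p)"
    proof (rule prod.UNION_disjoint[symmetric])
      show "\<forall>i\<in>I. finite (\<sigma> i)" using assms(2) \<sigma> finite_subset by blast
      show "\<forall>i\<in>I. \<forall>j\<in>I. i \<noteq> j \<longrightarrow> \<sigma> i \<inter> \<sigma> j = {}"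
        using assms(4) \<sigma> unfolding disjoint_family_on_def by blast
    qed fact
  qed
  finally show ?thesis .
qed

text \<open>The periodic estimate applied to each monomial. The families \<open>F i\<close> and the
  field are left general because the lemma serves twice: for the complex truncated expansion and for
  the real majorant of its error.\<close>

lemma sum_prod_families_approx:
  fixes u :: "nat \<Rightarrow> nat \<Rightarrow> 'a::real_normed_field"
  assumes I: "finite I" "\<And>i. i \<in> I \<Longrightarrow> finite (P i)" "\<And>i. i \<in> I \<Longrightarrow> F i \<subseteq> Pow (P i)"
      "disjoint_family_on P I"
    and pr: "\<And>i p. i \<in> I \<Longrightarrow> p \<in> P i \<Longrightarrow> prime p"
    and per: "\<And>i p m. i \<in> I \<Longrightarrow> p \<in> P i \<Longrightarrow> u p (m mod p) = u p m"
  shows "norm ((\<Sum>m<H. \<Prod>i\<in>I. \<Sum>S\<in>F i. \<Prod>p\<in>S. u p m)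
      - of_nat H * (\<Prod>i\<in>I. \<Sum>S\<in>F i. \<Prod>p\<in>S. (\<Sum>m<p. u p m) / of_nat p))
    \<le> 2 * (\<Prod>i\<in>I. \<Sum>S\<in>F i. \<Prod>p\<in>S. \<Sum>m<p. norm (u p m))"
proof -
  let ?U = "\<lambda>\<sigma>. \<Union>i\<in>I. \<sigma> i"
  have eqc: "(\<Prod>i\<in>I. \<Sum>S\<in>F i. \<Prod>p\<in>S. v p) = (\<Sum>\<sigma>\<in>PiE I F. \<Prod>p\<in>?U \<sigma>. v p)"
    for v :: "nat \<Rightarrow> 'a"
    by (rule prod_sum_families) (use I in auto)
  have eqr: "(\<Prod>i\<in>I. \<Sum>S\<in>F i. \<Prod>p\<in>S. v p) = (\<Sum>\<sigma>\<in>PiE I F. \<Prod>p\<in>?U \<sigma>. v p)"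
    for v :: "nat \<Rightarrow> real"
    by (rule prod_sum_families) (use I in auto)
  have "(\<Sum>m<H. \<Prod>i\<in>I. \<Sum>S\<in>F i. \<Prod>p\<in>S. u p m)
      - of_nat H * (\<Prod>i\<in>I. \<Sum>S\<in>F i. \<Prod>p\<in>S. (\<Sum>m<p. u p m) / of_nat p)
     = (\<Sum>\<sigma>\<in>PiE I F. (\<Sum>m<H. \<Prod>p\<in>?U \<sigma>. u p m)
          - of_nat H * (\<Prod>p\<in>?U \<sigma>. (\<Sum>m<p. u p m) / of_nat p))"
    unfolding eqc sum_subtractf by (simp only: sum.swap[of _ _ "{..<H}"] sum_distrib_left)
  also have "norm \<dots> \<le> (\<Sum>\<sigma>\<in>PiE I F. 2 * (\<Prod>p\<in>?U \<sigma>. \<Sum>m<p. norm (u p m)))"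
  proof (intro order_trans[OF norm_sum] sum_mono sum_prod_periodic_approx)
    fix \<sigma> assume "\<sigma> \<in> PiE I F"
    then have \<sigma>: "\<sigma> i \<subseteq> P i" if "i \<in> I" for i using I(3) that by (auto simp: PiE_def)
    show "finite (?U \<sigma>)" using I \<sigma> by (meson finite_UN finite_subset)
    show "prime p" if "p \<in> ?U \<sigma>" for p using that \<sigma> pr by blast
    show "u p (m mod p) = u p m" if "p \<in> ?U \<sigma>" for p m using that \<sigma> per by blast
  qed
  also have "\<dots> = 2 * (\<Prod>i\<in>I. \<Sum>S\<in>F i. \<Prod>p\<in>S. \<Sum>m<p. norm (u p m))"
    unfolding eqr by (simp add: sum_distrib_left)
  finally show ?thesis .
qed

text \<open>Puts a factor of the majorant into the shape of a sum over a family of subsets; the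
  empty set supplies the \<open>1\<close>.\<close>

lemma one_plus_elem_sym:
  assumes "finite A"
  shows "(\<Sum>S | S \<subseteq> A \<and> (card S = 0 \<or> card S = Suc b). \<Prod>p\<in>S. v p) = 1 + elem_sym (Suc b) A v"
proof -
  have "{S. S \<subseteq> A \<and> (card S = 0 \<or> card S = Suc b)} =
      {S. S \<subseteq> A \<and> card S = 0} \<union> {S. S \<subseteq> A \<and> card S = Suc b}" by auto
  moreover have "{S. S \<subseteq> A \<and> card S = 0} \<inter> {S. S \<subseteq> A \<and> card S = Suc b} = {}" by auto
  ultimately have "(\<Sum>S | S \<subseteq> A \<and> (card S = 0 \<or> card S = Suc b). \<Prod>p\<in>S. v p)
      = elem_sym 0 A v + elem_sym (Suc b) A v"
    using assms unfolding elem_sym_def by (simp only:) (intro sum.union_disjoint, auto)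
  then show ?thesis using assms by (simp add: elem_sym_0)
qed

text \<open>
  The factors \<open>X p\<close> and the majorants \<open>1 + elem_sym\<close> of the truncation error are both low-degree
  polynomials in the functions \<open>X p - 1\<close>, so both can be averaged by the Chinese remainder theorem. The
  last term collects the error from incomplete periods.
\<close>

lemma norm_sum_prod_le:
  fixes X :: "nat \<Rightarrow> nat \<Rightarrow> complex" and P :: "nat \<Rightarrow> nat set" and b :: "nat \<Rightarrow> nat" and \<kappa> :: real
  assumes I: "finite I" "\<And>i. i \<in> I \<Longrightarrow> finite (P i)" "disjoint_family_on P I"
    and pr: "\<And>i p. i \<in> I \<Longrightarrow> p \<in> P i \<Longrightarrow> prime p"
    and per: "\<And>i p m. i \<in> I \<Longrightarrow> p \<in> P i \<Longrightarrow> X p (m mod p) = X p m"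
    and X1: "\<And>i p m. i \<in> I \<Longrightarrow> p \<in> P i \<Longrightarrow> norm (X p m) \<le> 1"
    and \<kappa>: "\<And>i p. i \<in> I \<Longrightarrow> p \<in> P i \<Longrightarrow> (\<Sum>m<p. norm (X p m - 1)) \<le> \<kappa>"
  shows "norm (\<Sum>m<H. \<Prod>i\<in>I. \<Prod>p\<in>P i. X p m)
    \<le> real H * norm (\<Prod>i\<in>I. \<Prod>p\<in>P i. (\<Sum>m<p. X p m) / of_nat p)
      + 2 * real H * ((\<Prod>i\<in>I. 1 + elem_sym (Suc (b i)) (P i) (\<lambda>p. \<kappa> / real p)) - 1)
      + 4 * (\<Prod>i\<in>I. \<Sum>S | S \<subseteq> P i \<and> card S \<le> Suc (b i). \<kappa> ^ card S)"
proof -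
  define u where "u p m = X p m - 1" for p m
  define s where "s p = (\<Sum>m<p. u p m)" for p
  define a where "a p = (\<Sum>m<p. norm (u p m))" for p
  define W where "W m = (\<Prod>i\<in>I. \<Prod>p\<in>P i. X p m)" for m
  define T where "T m = (\<Prod>i\<in>I. trunc_poly (b i) (P i) (\<lambda>p. u p m))" for m
  define R where "R v = (\<Prod>i\<in>I. 1 + elem_sym (Suc (b i)) (P i) v)" for v :: "nat \<Rightarrow> real"
  define T0 where "T0 = (\<Prod>i\<in>I. trunc_poly (b i) (P i) (\<lambda>p. s p / of_nat p))"
  define W0 where "W0 = (\<Prod>i\<in>I. \<Prod>p\<in>P i. 1 + s p / of_nat p)"
  define D where "D = (\<Prod>i\<in>I. \<Sum>S | S \<subseteq> P i \<and> card S \<le> Suc (b i). \<kappa> ^ card S)"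
  define R0 where "R0 = R (\<lambda>p. \<kappa> / real p)"

  have a: "0 \<le> a p" "a p \<le> \<kappa>" if "i \<in> I" "p \<in> P i" for i p
    using \<kappa>[OF that] by (auto simp: a_def u_def intro: sum_nonneg)
  have s: "norm (s p) \<le> a p" for p
    unfolding s_def a_def by (rule norm_sum)
  have p0: "p > 0" if "i \<in> I" "p \<in> P i" for i p
    using pr[OF that] by (rule prime_gt_0_nat)
  have sX: "1 + s p / of_nat p = (\<Sum>m<p. X p m) / of_nat p" if "i \<in> I" "p \<in> P i" for i p
    using p0[OF that] by (simp add: s_def u_def sum_subtractf field_simps)
  have sX1: "norm (1 + s p / of_nat p) \<le> 1" if "i \<in> I" "p \<in> P i" for i p
  proof -
    have "norm (\<Sum>m<p. X p m) \<le> (\<Sum>m<p. 1)"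
      using X1[OF that] by (intro order_trans[OF norm_sum] sum_mono)
    then show ?thesis unfolding sX[OF that] using p0[OF that] by (simp add: norm_divide)
  qed
  have R_mono: "R v \<le> R w" if "\<And>i p. i \<in> I \<Longrightarrow> p \<in> P i \<Longrightarrow> 0 \<le> v p \<and> v p \<le> w p" for v w
    unfolding R_def using that
    by (intro prod_mono conjI add_left_mono elem_sym_mono add_nonneg_nonneg elem_sym_nonneg) auto

  have WT: "norm (T m - W m) \<le> R (\<lambda>p. norm (u p m)) - 1" for m
    unfolding T_def W_def R_def
  proof (rule norm_prod_diff_le_prod[OF I(1)])
    show "norm (\<Prod>p\<in>P i. X p m) \<le> 1" if "i \<in> I" for i
      using X1[OF that] by (intro norm_prod_le_1)
    show "norm (trunc_poly (b i) (P i) (\<lambda>p. u p m) - (\<Prod>p\<in>P i. X p m))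
        \<le> elem_sym (Suc (b i)) (P i) (\<lambda>p. norm (u p m))" if "i \<in> I" for i
      using norm_prod_minus_trunc_poly[of "P i" "\<lambda>p. u p m" "b i"] I(2)[OF that] X1[OF that]
      by (simp add: u_def norm_minus_commute)
  qed
  \<comment> \<open>The same truncation bound, now for the means: \<open>1 + s p / p\<close> is an
    average of values of \<open>X p\<close>, so it lies in the disc too.\<close>
  have WT0: "norm (T0 - W0) \<le> R0 - 1"
  proof -
    have "norm (T0 - W0) \<le> R (\<lambda>p. norm (s p / of_nat p)) - 1"
      unfolding T0_def W0_def R_def
    proof (rule norm_prod_diff_le_prod[OF I(1)])
      show "norm (\<Prod>p\<in>P i. 1 + s p / of_nat p) \<le> 1" if "i \<in> I" for i
        using sX1[OF that] by (intro norm_prod_le_1)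
      show "norm (trunc_poly (b i) (P i) (\<lambda>p. s p / of_nat p) - (\<Prod>p\<in>P i. 1 + s p / of_nat p))
          \<le> elem_sym (Suc (b i)) (P i) (\<lambda>p. norm (s p / of_nat p))" if "i \<in> I" for i
        using norm_prod_minus_trunc_poly[of "P i" "\<lambda>p. s p / of_nat p" "b i"] I(2)[OF that] sX1[OF that]
        by (simp add: norm_minus_commute)
    qed
    also have "R (\<lambda>p. norm (s p / of_nat p)) \<le> R0"
      unfolding R0_def
    proof (intro R_mono conjI)
      show "norm (s p / of_nat p) \<le> \<kappa> / real p" if "i \<in> I" "p \<in> P i" for i p
        using order_trans[OF s a(2)[OF that]] by (simp add: norm_divide divide_right_mono)
    qed auto
    finally show ?thesis by simp
  qed

  \<comment> \<open>\<open>D\<close> must dominate the incomplete-period errors of both averages: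
    monomials of degree at most \<open>b i\<close> from \<open>T\<close>, and of degree
    \<open>0\<close> or \<open>Suc (b i)\<close> from \<open>R\<close>. Hence the degree
    \<open>Suc (b i)\<close> in \<open>D\<close>.\<close>
  have D_le: "(\<Prod>i\<in>I. \<Sum>S | S \<subseteq> P i \<and> Q i (card S). \<Prod>p\<in>S. a p) \<le> D"
    if "\<And>i c. Q i c \<Longrightarrow> c \<le> Suc (b i)" for Q :: "nat \<Rightarrow> nat \<Rightarrow> bool"
    unfolding D_def
  proof (intro prod_mono conjI sum_nonneg prod_nonneg ballI)
    fix i assume i: "i \<in> I"
    show "0 \<le> a p" if "S \<in> {S. S \<subseteq> P i \<and> Q i (card S)}" "p \<in> S" for S p
      using that i a by auto
    \<comment> \<open>The sign of \<open>\<kappa>\<close> comes from an element of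
      \<open>P i\<close>, where \<open>\<kappa>\<close> bounds a sum of norms. For the empty set the
      power is \<open>1\<close> in any case.\<close>
    have \<kappa>0: "0 \<le> \<kappa>" if "S \<subseteq> P i" "card S > 0" for S
    proof -
      from that obtain p where "p \<in> P i" by (metis card_gt_0_iff ex_in_conv subsetD)
      then show ?thesis using a i by force
    qed
    have k0: "0 \<le> \<kappa> ^ card S" if "S \<subseteq> P i" for S
      using \<kappa>0[OF that] by (cases "card S > 0") auto
    have "(\<Sum>S | S \<subseteq> P i \<and> Q i (card S). \<Prod>p\<in>S. a p)
        \<le> (\<Sum>S | S \<subseteq> P i \<and> Q i (card S). \<Prod>p\<in>S. \<kappa>)"
      using a i by (intro sum_mono prod_mono) auto
    also have "\<dots> \<le> (\<Sum>S | S \<subseteq> P i \<and> card S \<le> Suc (b i). \<kappa> ^ card S)"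
      unfolding prod_constant using that I(2)[OF i] k0 by (intro sum_mono2) auto
    finally show "(\<Sum>S | S \<subseteq> P i \<and> Q i (card S). \<Prod>p\<in>S. a p)
        \<le> (\<Sum>S | S \<subseteq> P i \<and> card S \<le> Suc (b i). \<kappa> ^ card S)" .
  qed

  have "norm ((\<Sum>m<H. T m) - of_nat H * T0)
      \<le> 2 * (\<Prod>i\<in>I. \<Sum>S | S \<subseteq> P i \<and> card S \<le> b i. \<Prod>p\<in>S. a p)"
    unfolding T_def T0_def trunc_poly_def s_def a_def using I pr per
    by (intro sum_prod_families_approx) (auto simp: u_def)
  also have "\<dots> \<le> 2 * D" using D_le[of "\<lambda>i c. c \<le> b i"] by simp
  finally have TT: "norm ((\<Sum>m<H. T m) - of_nat H * T0) \<le> 2 * D" .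

  have R_eq: "R v = (\<Prod>i\<in>I. \<Sum>S | S \<subseteq> P i \<and> (card S = 0 \<or> card S = Suc (b i)). \<Prod>p\<in>S. v p)" for v
    unfolding R_def using I by (intro prod.cong refl one_plus_elem_sym[symmetric])
  have "norm ((\<Sum>m<H. R (\<lambda>p. norm (u p m))) - of_nat H * R (\<lambda>p. a p / of_nat p))
      \<le> 2 * (\<Prod>i\<in>I. \<Sum>S | S \<subseteq> P i \<and> (card S = 0 \<or> card S = Suc (b i)).
              \<Prod>p\<in>S. \<Sum>m<p. norm (norm (u p m)))"
    unfolding R_eq a_def using I pr per
    by (intro sum_prod_families_approx) (auto simp: u_def)
  also have "\<dots> \<le> 2 * D"
  proof -
    have "(\<Prod>i\<in>I. \<Sum>S | S \<subseteq> P i \<and> (card S = 0 \<or> card S = Suc (b i)). \<Prod>p\<in>S. a p) \<le> D"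
      by (rule D_le[where Q = "\<lambda>i c. c = 0 \<or> c = Suc (b i)"]) auto
    then show ?thesis by (simp add: a_def)
  qed
  finally have "(\<Sum>m<H. R (\<lambda>p. norm (u p m))) \<le> real H * R (\<lambda>p. a p / real p) + 2 * D"
    by (simp add: abs_le_iff)
  moreover have "R (\<lambda>p. a p / real p) \<le> R0"
    unfolding R0_def using a by (intro R_mono conjI divide_right_mono divide_nonneg_nonneg) auto
  ultimately have RR: "(\<Sum>m<H. R (\<lambda>p. norm (u p m))) \<le> real H * R0 + 2 * D"
    using mult_left_mono[of _ R0 "real H"] by force

  \<comment> \<open>The chain is: \<open>W\<close> to \<open>T\<close> pointwise, \<open>T\<close>
    to its mean \<open>T0\<close>, and \<open>T0\<close> back to \<open>W0\<close>. Both truncation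
    steps cost \<open>H * (R0 - 1)\<close>, and both averagings, of \<open>T\<close> and of
    \<open>R\<close>, cost \<open>2 * D\<close>.\<close>
  have "norm (\<Sum>m<H. W m) \<le> norm (\<Sum>m<H. T m) + norm (\<Sum>m<H. T m - W m)"
    using norm_triangle_ineq4[of "\<Sum>m<H. T m" "\<Sum>m<H. T m - W m"] by (simp add: sum_subtractf)
  also have "norm (\<Sum>m<H. T m - W m) \<le> (\<Sum>m<H. R (\<lambda>p. norm (u p m)) - 1)"
    using WT by (intro order_trans[OF norm_sum] sum_mono)
  also have "\<dots> \<le> real H * (R0 - 1) + 2 * D"
    using RR by (simp add: sum_subtractf algebra_simps)
  also have "norm (\<Sum>m<H. T m) \<le> norm (of_nat H * T0) + 2 * D"
    using TT norm_triangle_sub[of "\<Sum>m<H. T m" "of_nat H * T0"] by linarith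
  also have "norm (of_nat H * T0) \<le> real H * (norm W0 + (R0 - 1))"
    using WT0 norm_triangle_sub[of T0 W0] unfolding norm_mult norm_of_nat
    by (intro mult_left_mono) auto
  finally have "norm (\<Sum>m<H. W m) \<le> real H * norm W0 + 2 * real H * (R0 - 1) + 4 * D"
    by (simp add: algebra_simps)
  moreover have "W0 = (\<Prod>i\<in>I. \<Prod>p\<in>P i. (\<Sum>m<p. X p m) / of_nat p)"
    unfolding W0_def by (intro prod.cong refl) (rule sX)
  ultimately show ?thesis
    unfolding R0_def R_def W_def D_def by simp
qed

section \<open>Sums of reciprocals of primes\<close>

lemma prod_primes_dvd:
  fixes N :: nat
  assumes "finite S" "\<And>p. p \<in> S \<Longrightarrow> prime p \<and> p dvd N"
  shows "\<Prod>S dvd N"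
  using assms
proof (induction S rule: finite_induct)
  case (insert p S)
  then show ?case
    using prod_primes_coprime[of S p] by (auto intro!: divides_mult)
qed simp

definition dyadic_primes :: "nat \<Rightarrow> nat set" where
  "dyadic_primes l = {p. prime p \<and> 2 ^ l < p \<and> p \<le> 2 ^ Suc l}"

lemma finite_dyadic_primes: "finite (dyadic_primes l)"
  by (rule finite_subset[of _ "{..2 ^ Suc l}"]) (auto simp: dyadic_primes_def)

text \<open>Chebyshev's argument: with \<open>n = 2 ^ l\<close>, the primes in
  \<open>(n, 2n]\<close> all divide the central binomial coefficient, which is at most
  \<open>2 ^ (2 * n)\<close>, while each exceeds \<open>n\<close>.\<close>

lemma card_dyadic_primes: "l * card (dyadic_primes l) \<le> 2 ^ Suc l"
proof -
  define n :: nat where "n = 2 ^ l"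
  have "\<Prod>(dyadic_primes l) dvd (2 * n) choose n"
  proof (intro prod_primes_dvd finite_dyadic_primes conjI)
    fix p assume "p \<in> dyadic_primes l"
    then have p: "prime p" "n < p" "p \<le> 2 * n" by (auto simp: dyadic_primes_def n_def)
    then show "prime p" by simp
    have "p dvd fact (2 * n)" using p by (simp add: prime_dvd_fact_iff)
    moreover have "fact (2 * n) = fact n * fact n * ((2 * n) choose n)"
      using binomial_fact_lemma[of n "2 * n"] by simp
    ultimately have "p dvd fact n * fact n * ((2 * n) choose n)" by simp
    then show "p dvd (2 * n) choose n"
      using p by (simp add: prime_dvd_mult_iff prime_dvd_fact_iff)
  qed
  then have "\<Prod>(dyadic_primes l) \<le> (2 * n) choose n"
    by (intro dvd_imp_le) auto
  also have "\<dots> \<le> 2 ^ (2 * n)" by (rule binomial_le_pow2)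
  finally have le: "\<Prod>(dyadic_primes l) \<le> 2 ^ (2 * n)" .
  have "2 ^ (l * card (dyadic_primes l)) = (\<Prod>p\<in>dyadic_primes l. n)"
    by (simp add: n_def power_mult)
  also have "\<dots> \<le> \<Prod>(dyadic_primes l)"
    by (intro prod_mono) (auto simp: dyadic_primes_def n_def)
  finally have "(2::nat) ^ (l * card (dyadic_primes l)) \<le> 2 ^ (2 * n)" using le by linarith
  then show ?thesis by (simp add: n_def)
qed

lemma sum_inverse_dyadic_primes:
  assumes "l > 0"
  shows "(\<Sum>p\<in>dyadic_primes l. 1 / real p) \<le> 2 / real l"
proof -
  have "(\<Sum>p\<in>dyadic_primes l. 1 / real p) \<le> (\<Sum>p\<in>dyadic_primes l. 1 / 2 ^ l)"
  proof (intro sum_mono divide_left_mono)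
    fix p assume "p \<in> dyadic_primes l"
    then have "2 ^ l < p" by (simp add: dyadic_primes_def)
    then have "real (2 ^ l) \<le> real p" by (intro of_nat_mono) simp
    then show "2 ^ l \<le> real p" by simp
    then show "0 < real p * 2 ^ l" by (simp add: less_le_trans[of 0 "2 ^ l"])
  qed simp
  also have "\<dots> = real (card (dyadic_primes l)) / 2 ^ l" by simp
  also have "\<dots> \<le> 2 / real l"
  proof -
    have "real (l * card (dyadic_primes l)) \<le> real (2 ^ Suc l)"
      using card_dyadic_primes by (rule of_nat_mono)
    then show ?thesis using assms by (simp add: field_simps)
  qed
  finally show ?thesis .
qed

text \<open>Each of the \<open>v\<close> dyadic intervals contributes at most \<open>2 / a\<close>.
  Keeping the first denominator throughout is harmless in both uses: \<open>v = a\<close> for one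
  block, and bounded \<open>v\<close> just beyond \<open>x\<close>.\<close>

lemma sum_inverse_primes_pow2:
  assumes "a > 0"
  shows "(\<Sum>p | prime p \<and> 2 ^ a < p \<and> p \<le> 2 ^ (a + v). 1 / real p) \<le> 2 * real v / real a"
proof (induction v)
  case 0
  have "{p::nat. prime p \<and> 2 ^ a < p \<and> p \<le> 2 ^ (a + 0)} = {}" by auto
  then show ?case unfolding \<open>_ = {}\<close> by simp
next
  case (Suc v)
  let ?A = "\<lambda>v. {p::nat. prime p \<and> 2 ^ a < p \<and> p \<le> 2 ^ (a + v)}"
  have "?A (Suc v) \<subseteq> ?A v \<union> dyadic_primes (a + v)" by (auto simp: dyadic_primes_def)
  moreover have fin: "finite (?A v)" for v by (rule finite_subset[of _ "{..2 ^ (a + v)}"]) auto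
  ultimately have "(\<Sum>p\<in>?A (Suc v). 1 / real p) \<le> (\<Sum>p\<in>?A v \<union> dyadic_primes (a + v). 1 / real p)"
    using finite_dyadic_primes by (intro sum_mono2) auto
  also have "\<dots> \<le> (\<Sum>p\<in>?A v. 1 / real p) + (\<Sum>p\<in>dyadic_primes (a + v). 1 / real p)"
    using fin finite_dyadic_primes by (subst sum_Un) (auto intro!: sum_nonneg)
  also have "\<dots> \<le> 2 * real v / real a + 2 / real (a + v)"
    using Suc assms by (intro add_mono sum_inverse_dyadic_primes) auto
  also have "2 / real (a + v) \<le> 2 / real a"
    using assms by (intro divide_left_mono) auto
  finally show ?case by (simp add: add_divide_distrib[symmetric] add.commute)
qed

text \<open>Block \<open>0\<close> is \<open>{3}\<close>, so the prime \<open>2\<close> lies in no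
  block; the primes sieved later all exceed \<open>4\<close>.\<close>

definition block_primes :: "nat \<Rightarrow> nat set" where
  "block_primes i = {p. prime p \<and> 2 ^ 2 ^ i < p \<and> p \<le> 2 ^ 2 ^ Suc i}"

lemma finite_block_primes: "finite (block_primes i)"
  by (rule finite_subset[of _ "{..2 ^ 2 ^ Suc i}"]) (auto simp: block_primes_def)

lemma sum_inverse_block_primes: "(\<Sum>p\<in>block_primes i. 1 / real p) \<le> 2"
proof -
  have "block_primes i = {p. prime p \<and> 2 ^ 2 ^ i < p \<and> p \<le> 2 ^ (2 ^ i + 2 ^ i)}"
    by (simp add: block_primes_def mult_2)
  then show ?thesis using sum_inverse_primes_pow2[of "2 ^ i" "2 ^ i"] by simp
qed

lemma prime_in_block:
  assumes "prime p" "p > 2"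
  obtains i where "p \<in> block_primes i"
proof -
  have ex: "\<exists>i. p \<le> 2 ^ 2 ^ Suc i"
  proof
    have "p < 2 ^ p" by simp
    also have "\<dots> \<le> 2 ^ 2 ^ Suc p"
      by (intro power_increasing) (use less_exp[of "Suc p"] in auto)
    finally show "p \<le> 2 ^ 2 ^ Suc p" by simp
  qed
  define i where "i = (LEAST i. p \<le> 2 ^ 2 ^ Suc i)"
  have 1: "p \<le> 2 ^ 2 ^ Suc i" unfolding i_def using ex by (rule LeastI_ex)
  have "2 ^ 2 ^ i < p"
  proof (cases i)
    case 0
    then show ?thesis using assms by simp
  next
    case (Suc j)
    then have "\<not> p \<le> 2 ^ 2 ^ Suc j" unfolding i_def by (intro not_less_Least) simp
    then show ?thesis using Suc by simp
  qed
  with 1 assms show ?thesis by (intro that) (auto simp: block_primes_def)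
qed

lemma disjoint_family_block_primes: "disjoint_family_on block_primes I"
proof -
  have *: "block_primes i \<inter> block_primes j = {}" if "i < j" for i j
  proof -
    have "(2::nat) ^ 2 ^ Suc i \<le> 2 ^ 2 ^ j" using that by (intro power_increasing) auto
    then show ?thesis by (auto simp: block_primes_def simp del: power_Suc power_increasing_iff)
  qed
  show ?thesis unfolding disjoint_family_on_def
    using * by (metis Int_commute linorder_neqE_nat)
qed

text \<open>Passing from \<open>x powr \<epsilon>\<close> to \<open>x\<close> raises
  \<open>log 2 (log 2 _)\<close> by \<open>log 2 (1 / \<epsilon>)\<close>, so at most that many
  blocks plus 2, for rounding at the ends, meet the range, and each contributes at most 2. The
  \<open>max 0\<close> covers \<open>\<epsilon> > 1\<close>, where the range is empty.\<close>

lemma sum_inverse_primes_powr_le: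
  fixes x \<epsilon> :: real
  assumes "0 < \<epsilon>" "x powr \<epsilon> \<ge> 2" "x \<ge> 2"
  shows "(\<Sum>p | prime p \<and> x powr \<epsilon> < real p \<and> real p \<le> x. 1 / real p) \<le> 2 * (max 0 (log 2 (1 / \<epsilon>)) + 2)"
proof (cases "\<epsilon> \<le> 1")
  case False
  have "x powr 1 \<le> x powr \<epsilon>" using assms False by (intro powr_mono) auto
  then have "{p. prime p \<and> x powr \<epsilon> < real p \<and> real p \<le> x} = {}" using assms by auto
  then show ?thesis by (simp only: sum.empty) simp
next
  case True
  define L where "L = log 2 (log 2 (x powr \<epsilon>))"
  define U where "U = log 2 (log 2 x)"
  have y1: "log 2 (x powr \<epsilon>) \<ge> 1" using assms by simp
  have L0: "L \<ge> 0" unfolding L_def using y1 by simp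
  have x1: "log 2 x \<ge> 1" using assms by simp
  have UL: "U = L + log 2 (1 / \<epsilon>)"
  proof -
    have "log 2 (\<epsilon> * log 2 x) = log 2 \<epsilon> + log 2 (log 2 x)"
      using assms x1 by (intro log_mult_pos) auto
    moreover have "log 2 (1 / \<epsilon>) = - log 2 \<epsilon>"
      using assms by (simp add: log_divide_pos)
    ultimately show ?thesis unfolding L_def U_def using assms by (simp add: log_powr)
  qed
  have UL': "L \<le> U" unfolding UL using assms True by simp
  let ?J = "{nat \<lfloor>L\<rfloor>..<nat \<lceil>U\<rceil>}"
  have "{p. prime p \<and> x powr \<epsilon> < real p \<and> real p \<le> x} \<subseteq> (\<Union>i\<in>?J. block_primes i)"
  proof
    fix p assume "p \<in> {p. prime p \<and> x powr \<epsilon> < real p \<and> real p \<le> x}"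
    then have p: "prime p" "x powr \<epsilon> < real p" "real p \<le> x" by auto
    then obtain i where i: "p \<in> block_primes i"
      using assms prime_in_block[of p] by auto
    then have "2 ^ 2 ^ i < p" "p \<le> 2 ^ 2 ^ Suc i" by (auto simp: block_primes_def)
    then have "real (2 ^ 2 ^ i) < real p" "real p \<le> real (2 ^ 2 ^ Suc i)" by (simp_all only: of_nat_less_iff of_nat_le_iff)
    then have *: "2 ^ 2 ^ i < real p" "real p \<le> 2 ^ 2 ^ Suc i" by simp_all
    have "2 ^ 2 ^ i < x" using *(1) p(3) by (rule less_le_trans)
    then have "log 2 (2 ^ 2 ^ i) < log 2 x" by (intro log_less) auto
    then have "2 ^ i < log 2 x" by (simp add: log_nat_power)
    then have "log 2 (2 ^ i) < U" unfolding U_def by (intro log_less) auto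
    then have iU: "real i < U" by (simp add: log_nat_power)
    have "x powr \<epsilon> < 2 ^ 2 ^ Suc i" using p(2) *(2) by (rule less_le_trans)
    then have "log 2 (x powr \<epsilon>) < log 2 (2 ^ 2 ^ Suc i)" using assms by (intro log_less) auto
    then have "log 2 (x powr \<epsilon>) < 2 ^ Suc i" by (simp add: log_nat_power)
    then have "L < log 2 (2 ^ Suc i)" unfolding L_def using y1 by (intro log_less) auto
    then have iL: "L < real (Suc i)" by (simp add: log_nat_power del: power_Suc)
    have "i \<in> ?J" using iU iL L0 by (auto; linarith)
    then show "p \<in> (\<Union>i\<in>?J. block_primes i)" using i by blast
  qed
  then have "(\<Sum>p | prime p \<and> x powr \<epsilon> < real p \<and> real p \<le> x. 1 / real p)
      \<le> (\<Sum>p\<in>(\<Union>i\<in>?J. block_primes i). 1 / real p)"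
    using finite_block_primes by (intro sum_mono2) auto
  also have "\<dots> = (\<Sum>i\<in>?J. \<Sum>p\<in>block_primes i. 1 / real p)"
    using finite_block_primes disjoint_family_block_primes[of ?J]
    by (intro sum.UNION_disjoint) (auto simp: disjoint_family_on_def)
  also have "\<dots> \<le> (\<Sum>i\<in>?J. 2)" by (intro sum_mono sum_inverse_block_primes)
  also have "\<dots> = 2 * real (nat \<lceil>U\<rceil> - nat \<lfloor>L\<rfloor>)" by simp
  also have "real (nat \<lceil>U\<rceil> - nat \<lfloor>L\<rfloor>) \<le> U - L + 2"
    using L0 UL' by linarith
  also have "U - L = log 2 (1 / \<epsilon>)" using UL by simp
  finally show ?thesis by simp
qed

text \<open>Needed because the linear forms take values beyond \<open>x\<close>, where the distances
  say nothing. A bounded number of dyadic intervals contributes \<open>O(1 / log x)\<close>.\<close>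

lemma sum_inverse_primes_dilate_le:
  fixes x :: real
  assumes "x \<ge> 4"
  shows "(\<Sum>p | prime p \<and> x < real p \<and> real p \<le> 2 ^ v * x. 1 / real p)
    \<le> 4 * (real v + 1) / log 2 x"
proof -
  define a where "a = nat \<lfloor>log 2 x\<rfloor>"
  have "log 2 4 \<le> log 2 x" using assms by (subst log_le_cancel_iff) auto
  moreover have "log 2 4 = (2::real)" using log_nat_power[of 2 2 2] by simp
  ultimately have x2: "log 2 x \<ge> 2" by simp
  have a: "real a \<le> log 2 x" "log 2 x < real a + 1" "a \<ge> 2"
    unfolding a_def using x2 by linarith+
  have a2: "2 ^ a \<le> x"
    using a assms by (simp add: le_log_iff powr_realpow)
  have a3: "x \<le> 2 ^ Suc a"
    using a assms log_le_iff[of 2 x "real (Suc a)"] powr_realpow[of 2 "Suc a"] by (simp del: power_Suc)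
  have "(\<Sum>p | prime p \<and> x < real p \<and> real p \<le> 2 ^ v * x. 1 / real p)
      \<le> (\<Sum>p | prime p \<and> 2 ^ a < p \<and> p \<le> 2 ^ (a + Suc v). 1 / real p)"
  proof (intro sum_mono2)
    show "finite {p::nat. prime p \<and> 2 ^ a < p \<and> p \<le> 2 ^ (a + Suc v)}"
      by (rule finite_subset[of _ "{..2 ^ (a + Suc v)}"]) auto
    show "{p. prime p \<and> x < real p \<and> real p \<le> 2 ^ v * x} \<subseteq> {p. prime p \<and> 2 ^ a < p \<and> p \<le> 2 ^ (a + Suc v)}"
    proof safe
      fix p :: nat assume p: "x < real p" "real p \<le> 2 ^ v * x"
      have "real (2 ^ a) < real p" using p a2 by (simp del: of_nat_less_iff of_nat_less_numeral_power_cancel_iff of_nat_less_of_nat_power_cancel_iff numeral_power_less_of_nat_cancel_iff)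
      then show "2 ^ a < p" by (simp only: of_nat_less_iff)
      have "real p \<le> 2 ^ v * 2 ^ Suc a"
        using p a3 by (meson mult_left_mono order_trans zero_le_numeral zero_le_power)
      then have "real p \<le> real (2 ^ (a + Suc v))" by (simp add: power_add mult_ac)
      then show "p \<le> 2 ^ (a + Suc v)" by (simp only: of_nat_le_iff)
    qed
  qed auto
  also have "\<dots> \<le> 2 * real (Suc v) / real a"
    using a by (intro sum_inverse_primes_pow2) auto
  also have "\<dots> \<le> 4 * (real v + 1) / log 2 x"
  proof -
    have "log 2 x \<le> 2 * real a" using a x2 by linarith
    then have "real (Suc v) * log 2 x \<le> real (Suc v) * (2 * real a)" by (intro mult_left_mono) auto
    then show ?thesis using a x2 by (simp add: field_simps)
  qed
  finally show ?thesis .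
qed

section \<open>Characters and multiplicative functions\<close>

definition nat_twist :: "real \<Rightarrow> nat \<Rightarrow> complex" where
  "nat_twist t n = of_nat n powr (\<i> * of_real t)"

lemma nat_twist_eq_cis: "n > 0 \<Longrightarrow> nat_twist t n = cis (t * ln (real n))"
  by (simp add: nat_twist_def powr_def cis_conv_exp mult_ac Ln_of_nat)

lemma norm_nat_twist: "n > 0 \<Longrightarrow> norm (nat_twist t n) = 1"
  by (simp add: nat_twist_eq_cis)

lemma nat_twist_mult: "m > 0 \<Longrightarrow> n > 0 \<Longrightarrow> nat_twist t (m * n) = nat_twist t m * nat_twist t n"
  by (simp add: nat_twist_eq_cis ln_mult cis_mult distrib_left)

lemma cnj_nat_twist_mult: "n > 0 \<Longrightarrow> cnj (nat_twist t n) * nat_twist t n = 1"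
  by (simp add: nat_twist_eq_cis cis_cnj cis_mult)

lemma twisted_character_eq: "twisted_character chi t n = chi n * nat_twist t n"
  by (simp add: twisted_character_def nat_twist_def)

lemma dirichlet_character_mod:
  assumes "dirichlet_character q chi"
  shows "chi (n mod q) = chi n"
proof -
  have *: "chi (m + c * q) = chi m" for m c
  proof (induction c)
    case (Suc c)
    have "chi (m + Suc c * q) = chi ((m + c * q) + q)" by (simp add: algebra_simps)
    also have "\<dots> = chi (m + c * q)" using assms by (simp add: dirichlet_character_def)
    finally show ?case using Suc by simp
  qed simp
  show ?thesis using *[of "n mod q" "n div q"] by simp
qed

lemma dirichlet_character_cong:
  assumes "dirichlet_character q chi" "[m = n] (mod q)"
  shows "chi m = chi n"
  using assms dirichlet_character_mod[OF assms(1), of m] dirichlet_character_mod[OF assms(1), of n]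
  by (simp add: cong_def)

text \<open>Euler's theorem makes \<open>chi n\<close> a root of unity when \<open>n\<close> is a
  unit modulo \<open>q\<close>.\<close>

lemma norm_dirichlet_character:
  assumes "dirichlet_character q chi"
  shows "norm (chi n) = (if coprime n q then 1 else 0)"
proof (cases "coprime n q")
  case True
  have pow: "chi (n ^ e) = chi n ^ e" for e
    using assms by (induction e) (auto simp: dirichlet_character_def)
  have "chi (n ^ totient q) = chi 1"
    by (intro dirichlet_character_cong[OF assms] euler_theorem True)
  then have "norm (chi n) ^ totient q = 1"
    using assms by (simp add: pow norm_power[symmetric] dirichlet_character_def)
  moreover have "totient q > 0" using assms by (simp add: dirichlet_character_def)
  ultimately show ?thesis using True
    by (metis norm_ge_zero power_eq_1_iff power_eq_imp_eq_base power_one zero_le_one)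
next
  case False
  then show ?thesis using assms by (auto simp: dirichlet_character_def)
qed

lemma multiplicative_fun_prod_primes:
  assumes "multiplicative_fun f" "finite S" "\<And>p. p \<in> S \<Longrightarrow> prime p"
  shows "f (\<Prod>S) = (\<Prod>p\<in>S. f p)"
  using assms(2,3)
proof (induction S rule: finite_induct)
  case empty
  then show ?case using assms(1) by (simp add: multiplicative_fun_def)
next
  case (insert p S)
  have "coprime p (\<Prod>S)" using insert by (intro prod_primes_coprime) auto
  moreover have "\<Prod>S > 0" using insert by (auto intro!: prod_pos prime_gt_0_nat)
  moreover have "p > 0" using insert by (auto intro: prime_gt_0_nat)
  ultimately show ?case using assms(1) insert by (simp add: multiplicative_fun_def)
qed

lemma prod_prime_factors_eq:
  fixes r :: nat
  assumes "r > 0" "\<And>p. prime p \<Longrightarrow> \<not> p\<^sup>2 dvd r"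
  shows "\<Prod>(prime_factors r) = r"
proof -
  have "multiplicity p r = 1" if "p \<in> prime_factors r" for p
  proof -
    have p: "prime p" using that by auto
    have "multiplicity p r > 0" using that by (simp add: prime_factors_multiplicity)
    moreover have "\<not> 2 \<le> multiplicity p r"
      using assms(2)[OF p] multiplicity_dvd'[of 2 p r] by blast
    ultimately show ?thesis by linarith
  qed
  then have "\<Prod>(prime_factors r) = (\<Prod>p\<in>prime_factors r. p ^ multiplicity p r)"
    by (intro prod.cong) auto
  then show ?thesis using prime_factorization_nat[OF assms(1)] by simp
qed

text \<open>A prime \<open>p \<le> w\<close> divides \<open>fact w\<close> and occurs in
  \<open>N\<close> with exponent below \<open>w\<close>, so \<open>fact w ^ w\<close> absorbs its
  full power in \<open>N\<close>. Primes above \<open>w\<close> do not divide \<open>fact w\<close>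
  at all.\<close>

lemma gcd_smooth_split:
  fixes N w s r :: nat
  assumes "N > 0" "\<And>p. prime p \<Longrightarrow> p \<le> w \<Longrightarrow> \<not> p ^ w dvd N"
  defines "s \<equiv> gcd N (fact w ^ w)"
  defines "r \<equiv> N div s"
  shows "N = s * r" "s > 0" "r > 0" "coprime s r" "prime_factors r = {p \<in> prime_factors N. w < p}"
proof -
  show N: "N = s * r" by (simp add: s_def r_def)
  show s0: "s > 0" and r0: "r > 0" using N assms(1) by (auto intro: Nat.gr0I)
  have r_large: "w < p" if p: "prime p" "p dvd r" for p
  proof (rule ccontr)
    assume "\<not> w < p"
    then have pw: "p \<le> w" by simp
    define v where "v = multiplicity p N"
    have le: "p ^ e dvd N \<longleftrightarrow> e \<le> v" for e
      unfolding v_def using p assms(1)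
      by (intro power_dvd_iff_le_multiplicity) (auto dest: not_prime_unit)
    have "v < w" using assms(2)[OF p(1) pw] le[of w] by simp
    have "p dvd fact w" using p pw by (simp add: prime_dvd_fact_iff)
    then have "p ^ v dvd fact w ^ v" by (rule dvd_power_same)
    also have "fact w ^ v dvd (fact w ^ w :: nat)" using \<open>v < w\<close> by (intro le_imp_power_dvd) simp
    finally have "p ^ v dvd s" unfolding s_def using le by simp
    then have "p ^ v * p dvd s * r" using p by (intro mult_dvd_mono)
    then have "p ^ Suc v dvd N" using N by (simp add: mult.commute)
    then show False unfolding le by simp
  qed
  have s_small: "p \<le> w" if p: "prime p" "p dvd s" for p
  proof -
    have "p dvd fact w ^ w" using p unfolding s_def by auto
    then have "p dvd fact w" using p prime_dvd_power by blast
    then show ?thesis using p by (simp add: prime_dvd_fact_iff)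
  qed
  show "coprime s r"
  proof (rule ccontr)
    assume "\<not> coprime s r"
    then have "gcd s r \<noteq> 1" by (simp only: coprime_iff_gcd_eq_1 not_False_eq_True)
    then obtain p where p: "prime p" "p dvd gcd s r" using prime_factor_nat by blast
    then have "p \<le> w" "w < p" using s_small[of p] r_large[of p] by auto
    then show False by simp
  qed
  show "prime_factors r = {p \<in> prime_factors N. w < p}"
  proof (intro equalityI subsetI)
    fix p assume "p \<in> prime_factors r"
    then show "p \<in> {p \<in> prime_factors N. w < p}"
      using r_large N assms(1) by (auto simp: in_prime_factors_iff)
  next
    fix p assume "p \<in> {p \<in> prime_factors N. w < p}"
    then have p: "prime p" "p dvd N" "w < p" by auto
    then have "p dvd s \<or> p dvd r" using N by (metis prime_dvd_mult_iff)
    then have "p dvd r" using p s_small[of p] by auto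
    then show "p \<in> prime_factors r" using p r0 by (simp add: in_prime_factors_iff)
  qed
qed

text \<open>The cofactor \<open>r = N div s\<close> is squarefree with primes above
  \<open>w \<ge> q\<close>, where the twisted character is unimodular; so each \<open>f p\<close> is
  \<open>f p * cnj (twisted_character chi t p)\<close> times the character, and the characters
  multiply to \<open>chi r\<close> times the twist of \<open>r\<close>. Writing the latter as the
  twist of \<open>N\<close> over that of \<open>s\<close> separates the slowly varying factor from
  those that depend on \<open>s\<close> and \<open>chi\<close>.\<close>

lemma multiplicative_fun_pretentious_split:
  fixes N w :: nat
  assumes f: "multiplicative_fun f" and chi: "dirichlet_character q chi" and N: "N > 0"
    and small: "\<And>p. prime p \<Longrightarrow> p \<le> w \<Longrightarrow> \<not> p ^ w dvd N"
    and large: "\<And>p. prime p \<Longrightarrow> w < p \<Longrightarrow> \<not> p\<^sup>2 dvd N"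
    and q: "q \<le> w"
  defines "s \<equiv> gcd N (fact w ^ w)"
  shows "f N = f s * chi (N div s) * cnj (nat_twist t s) * nat_twist t N *
    (\<Prod>p\<in>{p \<in> prime_factors N. w < p}. f p * cnj (twisted_character chi t p))"
proof -
  define r where "r = N div s"
  have split: "N = s * r" "s > 0" "r > 0" "coprime s r" "prime_factors r = {p \<in> prime_factors N. w < p}"
    unfolding r_def s_def by (rule gcd_smooth_split[OF N small]; assumption)+
  have fN: "f N = f s * f r"
    using f split unfolding multiplicative_fun_def by metis
  have sq: "\<not> p\<^sup>2 dvd r" if p: "prime p" for p
  proof
    assume d: "p\<^sup>2 dvd r"
    then have "p dvd r" by (metis dvd_trans dvd_triv_left power2_eq_square)
    then have "p \<in> prime_factors r" using p split(3) by (simp add: in_prime_factors_iff)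
    then have "w < p" using split(5) by auto
    moreover have "p\<^sup>2 dvd N" using d split(1) by (metis dvd_mult)
    ultimately show False using large p by blast
  qed
  have r: "\<Prod>(prime_factors r) = r" by (rule prod_prime_factors_eq) (use split sq in auto)
  have tw: "multiplicative_fun (twisted_character chi t)"
    using chi unfolding multiplicative_fun_def dirichlet_character_def twisted_character_eq
    by (simp add: nat_twist_mult) (simp add: nat_twist_def)
  have pr: "prime p" if "p \<in> prime_factors r" for p using that by auto
  have "f r = (\<Prod>p\<in>prime_factors r. f p)"
    using multiplicative_fun_prod_primes[OF f finite_set_mset, of "prime_factorization r"] pr
    unfolding r by blast
  also have "\<dots> = (\<Prod>p\<in>prime_factors r. f p * cnj (twisted_character chi t p) * twisted_character chi t p)"
  proof (intro prod.cong refl)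
    fix p assume "p \<in> prime_factors r"
    then have p: "prime p" "w < p" using split(5) by auto
    have "q > 0" using chi by (simp add: dirichlet_character_def)
    then have "\<not> p dvd q" using p q by (auto dest: dvd_imp_le)
    then have "coprime p q" using p by (simp add: prime_imp_coprime)
    then have "norm (twisted_character chi t p) = 1"
      using p norm_dirichlet_character[OF chi]
      by (simp add: twisted_character_eq norm_mult norm_nat_twist prime_gt_0_nat)
    then have "twisted_character chi t p * cnj (twisted_character chi t p) = 1"
      by (simp add: complex_norm_square[symmetric])
    then show "f p = f p * cnj (twisted_character chi t p) * twisted_character chi t p"
      by (simp add: mult.assoc mult.commute[of "cnj _"])
  qed
  also have "\<dots> = (\<Prod>p\<in>prime_factors r. f p * cnj (twisted_character chi t p)) * twisted_character chi t r"
    unfolding prod.distrib using multiplicative_fun_prod_primes[OF tw finite_set_mset, of "prime_factorization r"] pr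
    unfolding r by metis
  also have "twisted_character chi t r = chi r * (cnj (nat_twist t s) * nat_twist t N)"
  proof -
    have "nat_twist t N = nat_twist t s * nat_twist t r"
      using split by (metis nat_twist_mult)
    then have "cnj (nat_twist t s) * nat_twist t N = nat_twist t r"
      using cnj_nat_twist_mult[OF split(2), of t] by (simp add: mult.assoc[symmetric])
    then show ?thesis by (simp add: twisted_character_eq)
  qed
  finally show ?thesis unfolding fN r_def[symmetric] split(5)[symmetric] by (simp only: mult_ac)
qed

text \<open>Dividing a multiple of \<open>W * q\<close> by a divisor of \<open>W\<close> leaves a
  multiple of \<open>q\<close>. This is why \<open>Q\<close> contains the moduli in addition to
  \<open>W\<close>.\<close>

lemma gcd_part_periodic:
  fixes N K W q :: nat
  assumes chi: "dirichlet_character q chi" and "W * q dvd K" "W > 0"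
  shows "gcd (N + K) W = gcd N W" "chi ((N + K) div gcd N W) = chi (N div gcd N W)"
proof -
  obtain e where K: "K = W * q * e" using assms(2) by auto
  then show "gcd (N + K) W = gcd N W"
    by (metis (no_types, lifting) gcd.commute gcd_add_mult mult.assoc mult.commute add.commute)
  obtain c where c: "W = gcd N W * c" by (meson dvdE gcd_dvd2)
  have "(N + K) div gcd N W = N div gcd N W + K div gcd N W"
    by (intro div_plus_div_distrib_dvd_left) simp
  also have "K div gcd N W = c * e * q"
    unfolding K using assms(3) by (subst c) (simp add: mult_ac)
  finally show "chi ((N + K) div gcd N W) = chi (N div gcd N W)"
    by (intro dirichlet_character_cong[OF chi]) (simp add: cong_def)
qed

section \<open>Counting tools: multiples along a linear form and tails of inverse squares\<close>

text \<open>The quotients \<open>(a * n + h) div d\<close> are distinct positive integers up to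
  \<open>(a + h) * N / d\<close>. The bound has no additive constant, so it can be summed over
  moduli \<open>d\<close> far larger than \<open>N\<close>.\<close>

lemma card_dvd_linear_le:
  fixes a h d N :: nat
  assumes "d > 0" "a > 0"
  shows "real (card {n \<in> {1..N}. d dvd a * n + h}) \<le> real (a + h) * real N / real d"
proof -
  let ?S = "{n \<in> {1..N}. d dvd a * n + h}" and ?M = "(a + h) * N div d"
  have "card ?S \<le> card {1..?M}"
  proof (rule card_inj_on_le)
    show "inj_on (\<lambda>n. (a * n + h) div d) ?S"
      using assms by (auto intro!: inj_onI simp: dvd_div_eq_iff) 
    show "(\<lambda>n. (a * n + h) div d) ` ?S \<subseteq> {1..?M}"
    proof safe
      fix n assume n: "n \<in> {1..N}" "d dvd a * n + h"
      have "a * n + h > 0" using n assms by simp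
      then have "d \<le> a * n + h" using n by (auto intro: dvd_imp_le)
      then have "1 \<le> (a * n + h) div d" using assms by (simp add: div_greater_zero_iff Suc_le_eq)
      moreover have "a * n + h \<le> (a + h) * N"
        using n by (auto simp: distrib_right intro!: add_mono)
      then have "(a * n + h) div d \<le> ?M" by (rule div_le_mono)
      ultimately show "(a * n + h) div d \<in> {1..?M}" by simp
    qed
  qed simp
  then have "real (card ?S) \<le> real ?M" by simp
  also have "\<dots> \<le> real ((a + h) * N) / real d" by (rule of_nat_div_le_of_nat)
  finally show ?thesis by simp
qed

lemma sum_inverse_squares_le:
  assumes "w > 0"
  shows "(\<Sum>d\<in>{w<..M::nat}. 1 / (real d)\<^sup>2) \<le> 1 / real w"
proof (cases "w \<le> M")
  case True
  then have "(\<Sum>d\<in>{w<..M::nat}. 1 / (real d)\<^sup>2) \<le> 1 / real w - 1 / real M"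
  proof (induction M rule: dec_induct)
    case (step M)
    have "{w<..Suc M} = insert (Suc M) {w<..M}" using step by auto
    then have "(\<Sum>d\<in>{w<..Suc M}. 1 / (real d)\<^sup>2) \<le> 1 / (real (Suc M))\<^sup>2 + (1 / real w - 1 / real M)"
      using step by simp
    also have "1 / (real (Suc M))\<^sup>2 \<le> 1 / real M - 1 / real (Suc M)"
    proof -
      have M: "real M > 0" using step assms by simp
      have "1 / (real (Suc M))\<^sup>2 \<le> 1 / (real M * real (Suc M))"
        using M by (intro divide_left_mono) (auto simp: power2_eq_square)
      then show ?thesis using M by (simp add: field_simps)
    qed
    finally show ?case by simp
  qed simp
  also have "\<dots> \<le> 1 / real w" by simp
  finally show ?thesis .
qed simp

section \<open>Removing the large primes\<close>

lemma square_le_two_power: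
  assumes "4 \<le> n"
  shows "n\<^sup>2 \<le> (2::nat) ^ n"
  using assms
proof (induction n rule: dec_induct)
  case (step n)
  have "4 * n \<le> n * n" using step by (intro mult_right_mono) auto
  moreover have "(Suc n)\<^sup>2 = n * n + 2 * n + 1" by (simp add: power2_eq_square)
  moreover have "2 * n\<^sup>2 = n * n + n * n" by (simp add: power2_eq_square)
  ultimately have "(Suc n)\<^sup>2 \<le> 2 * n\<^sup>2" using step(1) by linarith
  then show ?case using step by simp
qed simp

text \<open>The bounds by \<open>w\<close> make every prime above \<open>w\<close> generic: it
  divides no \<open>a j\<close> and no modulus, and it cannot divide two of the linear forms at the
  same point. The bound \<open>2 * k \<le> w\<close> lets coefficients of the expansion be absorbed
  into the size of a block.\<close>

locale pretentious_system =
  fixes k :: nat and a h q :: "nat \<Rightarrow> nat" and chi :: "nat \<Rightarrow> nat \<Rightarrow> complex" and t :: "nat \<Rightarrow> real"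
    and f :: "nat \<Rightarrow> nat \<Rightarrow> complex" and w :: nat and y :: real
  assumes a1: "j \<in> {1..k} \<Longrightarrow> 1 \<le> a j"
    and h1: "j \<in> {1..k} \<Longrightarrow> 1 \<le> h j"
    and nondegenerate: "i \<in> {1..k} \<Longrightarrow> j \<in> {1..k} \<Longrightarrow> i \<noteq> j \<Longrightarrow> a i * h j \<noteq> a j * h i"
    and chi: "j \<in> {1..k} \<Longrightarrow> dirichlet_character (q j) (chi j)"
    and mult: "j \<in> {1..k} \<Longrightarrow> multiplicative_fun (f j)"
    and f_le: "j \<in> {1..k} \<Longrightarrow> 1 \<le> n \<Longrightarrow> norm (f j n) \<le> 1"
    and w4: "4 \<le> w"
    and q_le_w: "j \<in> {1..k} \<Longrightarrow> q j \<le> w"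
    and a_le_w: "j \<in> {1..k} \<Longrightarrow> a j \<le> w"
    and ah_le_w: "i \<in> {1..k} \<Longrightarrow> j \<in> {1..k} \<Longrightarrow> a i * h j \<le> w"
    and k_le_w: "2 * k \<le> w"
    and w_le_y: "real w \<le> y"
begin

text \<open>
  Outside the exceptional set \<open>bad N\<close>, \<open>smooth j n\<close> is the \<open>w\<close>-smooth part of \<open>L j n\<close> and the
  cofactor is squarefree. Taking a greatest common divisor with \<open>W\<close> instead of the true smooth part
  makes \<open>c\<close> periodic modulo \<open>Q\<close> without exception.
\<close>

definition L :: "nat \<Rightarrow> nat \<Rightarrow> nat" where
  "L j n = a j * n + h j"

definition F :: "nat \<Rightarrow> nat \<Rightarrow> complex" where
  "F j p = f j p * cnj (twisted_character (chi j) (t j) p)"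

text \<open>All forms are collected prime by prime. For \<open>p \<in> P\<close> at most one factor
  differs from \<open>1\<close>, by \<open>dvd_L_unique\<close>.\<close>

definition X :: "nat \<Rightarrow> nat \<Rightarrow> complex" where
  "X p n = (\<Prod>j=1..k. if p dvd L j n then F j p else 1)"

definition W :: nat where
  "W = fact w ^ w"

definition Q :: nat where
  "Q = W * (\<Prod>j=1..k. q j)"

definition smooth :: "nat \<Rightarrow> nat \<Rightarrow> nat" where
  "smooth j n = gcd (L j n) W"

definition c :: "nat \<Rightarrow> complex" where
  "c n = (\<Prod>j=1..k. f j (smooth j n) * chi j (L j n div smooth j n) * cnj (nat_twist (t j) (smooth j n)))"

definition \<phi> :: "nat \<Rightarrow> complex" where
  "\<phi> n = (\<Prod>j=1..k. nat_twist (t j) (L j n))"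

definition P :: "nat set" where
  "P = {p. prime p \<and> w < p \<and> real p \<le> y}"

definition Z :: "nat \<Rightarrow> complex" where
  "Z n = c n * \<phi> n * (\<Prod>p\<in>P. X p n)"

definition bad :: "nat \<Rightarrow> nat set" where
  "bad N = {n \<in> {1..N}. \<exists>j\<in>{1..k}. \<exists>p. prime p \<and> (if p \<le> w then p ^ w dvd L j n else p\<^sup>2 dvd L j n)}"

lemma L_pos: "j \<in> {1..k} \<Longrightarrow> L j n > 0"
  using h1[of j] by (simp add: L_def)

lemma L_le: "1 \<le> n \<Longrightarrow> n \<le> N \<Longrightarrow> L j n \<le> (a j + h j) * N"
  by (auto simp: L_def distrib_right intro!: add_mono)

lemma finite_P: "finite P"
  by (rule finite_subset[of _ "{..nat \<lfloor>y\<rfloor>}"]) (auto simp: P_def le_nat_floor)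

lemma q_pos: "j \<in> {1..k} \<Longrightarrow> q j > 0"
  using chi[of j] by (simp add: dirichlet_character_def)

lemma W_pos: "W > 0" by (simp add: W_def)

lemma Q_pos: "Q > 0" using q_pos W_pos by (auto simp: Q_def intro!: prod_pos)

lemma norm_chi_le: "j \<in> {1..k} \<Longrightarrow> norm (chi j n) \<le> 1"
  using norm_dirichlet_character[OF chi, of j n] by auto

lemma norm_F: "j \<in> {1..k} \<Longrightarrow> 0 < p \<Longrightarrow> norm (F j p) \<le> 1"
  using norm_chi_le[of j p] f_le[of j p]
  by (simp add: F_def twisted_character_eq norm_mult norm_nat_twist mult_le_one)

lemma norm_X: "0 < p \<Longrightarrow> norm (X p n) \<le> 1"
  unfolding X_def by (intro norm_prod_le_1) (auto intro: norm_F)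

lemma smooth_pos: "smooth j n > 0"
  using W_pos by (simp add: smooth_def)

lemma norm_c: "norm (c n) \<le> 1"
  unfolding c_def
proof (intro norm_prod_le_1)
  fix j assume j: "j \<in> {1..k}"
  show "norm (f j (smooth j n) * chi j (L j n div smooth j n) * cnj (nat_twist (t j) (smooth j n))) \<le> 1"
    using f_le[OF j, of "smooth j n"] norm_chi_le[OF j] smooth_pos[of j n]
    by (simp add: norm_mult norm_nat_twist mult_le_one)
qed

lemma norm_\<phi>: "norm (\<phi> n) \<le> 1"
  unfolding \<phi>_def using L_pos by (intro norm_prod_le_1) (simp add: norm_nat_twist)

lemma norm_prod_X: "norm (\<Prod>p\<in>P. X p n) \<le> 1"
  by (intro norm_prod_le_1 norm_X) (auto simp: P_def intro: prime_gt_0_nat)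

lemma norm_Z: "norm (Z n) \<le> 1"
  unfolding Z_def norm_mult using norm_c norm_\<phi> norm_prod_X by (intro mult_le_one) auto

lemma norm_prod_f: "norm (\<Prod>j=1..k. f j (L j n)) \<le> 1"
  using f_le L_pos by (intro norm_prod_le_1) (auto simp: Suc_le_eq)

lemma c_periodic: "c (n + Q * m) = c n"
  unfolding c_def
proof (intro prod.cong refl)
  fix j assume j: "j \<in> {1..k}"
  have L: "L j (n + Q * m) = L j n + a j * Q * m" by (simp add: L_def algebra_simps)
  have "q j dvd (\<Prod>j=1..k. q j)" using j by (intro dvd_prodI) auto
  then have "W * q j dvd a j * Q * m" unfolding Q_def by (intro dvd_mult2 dvd_mult mult_dvd_mono) auto
  note per = gcd_part_periodic[OF chi[OF j] this W_pos, of "L j n"]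
  then show "f j (smooth j (n + Q * m)) * chi j (L j (n + Q * m) div smooth j (n + Q * m)) *
      cnj (nat_twist (t j) (smooth j (n + Q * m)))
    = f j (smooth j n) * chi j (L j n div smooth j n) * cnj (nat_twist (t j) (smooth j n))"
    unfolding smooth_def L by simp
qed

lemma prod_X_eq:
  "(\<Prod>p\<in>P. X p n) = (\<Prod>j=1..k. \<Prod>p\<in>{p \<in> prime_factors (L j n). w < p \<and> real p \<le> y}. F j p)"
proof -
  have "(\<Prod>p\<in>P. X p n) = (\<Prod>j=1..k. \<Prod>p\<in>P. if p dvd L j n then F j p else 1)"
    unfolding X_def by (rule prod.swap)
  also have "\<dots> = (\<Prod>j=1..k. \<Prod>p\<in>{p \<in> prime_factors (L j n). w < p \<and> real p \<le> y}. F j p)"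
  proof (rule prod.cong[OF refl])
    fix j assume j: "j \<in> {1..k}"
    have "(\<Prod>p\<in>P. if p dvd L j n then F j p else 1) = (\<Prod>p\<in>{p \<in> P. p dvd L j n}. F j p)"
      using finite_P by (rule prod.inter_filter[symmetric])
    also have "{p \<in> P. p dvd L j n} = {p \<in> prime_factors (L j n). w < p \<and> real p \<le> y}"
      using L_pos[OF j, of n] by (auto simp: P_def in_prime_factors_iff)
    finally show "(\<Prod>p\<in>P. if p dvd L j n then F j p else 1) =
      (\<Prod>p\<in>{p \<in> prime_factors (L j n). w < p \<and> real p \<le> y}. F j p)" .
  qed
  finally show ?thesis .
qed

text \<open>Outside \<open>bad N\<close> the splitting applies to every form: smooth parts and
  characters go to \<open>c\<close>, twists to \<open>\<phi>\<close>, primes in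
  \<open>(w, y]\<close> to \<open>X\<close>, and the primes above \<open>y\<close> stay
  explicit.\<close>

lemma prod_f_good:
  assumes "n \<in> {1..N}" "n \<notin> bad N"
  shows "(\<Prod>j=1..k. f j (L j n)) =
    Z n * (\<Prod>j=1..k. \<Prod>p\<in>{p \<in> prime_factors (L j n). y < real p}. F j p)"
proof -
  have "f j (L j n) = f j (smooth j n) * chi j (L j n div smooth j n) * cnj (nat_twist (t j) (smooth j n)) *
      nat_twist (t j) (L j n) * ((\<Prod>p\<in>{p \<in> prime_factors (L j n). w < p \<and> real p \<le> y}. F j p) *
      (\<Prod>p\<in>{p \<in> prime_factors (L j n). y < real p}. F j p))" if j: "j \<in> {1..k}" for j
  proof -
    have good: "\<not> (if p \<le> w then p ^ w dvd L j n else p\<^sup>2 dvd L j n)" if "prime p" for p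
      using assms j that unfolding bad_def by blast
    have "f j (L j n) = f j (smooth j n) * chi j (L j n div smooth j n) * cnj (nat_twist (t j) (smooth j n)) *
      nat_twist (t j) (L j n) * (\<Prod>p\<in>{p \<in> prime_factors (L j n). w < p}. F j p)"
      unfolding smooth_def W_def F_def
    proof (rule multiplicative_fun_pretentious_split[OF mult[OF j] chi[OF j] L_pos[OF j] _ _ q_le_w[OF j]])
      show "\<not> p ^ w dvd L j n" if "prime p" "p \<le> w" for p using good[of p] that by simp
      show "\<not> p\<^sup>2 dvd L j n" if "prime p" "w < p" for p using good[of p] that by simp
    qed
    also have "{p \<in> prime_factors (L j n). w < p} =
        {p \<in> prime_factors (L j n). w < p \<and> real p \<le> y} \<union> {p \<in> prime_factors (L j n). y < real p}"
      using w_le_y by auto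
    also have "(\<Prod>p\<in>\<dots>. F j p) = (\<Prod>p\<in>{p \<in> prime_factors (L j n). w < p \<and> real p \<le> y}. F j p) *
        (\<Prod>p\<in>{p \<in> prime_factors (L j n). y < real p}. F j p)"
      by (intro prod.union_disjoint) auto
    finally show ?thesis .
  qed
  then have "(\<Prod>j=1..k. f j (L j n)) = (\<Prod>j=1..k. f j (smooth j n) * chi j (L j n div smooth j n) * cnj (nat_twist (t j) (smooth j n)) *
      nat_twist (t j) (L j n) * ((\<Prod>p\<in>{p \<in> prime_factors (L j n). w < p \<and> real p \<le> y}. F j p) *
      (\<Prod>p\<in>{p \<in> prime_factors (L j n). y < real p}. F j p)))"
    by (intro prod.cong) auto
  then show ?thesis unfolding Z_def prod_X_eq c_def \<phi>_def prod.distrib by (simp only: mult.assoc)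
qed

text \<open>All factors lie in the disc, so replacing the factors at primes above \<open>y\<close>
  by \<open>1\<close> costs at most the sum of the individual changes.\<close>

lemma prod_f_good_approx:
  assumes "n \<in> {1..N}" "n \<notin> bad N"
  shows "norm ((\<Prod>j=1..k. f j (L j n)) - Z n)
    \<le> (\<Sum>j=1..k. \<Sum>p\<in>{p \<in> prime_factors (L j n). y < real p}. norm (1 - F j p))"
proof -
  let ?T = "\<lambda>j. {p \<in> prime_factors (L j n). y < real p}"
  have F1: "norm (F j p) \<le> 1" if "j \<in> {1..k}" "p \<in> ?T j" for j p
    using that by (intro norm_F) (auto intro: prime_gt_0_nat)
  have "norm ((\<Prod>j=1..k. f j (L j n)) - Z n) = norm (Z n) * norm (1 - (\<Prod>j=1..k. \<Prod>p\<in>?T j. F j p))"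
    unfolding prod_f_good[OF assms] norm_mult[symmetric] by (subst norm_minus_commute) (simp add: algebra_simps)
  also have "\<dots> \<le> 1 * norm ((\<Prod>j=1..k. 1) - (\<Prod>j=1..k. \<Prod>p\<in>?T j. F j p))"
    using norm_Z by (intro mult_mono) auto
  also have "\<dots> \<le> (\<Sum>j=1..k. norm (1 - (\<Prod>p\<in>?T j. F j p)))"
    unfolding mult_1 using F1 by (intro norm_prod_diff norm_prod_le_1) auto
  also have "\<dots> \<le> (\<Sum>j=1..k. \<Sum>p\<in>?T j. norm (1 - F j p))"
  proof (rule sum_mono)
    fix j assume j: "j \<in> {1..k}"
    show "norm (1 - (\<Prod>p\<in>?T j. F j p)) \<le> (\<Sum>p\<in>?T j. norm (1 - F j p))"
      using norm_prod_diff[of "?T j" "\<lambda>_. 1" "F j"] F1[OF j] by simp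
  qed
  finally show ?thesis .
qed

section \<open>Density of the exceptional set and of large prime factors\<close>

lemma card_multiples_L_le:
  assumes "j \<in> {1..k}" "d > 0"
  shows "real (card {n \<in> {1..N}. d dvd L j n}) \<le> real (a j + h j) * real N / real d"
  using assms a1[of j] unfolding L_def by (intro card_dvd_linear_le) auto

text \<open>The fewer than \<open>w\<close> small primes each cost at most \<open>2 ^ (- w)\<close>,
  in total at most \<open>1 / w\<close> since \<open>w\<^sup>2 \<le> 2 ^ w\<close>; squares of
  larger primes cost at most the tail \<open>1 / w\<close> of the inverse squares.\<close>

lemma card_bad: "real (card (bad N)) \<le> (\<Sum>j=1..k. real (a j + h j)) * real N * (2 / real w)"
proof -
  define A where "A j = real (a j + h j) * real N" for j
  define B1 where "B1 j p = {n \<in> {1..N}. p ^ w dvd L j n}" for j p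
  define B2 where "B2 j p = {n \<in> {1..N}. p\<^sup>2 dvd L j n}" for j p
  define M where "M j = (a j + h j) * N" for j
  have w0: "w > 0" using w4 by simp
  have sub: "bad N \<subseteq> (\<Union>j\<in>{1..k}. (\<Union>p\<in>{2..w}. B1 j p) \<union> (\<Union>p\<in>{w<..M j}. B2 j p))"
  proof
    fix n assume "n \<in> bad N"
    then obtain j p where n: "n \<in> {1..N}" "j \<in> {1..k}" "prime p"
      "if p \<le> w then p ^ w dvd L j n else p\<^sup>2 dvd L j n" unfolding bad_def by blast
    have "p \<in> {2..w} \<and> n \<in> B1 j p \<or> p \<in> {w<..M j} \<and> n \<in> B2 j p"
    proof (cases "p \<le> w")
      case True
      then show ?thesis using n prime_ge_2_nat[of p] by (auto simp: B1_def)
    next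
      case False
      then have d: "p\<^sup>2 dvd L j n" using n by simp
      then have "p\<^sup>2 \<le> L j n" using L_pos n by (intro dvd_imp_le) auto
      moreover have "p \<le> p\<^sup>2" by (simp add: power2_eq_square)
      moreover have "L j n \<le> M j" using n unfolding M_def by (intro L_le) auto
      ultimately show ?thesis using False d n by (auto simp: B2_def)
    qed
    then show "n \<in> (\<Union>j\<in>{1..k}. (\<Union>p\<in>{2..w}. B1 j p) \<union> (\<Union>p\<in>{w<..M j}. B2 j p))"
      using n(2) by blast
  qed
  have fin: "finite (B1 j p)" "finite (B2 j p)" for j p by (auto simp: B1_def B2_def)
  have b1: "real (card (B1 j p)) \<le> A j * (1 / 2 ^ w)" if "j \<in> {1..k}" "p \<in> {2..w}" for j p
  proof -
    have "real (card (B1 j p)) \<le> A j / real (p ^ w)"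
      unfolding B1_def A_def using that by (intro card_multiples_L_le) auto
    also have "\<dots> \<le> A j / 2 ^ w"
      using that by (intro divide_left_mono) (auto simp: A_def intro!: power_mono mult_pos_pos)
    finally show ?thesis by simp
  qed
  have b2: "real (card (B2 j p)) \<le> A j * (1 / (real p)\<^sup>2)" if "j \<in> {1..k}" "p \<in> {w<..M j}" for j p
  proof -
    have "real (card (B2 j p)) \<le> A j / real (p\<^sup>2)"
      unfolding B2_def A_def using that by (intro card_multiples_L_le) auto
    then show ?thesis by simp
  qed
  have "real (card (bad N)) \<le> real (card (\<Union>j\<in>{1..k}. (\<Union>p\<in>{2..w}. B1 j p) \<union> (\<Union>p\<in>{w<..M j}. B2 j p)))"
    using sub fin by (intro of_nat_mono card_mono) auto
  also have "\<dots> \<le> real (\<Sum>j=1..k. card ((\<Union>p\<in>{2..w}. B1 j p) \<union> (\<Union>p\<in>{w<..M j}. B2 j p)))"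
    by (intro of_nat_mono card_UN_le) auto
  also have "\<dots> \<le> (\<Sum>j=1..k. A j * (2 / real w))"
    unfolding of_nat_sum
  proof (rule sum_mono)
    fix j assume j: "j \<in> {1..k}"
    have "real (card ((\<Union>p\<in>{2..w}. B1 j p) \<union> (\<Union>p\<in>{w<..M j}. B2 j p)))
        \<le> real ((\<Sum>p\<in>{2..w}. card (B1 j p)) + (\<Sum>p\<in>{w<..M j}. card (B2 j p)))"
      by (intro of_nat_mono order_trans[OF card_Un_le] add_mono card_UN_le) auto
    also have "\<dots> \<le> (\<Sum>p\<in>{2..w}. A j * (1 / 2 ^ w)) + (\<Sum>p\<in>{w<..M j}. A j * (1 / (real p)\<^sup>2))"
      unfolding of_nat_add of_nat_sum using b1[OF j] b2[OF j] by (intro add_mono sum_mono) auto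
    also have "(\<Sum>p\<in>{2..w}. A j * (1 / 2 ^ w)) \<le> A j * (1 / real w)"
    proof -
      have "real (w\<^sup>2) \<le> real (2 ^ w)" using square_le_two_power[OF w4] by (rule of_nat_mono)
      then have "(real w - 1) * real w \<le> 2 ^ w" by (simp add: power2_eq_square algebra_simps)
      then have "(real w - 1) * (1 / 2 ^ w) \<le> 1 / real w" using w0 by (simp add: field_simps)
      then have "A j * ((real w - 1) * (1 / 2 ^ w)) \<le> A j * (1 / real w)"
        by (intro mult_left_mono) (auto simp: A_def)
      moreover have "real (Suc w - 2) = real w - 1" using w4 by simp
      ultimately show ?thesis by (simp add: mult_ac)
    qed
    also have "(\<Sum>p\<in>{w<..M j}. A j * (1 / (real p)\<^sup>2)) \<le> A j * (1 / real w)"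
      unfolding sum_distrib_left[symmetric]
      by (intro mult_left_mono sum_inverse_squares_le w0) (simp add: A_def)
    finally show "real (card ((\<Union>p\<in>{2..w}. B1 j p) \<union> (\<Union>p\<in>{w<..M j}. B2 j p))) \<le> A j * (2 / real w)"
      by (simp add: mult_ac)
  qed
  also have "\<dots> = (\<Sum>j=1..k. real (a j + h j)) * real N * (2 / real w)"
    unfolding A_def by (simp only: sum_distrib_right)
  finally show ?thesis .
qed

lemma sum_prime_factors_L_le:
  assumes j: "j \<in> {1..k}" and g: "\<And>p. 0 \<le> g p"
  shows "(\<Sum>n=1..N. \<Sum>p\<in>{p \<in> prime_factors (L j n). y < real p}. g p)
    \<le> real (a j + h j) * real N * (\<Sum>p | prime p \<and> y < real p \<and> p \<le> (a j + h j) * N. g p / real p)"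
proof -
  let ?R = "{p. prime p \<and> y < real p \<and> p \<le> (a j + h j) * N}"
  have fin: "finite ?R" by (rule finite_subset[of _ "{..(a j + h j) * N}"]) auto
  have "(\<Sum>n=1..N. \<Sum>p\<in>{p \<in> prime_factors (L j n). y < real p}. g p)
      = (\<Sum>n=1..N. \<Sum>p\<in>?R. if p dvd L j n then g p else 0)"
  proof (rule sum.cong[OF refl])
    fix n assume n: "n \<in> {1..N}"
    have "{p \<in> prime_factors (L j n). y < real p} = {p \<in> ?R. p dvd L j n}"
      using L_pos[OF j, of n] L_le[of n N j] n dvd_imp_le[OF _ L_pos[OF j, of n]]
      by (auto simp: in_prime_factors_iff intro: order_trans)
    then show "(\<Sum>p\<in>{p \<in> prime_factors (L j n). y < real p}. g p)
        = (\<Sum>p\<in>?R. if p dvd L j n then g p else 0)"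
      using sum.inter_filter[OF fin] by simp
  qed
  also have "\<dots> = (\<Sum>p\<in>?R. \<Sum>n=1..N. if p dvd L j n then g p else 0)" by (rule sum.swap)
  also have "\<dots> = (\<Sum>p\<in>?R. g p * real (card {n \<in> {1..N}. p dvd L j n}))"
  proof (intro sum.cong refl)
    fix p
    have "(\<Sum>n=1..N. if p dvd L j n then g p else 0) = (\<Sum>n\<in>{n \<in> {1..N}. p dvd L j n}. g p)"
      by (rule sum.inter_filter[symmetric]) simp
    then show "(\<Sum>n=1..N. if p dvd L j n then g p else 0) = g p * real (card {n \<in> {1..N}. p dvd L j n})"
      by simp
  qed
  also have "\<dots> \<le> (\<Sum>p\<in>?R. g p * (real (a j + h j) * real N / real p))"
    by (intro sum_mono mult_left_mono card_multiples_L_le j g) (auto intro: prime_gt_0_nat)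
  also have "\<dots> = real (a j + h j) * real N * (\<Sum>p\<in>?R. g p / real p)"
    by (simp add: sum_distrib_left mult_ac)
  finally show ?thesis .
qed

text \<open>On \<open>bad N\<close> the trivial bound 2 for the difference doubles the density
  \<open>2 / w\<close>, giving \<open>4 / w\<close>; elsewhere the pointwise comparison is summed
  over \<open>n\<close>.\<close>

lemma sum_prod_f_approx:
  "norm ((\<Sum>n=1..N. \<Prod>j=1..k. f j (L j n)) - (\<Sum>n=1..N. Z n))
    \<le> (\<Sum>j=1..k. real (a j + h j)) * real N * (4 / real w)
      + (\<Sum>j=1..k. real (a j + h j) * real N *
          (\<Sum>p | prime p \<and> y < real p \<and> p \<le> (a j + h j) * N. norm (1 - F j p) / real p))"
proof -
  let ?E = "\<lambda>n. \<Sum>j=1..k. \<Sum>p\<in>{p \<in> prime_factors (L j n). y < real p}. norm (1 - F j p)"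
  have "norm ((\<Sum>n=1..N. \<Prod>j=1..k. f j (L j n)) - (\<Sum>n=1..N. Z n))
      \<le> (\<Sum>n=1..N. norm ((\<Prod>j=1..k. f j (L j n)) - Z n))"
    unfolding sum_subtractf[symmetric] by (rule norm_sum)
  also have "\<dots> \<le> (\<Sum>n=1..N. (if n \<in> bad N then 2 else 0) + ?E n)"
  proof (rule sum_mono)
    fix n assume n: "n \<in> {1..N}"
    show "norm ((\<Prod>j=1..k. f j (L j n)) - Z n) \<le> (if n \<in> bad N then 2 else 0) + ?E n"
    proof (cases "n \<in> bad N")
      case True
      have "norm ((\<Prod>j=1..k. f j (L j n)) - Z n) \<le> 1 + 1"
        by (intro order_trans[OF norm_triangle_ineq4] add_mono norm_prod_f norm_Z)
      also have "\<dots> \<le> 2 + ?E n" by (simp add: sum_nonneg)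
      finally show ?thesis using True by simp
    next
      case False
      then show ?thesis using prod_f_good_approx[OF n False] by simp
    qed
  qed
  also have "\<dots> = 2 * real (card (bad N)) + (\<Sum>n=1..N. ?E n)"
  proof -
    have "bad N = {n \<in> {1..N}. n \<in> bad N}" unfolding bad_def by blast
    then have "(\<Sum>n=1..N. if n \<in> bad N then 2 else (0::real)) = (\<Sum>n\<in>bad N. 2)"
      using sum.inter_filter[of "{1..N}" "\<lambda>_. 2::real" "\<lambda>n. n \<in> bad N"] by simp
    then show ?thesis by (simp add: sum.distrib)
  qed
  also have "(\<Sum>n=1..N. ?E n) = (\<Sum>j=1..k. \<Sum>n=1..N. \<Sum>p\<in>{p \<in> prime_factors (L j n). y < real p}. norm (1 - F j p))"
    by (rule sum.swap)
  also have "2 * real (card (bad N)) \<le> 2 * ((\<Sum>j=1..k. real (a j + h j)) * real N * (2 / real w))"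
    using card_bad by (intro mult_left_mono) auto
  also have "(\<Sum>j=1..k. \<Sum>n=1..N. \<Sum>p\<in>{p \<in> prime_factors (L j n). y < real p}. norm (1 - F j p))
      \<le> (\<Sum>j=1..k. real (a j + h j) * real N *
          (\<Sum>p | prime p \<and> y < real p \<and> p \<le> (a j + h j) * N. norm (1 - F j p) / real p))"
    by (intro sum_mono sum_prime_factors_L_le) auto
  finally show ?thesis by (simp add: mult_ac)
qed

end

section \<open>Cancellation on progressions\<close>

text \<open>Controls the sieve level: \<open>2 ^ i\<close> measures the logarithm of primes in block
  \<open>i\<close>, and degrees growing linearly as \<open>i\<close> decreases still leave the total
  comparable to the top block. The induction raises \<open>C\<close> by one, hence \<open>C\<close>
  is arbitrary.\<close>

lemma sum_pow2_weights_le: "(\<Sum>i\<le>n. 2 ^ i * (C + (n - i))) \<le> 2 ^ Suc n * (C + 1 :: nat)"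
proof (induction n arbitrary: C)
  case (Suc n)
  have "(\<Sum>i\<le>Suc n. 2 ^ i * (C + (Suc n - i))) = (\<Sum>i\<le>n. 2 ^ i * (Suc C + (n - i))) + 2 ^ Suc n * C"
    by (simp add: Suc_diff_le)
  also have "\<dots> \<le> 2 ^ Suc n * (Suc C + 1) + 2 ^ Suc n * C"
    using Suc[of "Suc C"] by (rule add_right_mono)
  finally show ?case by (simp add: algebra_simps)
qed simp

lemma sum_geometric_weights_le: "(\<Sum>i\<le>n. 1 / 2 ^ Suc (B + (n - i))) \<le> (1 / 2 ^ B :: real)"
proof -
  have "(\<Sum>i\<le>n. 1 / 2 ^ Suc (B + (n - i))) = 1 / 2 ^ B * (\<Sum>i\<le>n. 1 / 2 ^ Suc (n - i) :: real)"
    unfolding sum_distrib_left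
    by (rule sum.cong[OF refl]) (simp only: add_Suc_right[symmetric] power_add, simp)
  also have "\<dots> \<le> 1 / 2 ^ B * 1"
  proof (rule mult_left_mono)
    have "(\<Sum>i\<le>n. 1 / 2 ^ Suc (n - i) :: real) = 1 - 1 / 2 ^ Suc n"
    proof (induction n)
      case (Suc n)
      have "(\<Sum>i\<le>Suc n. 1 / 2 ^ Suc (Suc n - i) :: real) = (\<Sum>i\<le>n. 1 / 2 ^ Suc (n - i)) / 2 + 1 / 2"
        by (simp add: Suc_diff_le sum_divide_distrib)
      then show ?case using Suc by (simp add: field_simps)
    qed simp
    then show "(\<Sum>i\<le>n. 1 / 2 ^ Suc (n - i) :: real) \<le> 1" by simp
  qed simp
  finally show ?thesis by simp
qed

text \<open>Exact to first order in \<open>Re z\<close>, which carries the distance; the quadratic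
  term is summable over primes.\<close>

lemma norm_one_plus_le_exp:
  fixes z :: complex
  shows "norm (1 + z) \<le> exp (Re z + (norm z)\<^sup>2 / 2)"
proof -
  have "(norm (1 + z))\<^sup>2 = 1 + (2 * Re z + (norm z)\<^sup>2)"
    unfolding cmod_power2 by (simp add: power2_eq_square algebra_simps)
  also have "\<dots> \<le> exp (2 * Re z + (norm z)\<^sup>2)" by (rule exp_ge_add_one_self)
  also have "\<dots> = (exp (Re z + (norm z)\<^sup>2 / 2))\<^sup>2" by (simp add: exp_double[symmetric])
  finally show ?thesis by (rule power2_le_imp_le) simp
qed

context pretentious_system
begin

section \<open>Roots of the linear forms modulo primes of \<open>P\<close>\<close>

lemma not_dvd_a_Q:
  assumes "p \<in> P" "j \<in> {1..k}"
  shows "\<not> p dvd a j * Q"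
proof
  have p: "prime p" "w < p" using assms by (auto simp: P_def)
  have small: "\<not> p dvd m" if "0 < m" "m \<le> w" for m
    using that p by (auto dest: dvd_imp_le)
  assume "p dvd a j * Q"
  then consider "p dvd a j" | "p dvd fact w ^ w" | "p dvd (\<Prod>j=1..k. q j)"
    using p(1) by (auto simp: Q_def W_def prime_dvd_mult_iff)
  then show False
  proof cases
    case 1
    then show ?thesis using small[of "a j"] a1[OF assms(2)] a_le_w[OF assms(2)] by simp
  next
    case 2
    then have "p dvd fact w" using p(1) prime_dvd_power by blast
    then show ?thesis using p by (simp add: prime_dvd_fact_iff)
  next
    case 3
    then obtain i where "i \<in> {1..k}" "p dvd q i"
      using p(1) by (auto simp: prime_dvd_prod_iff)
    then show ?thesis using small[of "q i"] q_pos q_le_w by simp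
  qed
qed

lemma L_shift: "L j (n + Q * m) = L j n + a j * Q * m"
  by (simp add: L_def algebra_simps)

lemma dvd_L_mod: "p dvd L j (n + Q * (m mod p)) \<longleftrightarrow> p dvd L j (n + Q * m)"
proof -
  have "[L j n + a j * Q * (m mod p) = L j n + a j * Q * m] (mod p)"
    by (intro cong_add cong_mult cong_refl) (simp add: cong_def)
  then show ?thesis unfolding L_shift by (rule cong_dvd_iff)
qed

lemma X_periodic: "X p (n + Q * (m mod p)) = X p (n + Q * m)"
  unfolding X_def dvd_L_mod ..

lemma card_roots_le:
  assumes "p \<in> P" "j \<in> {1..k}"
  shows "card {m \<in> {..<p}. p dvd L j (n + Q * m)} \<le> 1"
proof -
  have p: "prime p" using assms by (auto simp: P_def)
  have "m = m'" if m: "m < p" "m' < p" "p dvd L j (n + Q * m)" "p dvd L j (n + Q * m')" for m m'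
  proof -
    have "[L j n + a j * Q * m = L j n + a j * Q * m'] (mod p)"
      using m unfolding L_shift cong_def by (simp add: dvd_imp_mod_0)
    then have "[a j * Q * m = a j * Q * m'] (mod p)" by (simp only: cong_add_lcancel_nat)
    moreover have "coprime (a j * Q) p"
      using prime_imp_coprime[OF p not_dvd_a_Q[OF assms]] by (rule coprime_commute[THEN iffD1])
    ultimately have "[m = m'] (mod p)" by (simp only: cong_mult_lcancel_nat)
    then show ?thesis using m by (simp add: cong_def)
  qed
  then show ?thesis
    by (intro card_le_Suc0_iff_eq[THEN iffD2, folded One_nat_def]) auto
qed

text \<open>With \<open>card_roots_le\<close> this gives exactly one root. Existence matters because
  the root of form \<open>j0\<close> is what brings \<open>F j0 p\<close> into the mean of
  \<open>X p\<close>.\<close>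

lemma ex_root:
  assumes "p \<in> P" "j \<in> {1..k}"
  shows "\<exists>m<p. p dvd L j (n + Q * m)"
proof -
  have p: "prime p" using assms by (auto simp: P_def)
  have p0: "p > 0" using p by (rule prime_gt_0_nat)
  have "coprime (a j * Q) p"
    using prime_imp_coprime[OF p not_dvd_a_Q[OF assms]] by (rule coprime_commute[THEN iffD1])
  then obtain x where x: "[a j * Q * x = Suc 0] (mod p)"
    using cong_solve_coprime_nat by blast
  define e where "e = p - L j n mod p"
  have e: "e + L j n mod p = p" using p0 by (simp add: e_def less_imp_le)
  have "[L j n = L j n mod p] (mod p)" by (simp add: cong_def)
  moreover have "[a j * Q * x * e = Suc 0 * e] (mod p)" using x by (intro cong_mult cong_refl)
  ultimately have "[L j n + a j * Q * x * e = L j n mod p + Suc 0 * e] (mod p)" by (rule cong_add)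
  also have "L j n mod p + Suc 0 * e = p" using e by simp
  finally have "p dvd L j n + a j * Q * x * e" by (simp add: cong_dvd_iff)
  then have "p dvd L j (n + Q * (x * e))" unfolding L_shift by (simp only: mult.assoc)
  then have "p dvd L j (n + Q * ((x * e) mod p))" using dvd_L_mod by blast
  then show ?thesis using p0 by (intro exI[of _ "(x * e) mod p"]) auto
qed

text \<open>A common prime divisor would divide the determinant
  \<open>a i * h j - a j * h i\<close>. Both products are at most \<open>w < p\<close>, so the
  congruence would be an equality, against nondegeneracy.\<close>

lemma dvd_L_unique:
  assumes "p \<in> P" "i \<in> {1..k}" "j \<in> {1..k}" "p dvd L i n" "p dvd L j n"
  shows "i = j"
proof (rule ccontr)
  assume ij: "i \<noteq> j"
  have p: "w < p" using assms by (auto simp: P_def)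
  have eq: "a i * L j n + a j * h i = a j * L i n + a i * h j"
    by (simp add: L_def algebra_simps)
  have "[a i * L j n + a j * h i = 0 + a j * h i] (mod p)"
    using assms by (intro cong_add cong_refl) (simp add: cong_0_iff)
  moreover have "[a j * L i n + a i * h j = 0 + a i * h j] (mod p)"
    using assms by (intro cong_add cong_refl) (simp add: cong_0_iff)
  ultimately have "[a j * h i = a i * h j] (mod p)" unfolding eq by (metis add_0 cong_sym cong_trans)
  moreover have "a j * h i < p" "a i * h j < p" using ah_le_w assms p by (auto intro: le_less_trans)
  ultimately have "a j * h i = a i * h j" by (simp add: cong_def)
  then show False using nondegenerate[OF assms(2,3) ij] by simp
qed

lemma sum_norm_X_minus_1:
  assumes "p \<in> P"
  shows "(\<Sum>m<p. norm (X p (n + Q * m) - 1)) \<le> 2 * real k"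
proof -
  have p0: "p > 0" using assms by (auto simp: P_def prime_gt_0_nat)
  have "(\<Sum>m<p. norm (X p (n + Q * m) - 1)) \<le> (\<Sum>m<p. \<Sum>j=1..k. if p dvd L j (n + Q * m) then 2 else 0)"
  proof (rule sum_mono)
    fix m
    have "norm (X p (n + Q * m) - (\<Prod>j=1..k. 1))
        \<le> (\<Sum>j=1..k. norm ((if p dvd L j (n + Q * m) then F j p else 1) - 1))"
      unfolding X_def using norm_F p0 by (intro norm_prod_diff) auto
    also have "\<dots> \<le> (\<Sum>j=1..k. if p dvd L j (n + Q * m) then 2 else 0)"
    proof (rule sum_mono)
      fix j assume j: "j \<in> {1..k}"
      have "norm (F j p - 1) \<le> 2"
        using norm_triangle_ineq4[of "F j p" 1] norm_F[OF j p0] by simp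
      then show "norm ((if p dvd L j (n + Q * m) then F j p else 1) - 1) \<le> (if p dvd L j (n + Q * m) then 2 else 0)"
        by simp
    qed
    finally show "norm (X p (n + Q * m) - 1) \<le> (\<Sum>j=1..k. if p dvd L j (n + Q * m) then 2 else 0)" by simp
  qed
  also have "\<dots> = (\<Sum>j=1..k. \<Sum>m<p. if p dvd L j (n + Q * m) then 2 else 0)" by (rule sum.swap)
  also have "\<dots> = (\<Sum>j=1..k. 2 * real (card {m \<in> {..<p}. p dvd L j (n + Q * m)}))"
    by (simp add: sum.inter_filter[symmetric] mult.commute)
  also have "\<dots> \<le> (\<Sum>j=1..k. 2 * 1)"
    using card_roots_le[OF assms] by (intro sum_mono mult_left_mono) force+
  finally show ?thesis by simp
qed

text \<open>Write the mean as \<open>1 + z\<close>. At the root of form \<open>j0\<close> the value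
  is exactly \<open>F j0 p\<close>, and every other residue contributes a nonpositive real part,
  which bounds \<open>Re z\<close>. Since the norm of \<open>z\<close> is at most
  \<open>2 * k / p\<close>, half its square is the term
  \<open>2 * k\<^sup>2 / p\<^sup>2\<close>.\<close>

lemma norm_mean_X_le:
  assumes p: "p \<in> P" and j0: "j0 \<in> {1..k}"
  shows "norm ((\<Sum>m<p. X p (n + Q * m)) / of_nat p)
    \<le> exp (2 * (real k)\<^sup>2 * (1 / (real p)\<^sup>2) - (1 - Re (F j0 p)) / real p)"
proof -
  define z where "z = (\<Sum>m<p. X p (n + Q * m) - 1) / of_nat p"
  have p0: "p > 0" using p by (auto simp: P_def prime_gt_0_nat)
  have eq: "(\<Sum>m<p. X p (n + Q * m)) / of_nat p = 1 + z"
    using p0 by (simp add: z_def sum_subtractf field_simps)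
  obtain m0 where m0: "m0 < p" "p dvd L j0 (n + Q * m0)" using ex_root[OF p j0] by blast
  have X0: "X p (n + Q * m0) = F j0 p"
  proof -
    have "(if p dvd L j (n + Q * m0) then F j p else 1) = (if j = j0 then F j0 p else 1)"
      if j: "j \<in> {1..k}" for j
    proof (cases "p dvd L j (n + Q * m0)")
      case True
      then have "j = j0" by (rule dvd_L_unique[OF p j j0 _ m0(2)])
      then show ?thesis using True by simp
    next
      case False
      then have "j \<noteq> j0" using m0(2) by blast
      then show ?thesis using False by simp
    qed
    then have "X p (n + Q * m0) = (\<Prod>j=1..k. if j = j0 then F j0 p else 1)"
      unfolding X_def by (rule prod.cong[OF refl])
    then show ?thesis using j0 by simp
  qed
  have "Re (\<Sum>m<p. X p (n + Q * m) - 1) = (\<Sum>m<p. Re (X p (n + Q * m)) - 1)" by simp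
  also have "\<dots> \<le> (\<Sum>m<p. if m = m0 then Re (F j0 p) - 1 else 0)"
  proof (rule sum_mono)
    fix m
    show "Re (X p (n + Q * m)) - 1 \<le> (if m = m0 then Re (F j0 p) - 1 else 0)"
      using X0 order_trans[OF complex_Re_le_cmod norm_X[OF p0, of "n + Q * m"]] by auto
  qed
  also have "\<dots> = Re (F j0 p) - 1" using m0 by simp
  finally have "Re (\<Sum>m<p. X p (n + Q * m) - 1) / real p \<le> (Re (F j0 p) - 1) / real p"
    using p0 by (intro divide_right_mono) auto
  then have "Re z \<le> - (1 - Re (F j0 p)) / real p" by (simp add: z_def)
  then have Rez: "Re z \<le> - ((1 - Re (F j0 p)) / real p)" by (simp only: minus_divide_left)
  have "norm (\<Sum>m<p. X p (n + Q * m) - 1) \<le> 2 * real k"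
    using sum_norm_X_minus_1[OF p, of n] by (intro order_trans[OF norm_sum]) auto
  then have "norm z \<le> 2 * real k / real p"
    using p0 by (simp add: z_def norm_divide divide_right_mono)
  then have "(norm z)\<^sup>2 \<le> (2 * real k / real p)\<^sup>2" by (intro power_mono) auto
  then have "Re z + (norm z)\<^sup>2 / 2 \<le> 2 * (real k)\<^sup>2 * (1 / (real p)\<^sup>2) - (1 - Re (F j0 p)) / real p"
  proof -
    have "(2 * real k / real p)\<^sup>2 = 2 * (2 * (real k)\<^sup>2 * (1 / (real p)\<^sup>2))"
      by (simp add: power_divide power_mult_distrib)
    then show ?thesis using Rez \<open>(norm z)\<^sup>2 \<le> _\<close> by linarith
  qed
  then show ?thesis unfolding eq
    using order_trans[OF norm_one_plus_le_exp[of z]] by simp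
qed

text \<open>This is \<open>norm_sum_prod_le\<close> with \<open>\<kappa> = 2 * k\<close> on the
  blocks of \<open>P\<close>: Euler product, truncation error and incomplete periods. The free
  degree \<open>B\<close> balances the last two terms.\<close>

lemma norm_sum_prod_X_le:
  assumes j0: "j0 \<in> {1..k}"
  shows "norm (\<Sum>m<H. \<Prod>p\<in>P. X p (n + Q * m))
    \<le> real H * exp (2 * (real k)\<^sup>2 - (\<Sum>p\<in>P. (1 - Re (F j0 p)) / real p))
      + 2 * real H * (exp (exp (8 * real k) / 2 ^ B) - 1)
      + 4 * y ^ (12 * (B + 2))"
proof -
  \<comment> \<open>The top block contains \<open>y\<close>; block \<open>i\<close> is truncated at degree \<open>B + (I - i)\<close>, so that the truncation
    errors sum geometrically while the level stays a power \<open>O(B)\<close> of \<open>y\<close>.\<close>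
  define I where "I = (LEAST i. y \<le> 2 ^ 2 ^ Suc i)"
  have y4: "y \<ge> 4" using w_le_y w4 by linarith
  have "\<exists>i. y \<le> 2 ^ 2 ^ Suc i"
  proof -
    obtain i :: nat where i: "y < 2 ^ i" using real_arch_pow[of 2 y] by auto
    have "(2::real) ^ i \<le> 2 ^ 2 ^ Suc i"
      using less_exp[of "Suc i"] by (intro power_increasing) auto
    then show ?thesis using i by (intro exI[of _ i]) linarith
  qed
  then have I1: "y \<le> 2 ^ 2 ^ Suc I" unfolding I_def by (rule LeastI_ex)
  have I2: "2 ^ 2 ^ I \<le> y"
  proof (cases I)
    case 0
    then show ?thesis using y4 by simp
  next
    case (Suc i)
    then have "\<not> y \<le> 2 ^ 2 ^ Suc i" unfolding I_def by (intro not_less_Least) simp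
    then show ?thesis using Suc by simp
  qed
  define Pb where "Pb i = P \<inter> block_primes i" for i
  define b where "b i = B + (I - i)" for i
  have fin: "finite (Pb i)" for i using finite_P by (simp add: Pb_def)
  have disj: "disjoint_family_on Pb {..I}"
    using disjoint_family_block_primes[of "{..I}"] by (auto simp: disjoint_family_on_def Pb_def)
  have PU: "P = (\<Union>i\<in>{..I}. Pb i)"
  proof (intro equalityI subsetI)
    fix p assume p: "p \<in> P"
    then have "prime p" "2 < p" "real p \<le> y" using w4 by (auto simp: P_def)
    then obtain i where i: "p \<in> block_primes i" using prime_in_block by blast
    have "i \<le> I"
    proof (rule ccontr)
      assume "\<not> i \<le> I"
      then have "(2::nat) ^ 2 ^ Suc I \<le> 2 ^ 2 ^ i" by (intro power_increasing) auto
      also have "\<dots> < p" using i by (simp add: block_primes_def)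
      finally have "real (2 ^ 2 ^ Suc I) < real p" by (simp only: of_nat_less_iff)
      then have "2 ^ 2 ^ Suc I < real p" by (simp only: of_nat_power of_nat_numeral)
      then show False using I1 \<open>real p \<le> y\<close> by linarith
    qed
    then show "p \<in> (\<Union>i\<in>{..I}. Pb i)" using p i by (auto simp: Pb_def)
  qed (auto simp: Pb_def)
  have PbP: "p \<in> P" if "p \<in> Pb i" for p i using that by (simp add: Pb_def)
  have prod_P: "(\<Prod>i\<in>{..I}. \<Prod>p\<in>Pb i. v p) = (\<Prod>p\<in>P. v p)" for v :: "nat \<Rightarrow> complex"
    unfolding PU using fin disj
    by (intro prod.UNION_disjoint[symmetric]) (auto simp: disjoint_family_on_def)

  have main: "norm (\<Prod>p\<in>P. (\<Sum>m<p. X p (n + Q * m)) / of_nat p)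
      \<le> exp (2 * (real k)\<^sup>2 - (\<Sum>p\<in>P. (1 - Re (F j0 p)) / real p))"
  proof -
    have "norm (\<Prod>p\<in>P. (\<Sum>m<p. X p (n + Q * m)) / of_nat p)
        \<le> (\<Prod>p\<in>P. exp (2 * (real k)\<^sup>2 * (1 / (real p)\<^sup>2) - (1 - Re (F j0 p)) / real p))"
      unfolding prod_norm[symmetric] using norm_mean_X_le[OF _ j0] by (intro prod_mono) auto
    also have "\<dots> = exp (2 * (real k)\<^sup>2 * (\<Sum>p\<in>P. 1 / (real p)\<^sup>2) - (\<Sum>p\<in>P. (1 - Re (F j0 p)) / real p))"
      using finite_P by (simp add: exp_sum[symmetric] sum_subtractf sum_distrib_left)
    also have "(\<Sum>p\<in>P. 1 / (real p)\<^sup>2) \<le> 1"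
    proof -
      have "(\<Sum>p\<in>P. 1 / (real p)\<^sup>2) \<le> (\<Sum>p\<in>{w<..nat \<lfloor>y\<rfloor>}. 1 / (real p)\<^sup>2)"
        by (intro sum_mono2) (auto simp: P_def le_nat_floor)
      also have "\<dots> \<le> 1 / real w" using w4 by (intro sum_inverse_squares_le) auto
      also have "\<dots> \<le> 1" using w4 by simp
      finally show ?thesis .
    qed
    then have "exp (2 * (real k)\<^sup>2 * (\<Sum>p\<in>P. 1 / (real p)\<^sup>2) - (\<Sum>p\<in>P. (1 - Re (F j0 p)) / real p))
        \<le> exp (2 * (real k)\<^sup>2 * 1 - (\<Sum>p\<in>P. (1 - Re (F j0 p)) / real p))"
      by (intro exp_le_cancel_iff[THEN iffD2] diff_right_mono mult_left_mono) auto
    finally show ?thesis by simp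
  qed

  \<comment> \<open>The exponent \<open>8 * k\<close> is \<open>2 * (2 * k) * 2\<close>: Rankin's
    weight, \<open>\<kappa>\<close>, and the bound on the reciprocals of a block.\<close>
  have trunc: "(\<Prod>i\<in>{..I}. 1 + elem_sym (Suc (b i)) (Pb i) (\<lambda>p. 2 * real k / real p))
      \<le> exp (exp (8 * real k) / 2 ^ B)"
  proof -
    have "elem_sym (Suc (b i)) (Pb i) (\<lambda>p. 2 * real k / real p) \<le> exp (8 * real k) * (1 / 2 ^ Suc (b i))" for i
    proof -
      have "(\<Sum>p\<in>Pb i. 1 / real p) \<le> (\<Sum>p\<in>block_primes i. 1 / real p)"
        using finite_block_primes by (intro sum_mono2) (auto simp: Pb_def)
      also have "\<dots> \<le> 2" by (rule sum_inverse_block_primes)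
      finally have "2 * real k * (\<Sum>p\<in>Pb i. 1 / real p) \<le> 2 * real k * 2" by (intro mult_left_mono) auto
      then have le: "2 * (\<Sum>p\<in>Pb i. 2 * real k / real p) \<le> 8 * real k"
      proof -
        have "(\<Sum>p\<in>Pb i. 2 * real k / real p) = 2 * real k * (\<Sum>p\<in>Pb i. 1 / real p)"
          by (simp add: sum_distrib_left)
        then show ?thesis using \<open>2 * real k * _ \<le> 2 * real k * 2\<close> by linarith
      qed
      have "elem_sym (Suc (b i)) (Pb i) (\<lambda>p. 2 * real k / real p)
          \<le> exp (2 * (\<Sum>p\<in>Pb i. 2 * real k / real p)) / 2 ^ Suc (b i)"
        using fin by (intro elem_sym_le_exp) auto
      also have "\<dots> \<le> exp (8 * real k) / 2 ^ Suc (b i)" using le by (intro divide_right_mono) auto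
      finally show ?thesis by simp
    qed
    moreover have "0 \<le> elem_sym (Suc (b i)) (Pb i) (\<lambda>p. 2 * real k / real p)" for i
      by (intro elem_sym_nonneg) auto
    ultimately have "(\<Prod>i\<in>{..I}. 1 + elem_sym (Suc (b i)) (Pb i) (\<lambda>p. 2 * real k / real p))
        \<le> (\<Prod>i\<in>{..I}. exp (exp (8 * real k) * (1 / 2 ^ Suc (b i))))"
      by (intro prod_mono conjI add_nonneg_nonneg order_trans[OF _ exp_ge_add_one_self] add_left_mono) auto
    also have "\<dots> = exp (exp (8 * real k) * (\<Sum>i\<le>I. 1 / 2 ^ Suc (b i)))"
      by (simp only: exp_sum[symmetric] sum_distrib_left finite_atMost)
    also have "\<dots> \<le> exp (exp (8 * real k) * (1 / 2 ^ B))"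
      unfolding b_def using sum_geometric_weights_le[of B I]
      by (intro exp_le_cancel_iff[THEN iffD2] mult_left_mono) auto
    finally show ?thesis by simp
  qed

  have size: "(\<Prod>i\<in>{..I}. \<Sum>S | S \<subseteq> Pb i \<and> card S \<le> Suc (b i). (2 * real k) ^ card S) \<le> y ^ (12 * (B + 2))"
  proof -
    have D: "(\<Sum>S | S \<subseteq> Pb i \<and> card S \<le> Suc (b i). (2 * real k) ^ card S) \<le> 2 ^ (6 * (2 ^ i * Suc (b i)))" for i
    \<comment> \<open>A prime \<open>p\<close> of the block gives
      \<open>2 * k \<le> w < p \<le> 2 ^ 2 ^ Suc i\<close>, so \<open>\<kappa>\<close> times the
      cardinality is at most \<open>2 ^ (4 * 2 ^ i)\<close>; the factor \<open>exp 1\<close> raises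
      4 to 6. Without such a prime only the empty subset is left.\<close>
    proof (cases "Pb i = {}")
      case True
      have "{S. S \<subseteq> Pb i \<and> card S \<le> Suc (b i)} = {{}}" using True by auto
      then show ?thesis by (simp only: sum.insert_remove[of "{}"] sum.empty finite.emptyI) simp
    next
      case False
      then obtain p where p: "p \<in> Pb i" by blast
      then have "w < p" "p \<le> 2 ^ 2 ^ Suc i" by (auto simp: Pb_def P_def block_primes_def)
      then have "2 * k \<le> 2 ^ 2 ^ Suc i" using k_le_w by linarith
      then have "real (2 * k) \<le> real (2 ^ 2 ^ Suc i)" by (rule of_nat_mono)
      then have k2: "2 * real k \<le> 2 ^ 2 ^ Suc i" by simp
      have "Pb i \<subseteq> {1..2 ^ 2 ^ Suc i}"
        by (auto simp: Pb_def block_primes_def Suc_le_eq prime_gt_0_nat)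
      then have "card (Pb i) \<le> 2 ^ 2 ^ Suc i" by (metis card_atLeastAtMost card_mono diff_Suc_1 finite_atLeastAtMost)
      then have "real (card (Pb i)) \<le> real (2 ^ 2 ^ Suc i)" by (rule of_nat_mono)
      then have "2 * real k * real (card (Pb i)) \<le> 2 ^ 2 ^ Suc i * 2 ^ 2 ^ Suc i"
        using k2 by (intro mult_mono) auto
      also have "\<dots> = 2 ^ (4 * 2 ^ i)" by (simp flip: power_add)
      finally have *: "2 * real k * real (card (Pb i)) \<le> 2 ^ (4 * 2 ^ i)" .
      have "(\<Sum>S | S \<subseteq> Pb i \<and> card S \<le> Suc (b i). (2 * real k) ^ card S)
          \<le> (2 ^ (4 * 2 ^ i)) ^ Suc (b i) * exp 1"
        using fin * by (intro sum_subsets_power_card_le) auto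
      also have "\<dots> \<le> (2 ^ (4 * 2 ^ i)) ^ Suc (b i) * 2 ^ (2 * (2 ^ i * Suc (b i)))"
      proof (intro mult_left_mono)
        have "exp 1 \<le> (2::real) ^ 2" using e_less_272 by simp
        also have "\<dots> \<le> 2 ^ (2 * (2 ^ i * Suc (b i)))"
        proof (rule power_increasing)
          have "0 < 2 ^ i * Suc (b i)" by simp
          then show "2 \<le> 2 * (2 ^ i * Suc (b i))" by linarith
        qed simp
        finally show "exp 1 \<le> (2::real) ^ (2 * (2 ^ i * Suc (b i)))" .
      qed simp
      also have "\<dots> = 2 ^ (6 * (2 ^ i * Suc (b i)))"
        by (simp only: power_mult[symmetric] power_add[symmetric]) (simp add: algebra_simps)
      finally show ?thesis .
    qed
    have "(\<Prod>i\<in>{..I}. \<Sum>S | S \<subseteq> Pb i \<and> card S \<le> Suc (b i). (2 * real k) ^ card S)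
        \<le> (\<Prod>i\<in>{..I}. 2 ^ (6 * (2 ^ i * Suc (b i))))"
      using D by (intro prod_mono conjI sum_nonneg) auto
    also have "\<dots> = 2 ^ (6 * (\<Sum>i\<le>I. 2 ^ i * (Suc B + (I - i))))"
      by (simp add: power_sum sum_distrib_left b_def)
    also have "\<dots> \<le> 2 ^ (6 * (2 ^ Suc I * (Suc B + 1)))"
      by (intro power_increasing mult_left_mono sum_pow2_weights_le) auto
    \<comment> \<open>The 12 is 6 doubled, since \<open>2 ^ Suc I = 2 * 2 ^ I\<close>; then
      \<open>2 ^ 2 ^ I \<le> y\<close>.\<close>
    also have "\<dots> = (2 ^ 2 ^ I) ^ (12 * (B + 2))"
      by (simp only: power_mult[symmetric]) (simp add: algebra_simps)
    also have "\<dots> \<le> y ^ (12 * (B + 2))" using I2 by (intro power_mono) auto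
    finally show ?thesis .
  qed

  have "norm (\<Sum>m<H. \<Prod>i\<in>{..I}. \<Prod>p\<in>Pb i. X p (n + Q * m))
    \<le> real H * norm (\<Prod>i\<in>{..I}. \<Prod>p\<in>Pb i. (\<Sum>m<p. X p (n + Q * m)) / of_nat p)
      + 2 * real H * ((\<Prod>i\<in>{..I}. 1 + elem_sym (Suc (b i)) (Pb i) (\<lambda>p. 2 * real k / real p)) - 1)
      + 4 * (\<Prod>i\<in>{..I}. \<Sum>S | S \<subseteq> Pb i \<and> card S \<le> Suc (b i). (2 * real k) ^ card S)"
  proof (rule norm_sum_prod_le[OF finite_atMost fin disj])
    fix i p m assume "p \<in> Pb i"
    then have p: "p \<in> P" by (rule PbP)
    then show "prime p" by (simp add: P_def)
    then show "norm (X p (n + Q * m)) \<le> 1" by (intro norm_X prime_gt_0_nat)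
    show "X p (n + Q * (m mod p)) = X p (n + Q * m)" by (rule X_periodic)
    show "(\<Sum>m<p. norm (X p (n + Q * m) - 1)) \<le> 2 * real k" using p by (rule sum_norm_X_minus_1)
  qed
  also have "\<dots> \<le> real H * exp (2 * (real k)\<^sup>2 - (\<Sum>p\<in>P. (1 - Re (F j0 p)) / real p))
      + 2 * real H * (exp (exp (8 * real k) / 2 ^ B) - 1) + 4 * y ^ (12 * (B + 2))"
    unfolding prod_P using main trunc size by (intro add_mono mult_left_mono diff_right_mono) auto
  finally show ?thesis unfolding prod_P .
qed

end

section \<open>Summation over blocks\<close>

lemma norm_cis_diff_le: "norm (cis x - cis y) \<le> \<bar>x - y\<bar>"
proof -
  have "cis x - cis y = cis y * (exp (\<i> * of_real (x - y)) - 1)"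
    by (simp add: cis_conv_exp[symmetric] algebra_simps cis_mult flip: of_real_diff)
  then have "norm (cis x - cis y) = 2 * \<bar>sin ((x - y) / 2)\<bar>"
    by (simp only: norm_mult norm_cis dist_exp_i_1 mult_1)
  also have "\<dots> \<le> 2 * \<bar>(x - y) / 2\<bar>"
    by (intro mult_left_mono abs_sin_x_le_abs_x) auto
  finally show ?thesis by simp
qed

text \<open>Cruder than a logarithm but enough: with \<open>R\<close> blocks of length
  \<open>K\<close>, \<open>K * sqrt R\<close> is the square root of \<open>K * (R * K)\<close>, so
  short blocks compensate.\<close>

lemma sum_inverse_le_sqrt: "(\<Sum>r=1..n. 1 / real r) \<le> 2 * sqrt (real n)"
proof (induction n)
  case (Suc n)
  define s u where "s = sqrt (real n)" and "u = sqrt (real (Suc n))"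
  have u: "u\<^sup>2 = real n + 1" "u \<ge> 1" and s: "s\<^sup>2 = real n" by (simp_all add: s_def u_def)
  have "0 \<le> (u - s)\<^sup>2" by simp
  then have "1 \<le> 2 * (u - s) * u"
    unfolding power2_diff u s using u by (simp add: algebra_simps power2_eq_square)
  then have "1 / u \<le> 2 * (u - s)" using u by (simp add: field_simps)
  moreover have "1 / real (Suc n) \<le> 1 / u"
  proof -
    have "u * 1 \<le> u * u" using u by (intro mult_left_mono) auto
    then have "u \<le> real (Suc n)" using u(1) by (simp add: power2_eq_square)
    then show ?thesis using u by (intro divide_left_mono) auto
  qed
  ultimately have "1 / real (Suc n) \<le> 2 * (u - s)" by (rule order_trans[rotated])
  then show ?case using Suc by (simp add: s_def u_def)
qed simp

lemma sum_lessThan_mult: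
  fixes g :: "nat \<Rightarrow> 'b::comm_monoid_add"
  shows "(\<Sum>n<R * K. g n) = (\<Sum>r<R. \<Sum>m<K. g (r * K + m))"
proof -
  have "(\<Sum>n<R * K. g n) = (\<Sum>r<R. sum g {r * K..<r * K + K})"
    by (rule sum.nat_group[symmetric])
  also have "\<dots> = (\<Sum>r<R. \<Sum>m<K. g (r * K + m))"
  proof (rule sum.cong[OF refl])
    fix r
    have "sum g {0 + r * K..<K + r * K} = (\<Sum>m=0..<K. g (m + r * K))" by (rule sum.shift_bounds_nat_ivl)
    then show "sum g {r * K..<r * K + K} = (\<Sum>m<K. g (r * K + m))"
      by (simp add: add.commute lessThan_atLeast0)
  qed
  finally show ?thesis .
qed

context pretentious_system
begin

text \<open>Each twist depends only on the logarithm of \<open>L j n\<close>, whose increment is at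
  most the relative change of \<open>L j\<close>, hence at most that of \<open>n\<close>.\<close>

lemma norm_\<phi>_diff_le:
  assumes "1 \<le> m" "m \<le> n"
  shows "norm (\<phi> n - \<phi> m) \<le> (\<Sum>j=1..k. \<bar>t j\<bar>) * (real (n - m) / real m)"
proof -
  have "norm (\<phi> n - \<phi> m) \<le> (\<Sum>j=1..k. norm (nat_twist (t j) (L j n) - nat_twist (t j) (L j m)))"
    unfolding \<phi>_def using L_pos by (intro norm_prod_diff) (simp_all add: norm_nat_twist)
  also have "\<dots> \<le> (\<Sum>j=1..k. \<bar>t j\<bar> * (real (n - m) / real m))"
  proof (rule sum_mono)
    fix j assume j: "j \<in> {1..k}"
    have pos: "real (L j n) > 0" "real (L j m) > 0" using L_pos[OF j] by auto
    have le: "real (L j m) \<le> real (L j n)"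
      unfolding L_def using assms by (intro of_nat_mono add_right_mono mult_left_mono) auto
    have "norm (nat_twist (t j) (L j n) - nat_twist (t j) (L j m))
        \<le> \<bar>t j * ln (real (L j n)) - t j * ln (real (L j m))\<bar>"
      using L_pos[OF j] by (simp only: nat_twist_eq_cis norm_cis_diff_le)
    also have "\<dots> = \<bar>t j\<bar> * (ln (real (L j n)) - ln (real (L j m)))"
      using le pos by (simp add: right_diff_distrib[symmetric] abs_mult)
    also have "ln (real (L j n)) - ln (real (L j m)) \<le> (real (L j n) - real (L j m)) / real (L j m)"
      using pos by (intro ln_diff_le)
    also have "\<dots> \<le> real (n - m) / real m"
    proof -
      have "(real (L j n) - real (L j m)) * real m = real (a j) * real (n - m) * real m"
        using assms by (simp add: L_def of_nat_diff algebra_simps)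
      also have "\<dots> \<le> real (n - m) * real (L j m)"
        by (simp add: L_def algebra_simps)
      finally show ?thesis using pos assms by (simp add: field_simps)
    qed
    finally show "norm (nat_twist (t j) (L j n) - nat_twist (t j) (L j m)) \<le> \<bar>t j\<bar> * (real (n - m) / real m)"
      by (simp add: mult_left_mono)
  qed
  finally show ?thesis by (simp only: sum_distrib_right)
qed

text \<open>The block starts beyond \<open>r\<close> times its length, so \<open>\<phi>\<close> can
  be frozen at the left end with error \<open>O(1 / r)\<close>. The rest splits into
  \<open>Q\<close> residue classes; on each \<open>c\<close> is constant and comes out of the
  sum.\<close>

lemma norm_sum_Z_block_le:
  assumes E: "\<And>n. norm (\<Sum>m<H. \<Prod>p\<in>P. X p (n + Q * m)) \<le> E" and r: "1 \<le> r"
  shows "norm (\<Sum>m<H * Q. Z (Suc (r * (H * Q) + m)))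
    \<le> real (H * Q) * ((\<Sum>j=1..k. \<bar>t j\<bar>) * (1 / real r)) + real Q * E"
proof -
  define s where "s = Suc (r * (H * Q))"
  define V where "V n = c n * (\<Prod>p\<in>P. X p n)" for n
  have V1: "norm (V n) \<le> 1" for n
    unfolding V_def norm_mult using norm_c norm_prod_X by (intro mult_le_one) auto
  have eqZ: "(\<Sum>m<H * Q. Z (s + m)) = (\<Sum>m<H * Q. V (s + m) * (\<phi> (s + m) - \<phi> s)) + \<phi> s * (\<Sum>m<H * Q. V (s + m))"
    by (simp add: Z_def V_def sum_distrib_left sum.distrib[symmetric] algebra_simps)
  have "norm (\<Sum>m<H * Q. Z (s + m)) \<le> real (H * Q) * ((\<Sum>j=1..k. \<bar>t j\<bar>) * (1 / real r)) + 1 * (real Q * E)"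
    unfolding eqZ
  proof (intro order_trans[OF norm_triangle_ineq] add_mono)
    have "norm (\<Sum>m<H * Q. V (s + m) * (\<phi> (s + m) - \<phi> s))
        \<le> (\<Sum>m<H * Q. (\<Sum>j=1..k. \<bar>t j\<bar>) * (1 / real r))"
    proof (rule order_trans[OF norm_sum sum_mono])
      fix m assume m: "m \<in> {..<H * Q}"
      have "norm (V (s + m) * (\<phi> (s + m) - \<phi> s)) \<le> 1 * norm (\<phi> (s + m) - \<phi> s)"
        unfolding norm_mult by (intro mult_right_mono V1) auto
      also have "norm (\<phi> (s + m) - \<phi> s) \<le> (\<Sum>j=1..k. \<bar>t j\<bar>) * (real (s + m - s) / real s)"
        by (intro norm_\<phi>_diff_le) (auto simp: s_def)
      also have "\<dots> \<le> (\<Sum>j=1..k. \<bar>t j\<bar>) * (1 / real r)"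
      proof (intro mult_left_mono sum_nonneg)
        have "real (m * r) \<le> real s"
          using m by (intro of_nat_mono) (simp add: s_def mult.commute mult_le_mono le_SucI)
        then show "real (s + m - s) / real s \<le> 1 / real r"
        proof -
          have "real s > 0" "real r > 0" using r by (auto simp: s_def simp del: of_nat_Suc)
          then show ?thesis using \<open>real (m * r) \<le> real s\<close> by (simp add: divide_simps mult.commute)
        qed
      qed auto
      finally show "norm (V (s + m) * (\<phi> (s + m) - \<phi> s)) \<le> (\<Sum>j=1..k. \<bar>t j\<bar>) * (1 / real r)" by simp
    qed
    then show "norm (\<Sum>m<H * Q. V (s + m) * (\<phi> (s + m) - \<phi> s))
        \<le> real (H * Q) * ((\<Sum>j=1..k. \<bar>t j\<bar>) * (1 / real r))" by simp
    have "(\<Sum>m<H * Q. V (s + m)) = (\<Sum>m<H. \<Sum>i<Q. V (s + (m * Q + i)))"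
      by (rule sum_lessThan_mult)
    also have "\<dots> = (\<Sum>i<Q. \<Sum>m<H. V (s + (m * Q + i)))" by (rule sum.swap)
    also have "\<dots> = (\<Sum>i<Q. c (s + i) * (\<Sum>m<H. \<Prod>p\<in>P. X p ((s + i) + Q * m)))"
    proof (rule sum.cong[OF refl])
      fix i
      have eq: "s + (m * Q + i) = (s + i) + Q * m" for m by (simp add: mult.commute)
      show "(\<Sum>m<H. V (s + (m * Q + i))) = c (s + i) * (\<Sum>m<H. \<Prod>p\<in>P. X p ((s + i) + Q * m))"
        unfolding V_def eq c_periodic sum_distrib_left ..
    qed
    finally have eq: "(\<Sum>m<H * Q. V (s + m)) = (\<Sum>i<Q. c (s + i) * (\<Sum>m<H. \<Prod>p\<in>P. X p ((s + i) + Q * m)))" .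
    have "norm (\<Sum>m<H * Q. V (s + m)) \<le> (\<Sum>i<Q. 1 * E)"
      unfolding eq
      by (intro order_trans[OF norm_sum] sum_mono, unfold norm_mult, intro mult_mono norm_c E) auto
    then have "norm (\<Sum>m<H * Q. V (s + m)) \<le> real Q * E" by simp
    then show "norm (\<phi> s * (\<Sum>m<H * Q. V (s + m))) \<le> 1 * (real Q * E)"
      unfolding norm_mult using norm_\<phi> by (intro mult_mono) auto
  qed
  then show ?thesis by (simp add: s_def)
qed

text \<open>Blocks have length \<open>K\<close> at most \<open>N / w\<^sup>2\<close>. Freezing
  \<open>\<phi>\<close> then costs at most \<open>2 * sqrt (K * N) \<le> 2 * N / w\<close> for each
  unit of the sum of the \<open>\<bar>t j\<bar>\<close>, and the first block and the tail, bounded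
  trivially, cost at most \<open>2 * N / w\<close>.\<close>

lemma norm_sum_Z_le:
  fixes B j0 N :: nat
  assumes j0: "j0 \<in> {1..k}" and N: "Q * w\<^sup>2 \<le> N"
  defines "\<delta> \<equiv> exp (2 * (real k)\<^sup>2 - (\<Sum>p\<in>P. (1 - Re (F j0 p)) / real p)) + 2 * (exp (exp (8 * real k) / 2 ^ B) - 1)"
  shows "norm (\<Sum>n=1..N. Z n)
    \<le> real N * (2 / real w + 2 * (\<Sum>j=1..k. \<bar>t j\<bar>) / real w + \<delta>) + 8 * real Q * (real w)\<^sup>2 * y ^ (12 * (B + 2))"
proof -
  define T where "T = (\<Sum>j=1..k. \<bar>t j\<bar>)"
  define Y where "Y = y ^ (12 * (B + 2))"
  define H where "H = N div (Q * w\<^sup>2)"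
  define K where "K = H * Q"
  define R where "R = N div K"
  define E where "E = real H * \<delta> + 4 * Y"
  have w0: "w > 0" "real w \<ge> 1" using w4 by auto
  have Qw: "Q * w\<^sup>2 > 0" using Q_pos w0 by simp
  have H0: "H > 0" unfolding H_def using N Qw by (simp add: div_greater_zero_iff)
  have K0: "K > 0" using H0 Q_pos by (simp add: K_def)
  have Y0: "Y \<ge> 0" using w_le_y by (simp add: Y_def)
  have \<delta>0: "\<delta> \<ge> 0" by (simp add: \<delta>_def)
  have E0: "E \<ge> 0" using Y0 \<delta>0 by (simp add: E_def)
  have T0: "T \<ge> 0" by (simp add: T_def sum_nonneg)
  have Kw: "K * w\<^sup>2 \<le> N"
  proof -
    have "H * (Q * w\<^sup>2) \<le> N" unfolding H_def by (rule div_times_less_eq_dividend)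
    then show ?thesis by (simp add: K_def mult.assoc)
  qed
  have NH: "real N \<le> 2 * real H * (real Q * (real w)\<^sup>2)"
  proof -
    have "N = H * (Q * w\<^sup>2) + N mod (Q * w\<^sup>2)"
      unfolding H_def by (rule div_mult_mod_eq[symmetric])
    also have "N mod (Q * w\<^sup>2) \<le> 1 * (Q * w\<^sup>2)" using mod_less_divisor[OF Qw, of N] by simp
    also have "1 * (Q * w\<^sup>2) \<le> H * (Q * w\<^sup>2)" using H0 by (intro mult_right_mono) auto
    finally have "N \<le> H * (Q * w\<^sup>2) + H * (Q * w\<^sup>2)" by simp
    then have "real N \<le> real (H * (Q * w\<^sup>2) + H * (Q * w\<^sup>2))" by (rule of_nat_mono)
    then show ?thesis by simp
  qed
  have RK: "R * K \<le> N" unfolding R_def by (rule div_times_less_eq_dividend)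
  have NRK: "N < R * K + K" unfolding R_def using K0 by (metis dividend_less_div_times add.commute)
  have R1: "R \<ge> 1"
  proof -
    have "K \<le> K * w\<^sup>2" using w0 by simp
    then have "K \<le> N" using Kw by (rule order_trans)
    then show ?thesis using K0 by (simp add: R_def Suc_le_eq div_greater_zero_iff)
  qed
  have E_bound: "norm (\<Sum>m<H. \<Prod>p\<in>P. X p (n + Q * m)) \<le> E" for n
    using norm_sum_prod_X_le[OF j0, where H = H and n = n and B = B] by (simp add: E_def \<delta>_def Y_def algebra_simps)

  have "(\<Sum>n=1..N. Z n) = (\<Sum>n<N. Z (Suc n))"
    by (simp add: sum.atLeast_Suc_atMost_Suc_shift lessThan_Suc_atMost[symmetric] sum.atLeast1_atMost_eq)
  also have "\<dots> = (\<Sum>n<R * K. Z (Suc n)) + (\<Sum>n\<in>{R * K..<N}. Z (Suc n))"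
    unfolding lessThan_atLeast0 using RK by (simp add: sum.atLeastLessThan_concat)
  finally have eq: "(\<Sum>n=1..N. Z n) = (\<Sum>n<R * K. Z (Suc n)) + (\<Sum>n\<in>{R * K..<N}. Z (Suc n))" .
  have "norm (\<Sum>n=1..N. Z n) \<le> (real K + (\<Sum>r=1..R. real K * (T * (1 / real r)) + real Q * E)) + real K"
    unfolding eq
  proof (intro order_trans[OF norm_triangle_ineq] add_mono)
    have "norm (\<Sum>n\<in>{R * K..<N}. Z (Suc n)) \<le> (\<Sum>n\<in>{R * K..<N}. 1)"
      by (intro order_trans[OF norm_sum] sum_mono norm_Z)
    also have "\<dots> \<le> real K" using NRK by simp
    finally show "norm (\<Sum>n\<in>{R * K..<N}. Z (Suc n)) \<le> real K" .
    \<comment> \<open>The block \<open>r = 0\<close> is split off because there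
      \<open>\<phi>\<close> need not vary slowly.\<close>
    have R: "{..<R} = insert 0 {1..<R}" using R1 by auto
    have eq': "(\<Sum>n<R * K. Z (Suc n)) = (\<Sum>m<K. Z (Suc m)) + (\<Sum>r=1..<R. \<Sum>m<K. Z (Suc (r * K + m)))"
      unfolding sum_lessThan_mult R by simp
    show "norm (\<Sum>n<R * K. Z (Suc n)) \<le> real K + (\<Sum>r=1..R. real K * (T * (1 / real r)) + real Q * E)"
      unfolding eq'
    proof (intro order_trans[OF norm_triangle_ineq] add_mono)
      have "norm (\<Sum>m<K. Z (Suc m)) \<le> (\<Sum>m<K. 1)"
        by (intro order_trans[OF norm_sum] sum_mono norm_Z)
      then show "norm (\<Sum>m<K. Z (Suc m)) \<le> real K" by simp
      have "norm (\<Sum>r=1..<R. \<Sum>m<K. Z (Suc (r * K + m))) \<le> (\<Sum>r=1..<R. real K * (T * (1 / real r)) + real Q * E)"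
        unfolding K_def T_def by (intro order_trans[OF norm_sum] sum_mono norm_sum_Z_block_le E_bound) auto
      also have "\<dots> \<le> (\<Sum>r=1..R. real K * (T * (1 / real r)) + real Q * E)"
        using T0 E0 by (intro sum_mono2) auto
      finally show "norm (\<Sum>r=1..<R. \<Sum>m<K. Z (Suc (r * K + m))) \<le> (\<Sum>r=1..R. real K * (T * (1 / real r)) + real Q * E)" .
    qed
  qed
  also have "\<dots> = 2 * real K + T * (real K * (\<Sum>r=1..R. 1 / real r)) + real R * real Q * E"
    by (simp add: sum.distrib sum_distrib_left mult_ac)
  also have "\<dots> \<le> real N * (2 / real w) + T * (2 * real N / real w) + (real N * \<delta> + 8 * real Q * (real w)\<^sup>2 * Y)"
  proof (intro add_mono)
    have Kw': "real K * (real w)\<^sup>2 \<le> real N"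
      using of_nat_mono[OF Kw, where ?'a = real] by simp
    have "real K * real w \<le> real K * (real w)\<^sup>2"
      using w0 by (intro mult_left_mono) (auto simp: power2_eq_square)
    then show "2 * real K \<le> real N * (2 / real w)" using Kw' w0 by (simp add: field_simps)
    have "real K * (\<Sum>r=1..R. 1 / real r) \<le> real K * (2 * sqrt (real R))"
      by (intro mult_left_mono sum_inverse_le_sqrt) auto
    also have "\<dots> = 2 * sqrt (real K * (real R * real K))"
      by (simp add: real_sqrt_mult mult_ac)
    also have "\<dots> \<le> 2 * sqrt ((real N / real w)\<^sup>2)"
    proof (intro mult_left_mono real_sqrt_le_mono)
      have "real R * real K \<le> real N" using of_nat_mono[OF RK, where ?'a = real] by simp
      then have "real K * (real R * real K) \<le> real N / (real w)\<^sup>2 * real N"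
        using Kw' w0 by (intro mult_mono) (auto simp: field_simps)
      then show "real K * (real R * real K) \<le> (real N / real w)\<^sup>2"
        by (simp add: power2_eq_square)
    qed simp
    finally show "T * (real K * (\<Sum>r=1..R. 1 / real r)) \<le> T * (2 * real N / real w)"
      using T0 by (intro mult_left_mono) auto
    have RQH: "real R * real Q * real H \<le> real N"
      using of_nat_mono[OF RK, where ?'a = real] by (simp add: K_def mult_ac)
    have "real R * real Q * real H \<le> 2 * real H * (real Q * (real w)\<^sup>2)" using RQH NH by linarith
    then have "real H * (real R * real Q) \<le> real H * (2 * (real Q * (real w)\<^sup>2))"
      by (simp only: mult_ac)
    \<comment> \<open>From \<open>R * Q * H \<le> N \<le> 2 * H * Q * w\<^sup>2\<close> by
      cancelling \<open>H\<close>. It bounds how often the error \<open>4 * Y\<close>, which is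
      independent of \<open>H\<close>, is incurred.\<close>
    then have RQ: "real R * real Q \<le> 2 * (real Q * (real w)\<^sup>2)"
      using H0 by (subst (asm) mult_le_cancel_left_pos) auto
    have "real R * real Q * E = real R * real Q * real H * \<delta> + real R * real Q * (4 * Y)"
      by (simp add: E_def algebra_simps)
    also have "\<dots> \<le> real N * \<delta> + 2 * (real Q * (real w)\<^sup>2) * (4 * Y)"
      using RQH RQ \<delta>0 Y0 by (intro add_mono mult_right_mono) auto
    finally show "real R * real Q * E \<le> real N * \<delta> + 8 * real Q * (real w)\<^sup>2 * Y" by simp
  qed
  finally show ?thesis unfolding T_def Y_def by (simp add: algebra_simps)
qed

end

section \<open>Choice of parameters\<close>

text \<open>Lets every \<open>O(\<epsilon>)\<close> error be absorbed, at the price of a factor 2,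
  into \<open>\<epsilon>\<close> times the square root of
  \<open>ln (1 / \<epsilon>)\<close>.\<close>

lemma half_le_sqrt_ln:
  fixes \<epsilon> :: real
  assumes "0 < \<epsilon>" "\<epsilon> < 1 / 2"
  shows "ln 2 \<le> ln (1 / \<epsilon>)" "1 / 2 \<le> sqrt (ln (1 / \<epsilon>))"
proof -
  have "2 \<le> 1 / \<epsilon>" using assms by (simp add: field_simps)
  then show *: "ln 2 \<le> ln (1 / \<epsilon>)" using assms by (intro ln_mono) auto
  have "(1 / 2)\<^sup>2 \<le> ln (1 / \<epsilon>)" using * ln2_ge_two_thirds by (simp add: power2_eq_square)
  then show "1 / 2 \<le> sqrt (ln (1 / \<epsilon>))" by (rule real_le_rsqrt)
qed

context pretentious_system
begin

lemma Re_F_le: "j \<in> {1..k} \<Longrightarrow> 0 < p \<Longrightarrow> Re (F j p) \<le> 1"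
  using norm_F[of j p] complex_Re_le_cmod[of "F j p"] by linarith

text \<open>For \<open>p \<le> w\<close> the numerator is at most \<open>2 \<le> p\<close>, so every
  discarded term is at most \<open>1\<close>.\<close>

lemma sum_P_ge:
  assumes j: "j \<in> {1..k}"
  shows "(\<Sum>p | prime p \<and> real p \<le> y. (1 - Re (F j p)) / real p) - real w
    \<le> (\<Sum>p\<in>P. (1 - Re (F j p)) / real p)"
proof -
  let ?S = "{p. prime p \<and> p \<le> w}"
  have fin: "finite ?S" by (rule finite_subset[of _ "{..w}"]) auto
  have eq: "{p. prime p \<and> real p \<le> y} = ?S \<union> P"
    using w_le_y by (auto simp: P_def)
  have "(\<Sum>p\<in>?S \<union> P. (1 - Re (F j p)) / real p)
      = (\<Sum>p\<in>?S. (1 - Re (F j p)) / real p) + (\<Sum>p\<in>P. (1 - Re (F j p)) / real p)"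
    using fin finite_P by (intro sum.union_disjoint) (auto simp: P_def)
  moreover have "(\<Sum>p\<in>?S. (1 - Re (F j p)) / real p) \<le> (\<Sum>p\<in>{1..w}. 1)"
  proof (rule order_trans[OF sum_mono[where g = "\<lambda>_. 1"] sum_mono2])
    fix p assume p: "p \<in> ?S"
    then have p2: "2 \<le> p" using prime_ge_2_nat by auto
    then have "\<bar>Re (F j p)\<bar> \<le> 1" using norm_F[OF j, of p] abs_Re_le_cmod[of "F j p"] by auto
    then have "1 - Re (F j p) \<le> real p" using p2 by linarith
    then show "(1 - Re (F j p)) / real p \<le> 1" using p2 by (simp add: divide_le_eq_1)
  qed (auto simp: Suc_le_eq prime_gt_0_nat)
  ultimately show ?thesis unfolding eq by simp
qed

text \<open>Up to \<open>x\<close>, Cauchy--Schwarz uses that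
  \<open>(norm (1 - F j p))\<^sup>2\<close> is at most \<open>2 * (1 - Re (F j p))\<close>, because
  \<open>F j p\<close> lies in the disc. From \<open>x\<close> to \<open>2 ^ v * x\<close> only the
  bound 2 is available, but there the reciprocals of primes sum to \<open>O(1 / log x)\<close>,
  hence \<open>O(\<epsilon>)\<close>.\<close>

lemma sum_large_primes_le:
  fixes x \<epsilon> :: real
  assumes \<epsilon>: "0 < \<epsilon>" "\<epsilon> < 1 / 2" and y: "y = x powr \<epsilon>" and x: "4 \<le> x" "1 / \<epsilon> \<le> log 2 x"
    and N: "real N \<le> x" and j: "j \<in> {1..k}" and v: "a j + h j \<le> 2 ^ v"
    and close: "(\<Sum>p | prime p \<and> y \<le> real p \<and> real p \<le> x. (1 - Re (F j p)) / real p) \<le> \<epsilon>\<^sup>2"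
  shows "(\<Sum>p | prime p \<and> y < real p \<and> p \<le> (a j + h j) * N. norm (1 - F j p) / real p)
    \<le> 5 * (\<epsilon> * sqrt (ln (1 / \<epsilon>))) + 8 * (real v + 1) * \<epsilon>"
proof -
  let ?A = "{p. prime p \<and> y < real p \<and> real p \<le> x}"
  let ?A' = "{p. prime p \<and> y \<le> real p \<and> real p \<le> x}"
  let ?B = "{p. prime p \<and> x < real p \<and> real p \<le> 2 ^ v * x}"
  have finx: "finite {p::nat. prime p \<and> Q p \<and> real p \<le> z}" for Q z
    by (rule finite_subset[of _ "{..nat \<lfloor>z\<rfloor>}"]) (auto simp: le_nat_floor)
  have y4: "4 \<le> y" using w_le_y w4 by linarith
  have p0: "0 < p" if "prime p" for p :: nat using that by (rule prime_gt_0_nat)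
  have "(\<Sum>p | prime p \<and> y < real p \<and> p \<le> (a j + h j) * N. norm (1 - F j p) / real p)
      \<le> (\<Sum>p\<in>?A \<union> ?B. norm (1 - F j p) / real p)"
  proof (rule sum_mono2)
    show "finite (?A \<union> ?B)" using finx by simp
    show "{p. prime p \<and> y < real p \<and> p \<le> (a j + h j) * N} \<subseteq> ?A \<union> ?B"
    proof
      fix p assume "p \<in> {p. prime p \<and> y < real p \<and> p \<le> (a j + h j) * N}"
      then have p: "prime p" "y < real p" "p \<le> (a j + h j) * N" by auto
      have "real p \<le> real (a j + h j) * real N" using p(3) by (metis of_nat_le_iff of_nat_mult)
      also have "\<dots> \<le> real (2 ^ v) * x" using v N by (intro mult_mono of_nat_mono) auto
      finally show "p \<in> ?A \<union> ?B" using p by auto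
    qed
  qed auto
  also have "\<dots> = (\<Sum>p\<in>?A. norm (1 - F j p) / real p) + (\<Sum>p\<in>?B. norm (1 - F j p) / real p)"
    using finx by (intro sum.union_disjoint) auto
  also have "(\<Sum>p\<in>?A. norm (1 - F j p) / real p) \<le> 5 * (\<epsilon> * sqrt (ln (1 / \<epsilon>)))"
  proof (rule power2_le_imp_le)
    have "(\<Sum>p\<in>?A. norm (1 - F j p) / real p)\<^sup>2
        = (\<Sum>p\<in>?A. (norm (1 - F j p) / sqrt (real p)) * (1 / sqrt (real p)))\<^sup>2" by simp
    also have "\<dots> \<le> (\<Sum>p\<in>?A. (norm (1 - F j p) / sqrt (real p))\<^sup>2) * (\<Sum>p\<in>?A. (1 / sqrt (real p))\<^sup>2)"
      by (rule Cauchy_Schwarz_ineq_sum)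
    also have "\<dots> = (\<Sum>p\<in>?A. (norm (1 - F j p))\<^sup>2 / real p) * (\<Sum>p\<in>?A. 1 / real p)"
      by (simp add: power_divide)
    also have "\<dots> \<le> (2 * \<epsilon>\<^sup>2) * (12 * ln (1 / \<epsilon>))"
    proof (intro mult_mono sum_nonneg)
      have "(\<Sum>p\<in>?A. (norm (1 - F j p))\<^sup>2 / real p) \<le> (\<Sum>p\<in>?A'. 2 * ((1 - Re (F j p)) / real p))"
      proof (rule order_trans[OF sum_mono sum_mono2])
        fix p assume p: "p \<in> ?A"
        have "(norm (1 - F j p))\<^sup>2 = 1 - 2 * Re (F j p) + (norm (F j p))\<^sup>2"
          unfolding cmod_power2 by (simp add: power2_eq_square algebra_simps)
        also have "(norm (F j p))\<^sup>2 \<le> 1\<^sup>2" using norm_F[OF j, of p] p p0 by (intro power_mono) auto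
        finally have "(norm (1 - F j p))\<^sup>2 \<le> 2 * (1 - Re (F j p))" by simp
        then show "(norm (1 - F j p))\<^sup>2 / real p \<le> 2 * ((1 - Re (F j p)) / real p)"
          by (simp add: divide_right_mono)
      qed (use finx Re_F_le[OF j] p0 in auto)
      also have "\<dots> = 2 * (\<Sum>p\<in>?A'. (1 - Re (F j p)) / real p)" by (simp only: sum_distrib_left)
      also have "\<dots> \<le> 2 * \<epsilon>\<^sup>2" using close by simp
      finally show "(\<Sum>p\<in>?A. (norm (1 - F j p))\<^sup>2 / real p) \<le> 2 * \<epsilon>\<^sup>2" .
      have "(\<Sum>p\<in>?A. 1 / real p) \<le> 2 * (max 0 (log 2 (1 / \<epsilon>)) + 2)"
        unfolding y using \<epsilon> x y y4 by (intro sum_inverse_primes_powr_le) auto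
      also have "\<dots> \<le> 12 * ln (1 / \<epsilon>)"
      proof -
        have l: "ln 2 \<le> ln (1 / \<epsilon>)" using \<epsilon> by (rule half_le_sqrt_ln)
        have "1 \<le> log 2 (1 / \<epsilon>)" using l by (simp add: log_def)
        then have "2 * (max 0 (log 2 (1 / \<epsilon>)) + 2) \<le> 6 * log 2 (1 / \<epsilon>)" by simp
        also have "log 2 (1 / \<epsilon>) \<le> 2 * ln (1 / \<epsilon>)"
        proof -
          have "ln (1 / \<epsilon>) * 1 \<le> ln (1 / \<epsilon>) * (2 * ln 2)"
            using l ln2_ge_two_thirds by (intro mult_left_mono) linarith+
          then show ?thesis by (simp add: log_def divide_le_eq mult_ac)
        qed
        finally show ?thesis by simp
      qed
      finally show "(\<Sum>p\<in>?A. 1 / real p) \<le> 12 * ln (1 / \<epsilon>)" .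
    qed auto
    \<comment> \<open>The product is \<open>24\<close>; it is rounded up to a perfect
      square.\<close>
    also have "\<dots> \<le> 25 * (\<epsilon>\<^sup>2 * ln (1 / \<epsilon>))"
      using half_le_sqrt_ln(1)[OF \<epsilon>] ln2_ge_two_thirds by simp
    also have "\<dots> = (5 * (\<epsilon> * sqrt (ln (1 / \<epsilon>))))\<^sup>2"
      using half_le_sqrt_ln(1)[OF \<epsilon>] ln2_ge_two_thirds by (simp add: power_mult_distrib)
    finally show "(\<Sum>p\<in>?A. norm (1 - F j p) / real p)\<^sup>2 \<le> (5 * (\<epsilon> * sqrt (ln (1 / \<epsilon>))))\<^sup>2" .
    show "0 \<le> 5 * (\<epsilon> * sqrt (ln (1 / \<epsilon>)))"
      using half_le_sqrt_ln(2)[OF \<epsilon>] \<epsilon> by (intro mult_nonneg_nonneg) auto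
  qed
  also have "(\<Sum>p\<in>?B. norm (1 - F j p) / real p) \<le> 8 * (real v + 1) * \<epsilon>"
  proof -
    have "(\<Sum>p\<in>?B. norm (1 - F j p) / real p) \<le> (\<Sum>p\<in>?B. 2 * (1 / real p))"
    proof (rule sum_mono)
      fix p assume "p \<in> ?B"
      then have "norm (1 - F j p) \<le> 2"
        using norm_triangle_ineq4[of 1 "F j p"] norm_F[OF j, of p] p0 by simp
      then show "norm (1 - F j p) / real p \<le> 2 * (1 / real p)" by (simp add: divide_right_mono)
    qed
    also have "\<dots> = 2 * (\<Sum>p\<in>?B. 1 / real p)" by (simp only: sum_distrib_left)
    also have "\<dots> \<le> 2 * (4 * (real v + 1) / log 2 x)"
      by (intro mult_left_mono sum_inverse_primes_dilate_le x(1)) auto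
    also have "\<dots> = 8 * (real v + 1) * (1 / log 2 x)" by simp
    also have "\<dots> \<le> 8 * (real v + 1) * \<epsilon>"
    proof (intro mult_left_mono)
      have "0 < log 2 x" using x by simp
      then show "1 / log 2 x \<le> \<epsilon>" using x(2) \<epsilon> by (simp add: field_simps)
    qed auto
    finally show ?thesis .
  qed
  finally show ?thesis by simp
qed

text \<open>Combines the comparison with \<open>Z\<close> and the bound for \<open>Z\<close>. The
  last three assumptions isolate what \<open>B\<close> and \<open>w\<close> must achieve: affordable
  level, small truncation error, small Euler product.\<close>

lemma norm_sum_prod_f_le:
  fixes x \<epsilon> :: real and B N v :: nat
  assumes \<epsilon>: "0 < \<epsilon>" "\<epsilon> < 1 / 2" and y: "y = x powr \<epsilon>" and x: "4 \<le> x" "1 / \<epsilon> \<le> log 2 x"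
    and N: "real N \<le> x" "Q * w\<^sup>2 \<le> N" and v: "\<And>j. j \<in> {1..k} \<Longrightarrow> a j + h j \<le> 2 ^ v"
    and w: "1 / \<epsilon> \<le> real w" "real w \<le> 1 / \<epsilon> + 1"
    and close: "\<And>j. j \<in> {1..k} \<Longrightarrow>
      (\<Sum>p | prime p \<and> y \<le> real p \<and> real p \<le> x. (1 - Re (F j p)) / real p) \<le> \<epsilon>\<^sup>2"
    and j0: "j0 \<in> {1..k}"
    and far: "(1 / \<epsilon>)\<^sup>2 \<le> (\<Sum>p | prime p \<and> real p \<le> y. (1 - Re (F j0 p)) / real p)"
    and level: "8 * real Q * (real w)\<^sup>2 * y ^ (12 * (B + 2)) \<le> x / real w"
    and B: "exp (exp (8 * real k) / 2 ^ B) - 1 \<le> 1 / real w"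
    and Euler: "exp (2 * (real k)\<^sup>2 - ((real w - 1)\<^sup>2 - real w)) \<le> 1 / real w"
  shows "norm (\<Sum>n=1..N. \<Prod>j=1..k. f j (L j n))
    \<le> x * (((\<Sum>j=1..k. real (a j + h j)) * (29 + 16 * real v) + 4 * (\<Sum>j=1..k. \<bar>t j\<bar>) + 12)
        * (sqrt (ln (1 / \<epsilon>)) * \<epsilon>))"
proof -
  define A where "A = (\<Sum>j=1..k. real (a j + h j))"
  define T where "T = (\<Sum>j=1..k. \<bar>t j\<bar>)"
  define s where "s = \<epsilon> * sqrt (ln (1 / \<epsilon>))"
  define D where "D = (\<Sum>p\<in>P. (1 - Re (F j0 p)) / real p)"
  have x0: "x > 0" using x by simp
  have A0: "A \<ge> 0" and T0: "T \<ge> 0" by (auto simp: A_def T_def intro!: sum_nonneg)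
  have w0: "real w > 0" using w4 by simp
  have w\<epsilon>: "1 / real w \<le> \<epsilon>" using w(1) w0 \<epsilon> by (simp add: field_simps)
  have \<epsilon>s: "\<epsilon> \<le> 2 * s"
    using half_le_sqrt_ln(2)[OF \<epsilon>] \<epsilon> by (simp add: s_def)
  have s0: "s \<ge> 0" using \<epsilon>s \<epsilon> by linarith

  have "(real w - 1)\<^sup>2 \<le> (1 / \<epsilon>)\<^sup>2"
    using w w4 by (intro power_mono) auto
  then have "(real w - 1)\<^sup>2 - real w \<le> D"
    unfolding D_def using far sum_P_ge[OF j0] by linarith
  then have "exp (2 * (real k)\<^sup>2 - D) \<le> exp (2 * (real k)\<^sup>2 - ((real w - 1)\<^sup>2 - real w))" by simp
  with Euler have D: "exp (2 * (real k)\<^sup>2 - D) \<le> \<epsilon>" using w\<epsilon> by linarith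
  define m where "m = 2 / real w + 2 * T / real w + (exp (2 * (real k)\<^sup>2 - D) + 2 * (exp (exp (8 * real k) / 2 ^ B) - 1))"
  have m: "m \<le> (5 + 2 * T) * \<epsilon>"
  proof -
    have "m = 2 * (1 / real w) + 2 * (T * (1 / real w))
        + (exp (2 * (real k)\<^sup>2 - D) + 2 * (exp (exp (8 * real k) / 2 ^ B) - 1))"
      by (simp add: m_def)
    also have "\<dots> \<le> 2 * \<epsilon> + 2 * (T * \<epsilon>) + (\<epsilon> + 2 * \<epsilon>)"
      by (intro add_mono mult_left_mono w\<epsilon> D T0 order_trans[OF B]) auto
    finally show ?thesis by (simp add: algebra_simps)
  qed
  have "0 \<le> exp (exp (8 * real k) / 2 ^ B) - 1" by simp
  then have m0: "m \<ge> 0" unfolding m_def using T0 by (intro add_nonneg_nonneg) auto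

  have "norm (\<Sum>n=1..N. Z n) \<le> real N * m + 8 * real Q * (real w)\<^sup>2 * y ^ (12 * (B + 2))"
    using norm_sum_Z_le[OF j0 N(2), of B] unfolding m_def D_def T_def by simp
  also have "\<dots> \<le> x * ((5 + 2 * T) * \<epsilon>) + x * \<epsilon>"
  proof (rule add_mono[OF mult_mono[OF N(1) m _ m0]])
    have "x / real w \<le> x * \<epsilon>" using mult_left_mono[OF w\<epsilon>, of x] x0 by simp
    then show "8 * real Q * (real w)\<^sup>2 * y ^ (12 * (B + 2)) \<le> x * \<epsilon>" using level by linarith
  qed (use x0 in auto)
  finally have Z: "norm (\<Sum>n=1..N. Z n) \<le> x * ((6 + 2 * T) * \<epsilon>)" by (simp add: algebra_simps)

  have "norm ((\<Sum>n=1..N. \<Prod>j=1..k. f j (L j n)) - (\<Sum>n=1..N. Z n))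
      \<le> A * real N * (4 / real w) + (\<Sum>j=1..k. real (a j + h j) * real N *
          (\<Sum>p | prime p \<and> y < real p \<and> p \<le> (a j + h j) * N. norm (1 - F j p) / real p))"
    unfolding A_def by (rule sum_prod_f_approx)
  also have "\<dots> \<le> A * x * (4 * \<epsilon>) + (\<Sum>j=1..k. real (a j + h j) * x * (5 * s + 8 * (real v + 1) * \<epsilon>))"
  proof (intro add_mono sum_mono mult_mono)
    fix j assume j: "j \<in> {1..k}"
    show "(\<Sum>p | prime p \<and> y < real p \<and> p \<le> (a j + h j) * N. norm (1 - F j p) / real p)
        \<le> 5 * s + 8 * (real v + 1) * \<epsilon>"
      unfolding s_def by (rule sum_large_primes_le[OF \<epsilon> y x N(1) j v[OF j] close[OF j]])
  qed (use A0 N x0 w\<epsilon> in \<open>auto intro!: sum_nonneg mult_nonneg_nonneg\<close>)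
  also have "\<dots> = x * (A * (4 * \<epsilon> + (5 * s + 8 * (real v + 1) * \<epsilon>)))"
    by (simp only: A_def sum_distrib_right[symmetric]) (simp add: algebra_simps)
  finally have "norm (\<Sum>n=1..N. \<Prod>j=1..k. f j (L j n))
      \<le> x * (A * (4 * \<epsilon> + (5 * s + 8 * (real v + 1) * \<epsilon>))) + x * ((6 + 2 * T) * \<epsilon>)"
    using Z norm_triangle_sub[of "\<Sum>n=1..N. \<Prod>j=1..k. f j (L j n)" "\<Sum>n=1..N. Z n"] by linarith
  also have "\<dots> = x * (A * (4 * \<epsilon> + (5 * s + 8 * (real v + 1) * \<epsilon>)) + (6 + 2 * T) * \<epsilon>)"
    by (simp only: distrib_left)
  \<comment> \<open>Every bare \<open>\<epsilon>\<close> becomes \<open>2 * s\<close>, whence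
    \<open>29 + 16 * v = 8 + 5 + 16 * (v + 1)\<close>, and 4 and 12 as twice 2 and 6.\<close>
  also have "\<dots> \<le> x * (A * (4 * (2 * s) + (5 * s + 8 * (real v + 1) * (2 * s))) + (6 + 2 * T) * (2 * s))"
    using x0 A0 T0 \<epsilon>s by (intro mult_left_mono add_mono) auto
  also have "\<dots> = x * ((A * (29 + 16 * real v) + 4 * T + 12) * (sqrt (ln (1 / \<epsilon>)) * \<epsilon>))"
    by (simp add: s_def algebra_simps)
  finally show ?thesis unfolding A_def T_def .
qed

end

text \<open>As \<open>ln x \<ge> exp (w - 1)\<close>, all requirements on \<open>x\<close> become
  requirements on \<open>w\<close> alone. The last four give, in order, \<open>w \<le> y\<close>,
  \<open>8 * Q * w ^ 3 \<le> x powr (1 / 4)\<close>, the truncation bound and the Euler product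
  bound.\<close>

lemma eventually_parameters:
  fixes k q0 M :: nat
  shows "eventually (\<lambda>w::nat. M \<le> w \<and> 192 \<le> w \<and>
    real w \<le> exp (exp (real w - 1) / real w) \<and>
    8 * real q0 * real w powr ((real w)\<^sup>2 + 3) \<le> exp (exp (real w - 1) / 4) \<and>
    exp (8 * real k) / 2 powr (real w / 96 - 3) \<le> 1 / (2 * real w) \<and>
    exp (2 * (real k)\<^sup>2 - ((real w - 1)\<^sup>2 - real w)) \<le> 1 / real w) sequentially"
proof (intro eventually_conj)
  show "eventually (\<lambda>w::nat. M \<le> w) sequentially" by (rule eventually_ge_at_top)
  show "eventually (\<lambda>w::nat. 192 \<le> w) sequentially" by (rule eventually_ge_at_top)
  show "eventually (\<lambda>w::nat. real w \<le> exp (exp (real w - 1) / real w)) sequentially" by real_asymp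
  show "eventually (\<lambda>w::nat. 8 * real q0 * real w powr ((real w)\<^sup>2 + 3) \<le> exp (exp (real w - 1) / 4)) sequentially"
  proof (cases "q0 = 0")
    case False
    then have "real q0 > 0" by simp
    then show ?thesis by real_asymp
  qed simp
  show "eventually (\<lambda>w::nat. exp (8 * real k) / 2 powr (real w / 96 - 3) \<le> 1 / (2 * real w)) sequentially"
    by real_asymp
  show "eventually (\<lambda>w::nat. exp (2 * (real k)\<^sup>2 - ((real w - 1)\<^sup>2 - real w)) \<le> 1 / real w) sequentially"
    by real_asymp
qed

theorem theorem4p1:
  fixes k :: nat and a h q :: "nat \<Rightarrow> nat"
    and chi :: "nat \<Rightarrow> nat \<Rightarrow> complex" and t :: "nat \<Rightarrow> real"
  assumes "k \<ge> 1"
    and "\<And>j. j \<in> {1..k} \<Longrightarrow> a j \<ge> 1"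
    and "\<And>j. j \<in> {1..k} \<Longrightarrow> h j \<ge> 1"
    and "\<And>i j. i \<in> {1..k} \<Longrightarrow> j \<in> {1..k} \<Longrightarrow> i \<noteq> j \<Longrightarrow> a i * h j \<noteq> a j * h i"
    and "\<And>j. j \<in> {1..k} \<Longrightarrow> dirichlet_character (q j) (chi j)"
  shows "\<exists>C::real. \<forall>(x::real) (\<epsilon>::real) (f :: nat \<Rightarrow> nat \<Rightarrow> complex).
    x \<ge> 3 \<longrightarrow> 1 / ln (ln x) < \<epsilon> \<longrightarrow> \<epsilon> < 1 / 2 \<longrightarrow>
    (\<forall>j\<in>{1..k}. multiplicative_fun (f j) \<and> (\<forall>n\<ge>1. f j n \<in> cball 0 1)) \<longrightarrow>
    Max ((\<lambda>j. pretentious_dist_trunc (f j) (twisted_character (chi j) (t j)) (x powr \<epsilon>) x) ` {1..k}) \<le> \<epsilon> \<longrightarrow>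
    Max ((\<lambda>j. pretentious_dist (f j) (twisted_character (chi j) (t j)) (x powr \<epsilon>)) ` {1..k}) \<ge> 1 / \<epsilon> \<longrightarrow>
    cmod (1 / of_real x * (\<Sum>n | n \<ge> 1 \<and> real n \<le> x. \<Prod>j=1..k. f j (a j * n + h j)))
      \<le> C * (sqrt (ln (1 / \<epsilon>)) * \<epsilon>)"
proof -
  define q0 where "q0 = (\<Prod>j=1..k. q j)"
  define A where "A = (\<Sum>j=1..k. real (a j + h j))"
  define T where "T = (\<Sum>j=1..k. \<bar>t j\<bar>)"
  \<comment> \<open>Any power of two above all \<open>a j + h j\<close> will do;
    \<open>2 ^ v\<close> is crude but depends on the fixed data only.\<close>
  define v where "v = (\<Sum>j=1..k. a j + h j)"
  define M where "M = 2 * k + (\<Sum>j=1..k. q j) + (\<Sum>j=1..k. a j) + (\<Sum>i=1..k. \<Sum>j=1..k. a i * h j)"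
  define C0 where "C0 = A * (29 + 16 * real v) + 4 * T + 12"
  obtain w0 where params: "\<And>w. w0 \<le> w \<Longrightarrow> M \<le> w \<and> 192 \<le> w \<and>
    real w \<le> exp (exp (real w - 1) / real w) \<and>
    8 * real q0 * real w powr ((real w)\<^sup>2 + 3) \<le> exp (exp (real w - 1) / 4) \<and>
    exp (8 * real k) / 2 powr (real w / 96 - 3) \<le> 1 / (2 * real w) \<and>
    exp (2 * (real k)\<^sup>2 - ((real w - 1)\<^sup>2 - real w)) \<le> 1 / real w"
    using eventually_parameters[of M q0 k] unfolding eventually_sequentially by blast
  \<comment> \<open>If \<open>w < w0\<close> then \<open>1 / \<epsilon> \<le> w0\<close>, and the
    trivial bound \<open>1\<close> is absorbed by \<open>2 * w0\<close>; \<open>C0\<close> serves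
    the main range.\<close>
  define C where "C = 2 * real w0 + C0"
  have "A \<ge> 0" "T \<ge> 0" by (auto simp: A_def T_def intro!: sum_nonneg)
  then have C0: "C0 \<ge> 0" by (simp add: C0_def)

  show ?thesis
  proof (intro exI[of _ C] allI impI)
    fix x \<epsilon> :: real and f :: "nat \<Rightarrow> nat \<Rightarrow> complex"
    assume x3: "3 \<le> x" and \<epsilon>1: "1 / ln (ln x) < \<epsilon>" and \<epsilon>2: "\<epsilon> < 1 / 2"
      and f: "\<forall>j\<in>{1..k}. multiplicative_fun (f j) \<and> (\<forall>n\<ge>1. f j n \<in> cball 0 1)"
      and close: "Max ((\<lambda>j. pretentious_dist_trunc (f j) (twisted_character (chi j) (t j)) (x powr \<epsilon>) x) ` {1..k}) \<le> \<epsilon>"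
      and far: "1 / \<epsilon> \<le> Max ((\<lambda>j. pretentious_dist (f j) (twisted_character (chi j) (t j)) (x powr \<epsilon>)) ` {1..k})"
    have mult: "multiplicative_fun (f j)" if "j \<in> {1..k}" for j using f that by blast
    have f_le: "norm (f j n) \<le> 1" if "j \<in> {1..k}" "1 \<le> n" for j n using f that by auto
    define N where "N = nat \<lfloor>x\<rfloor>"
    have N: "real N \<le> x" "x - 1 < real N" unfolding N_def using x3 by linarith+
    define S where "S = (\<Sum>n=1..N. \<Prod>j=1..k. f j (a j * n + h j))"
    have "{n. 1 \<le> n \<and> real n \<le> x} = {1..N}"
      unfolding N_def using x3 by (auto simp: le_nat_floor le_floor_iff nat_le_iff le_nat_iff)
    then have lhs: "cmod (1 / of_real x * (\<Sum>n | n \<ge> 1 \<and> real n \<le> x. \<Prod>j=1..k. f j (a j * n + h j))) = norm S / x"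
      using x3 by (simp add: S_def norm_mult norm_divide)
    define s where "s = sqrt (ln (1 / \<epsilon>))"
    have "exp 1 < x" using e_less_272 x3 by linarith
    then have "exp 1 < exp (ln x)" using x3 by simp
    then have lnx: "1 < ln x" by (simp only: exp_less_cancel_iff)
    then have lnln: "0 < ln (ln x)" by simp
    then have \<epsilon>: "0 < \<epsilon>" using \<epsilon>1 by (meson less_trans zero_less_divide_1_iff)
    have "1 / \<epsilon> < ln (ln x)" using \<epsilon>1 lnln \<epsilon> by (simp add: field_simps)
    then have "exp (1 / \<epsilon>) < exp (ln (ln x))" by (simp only: exp_less_cancel_iff)
    then have x_large: "exp (1 / \<epsilon>) < ln x" using lnx by simp
    have s: "1 / 2 \<le> s" unfolding s_def using \<epsilon> \<epsilon>2 by (rule half_le_sqrt_ln)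
    define w where "w = nat \<lceil>1 / \<epsilon>\<rceil>"
    have inv0: "0 < 1 / \<epsilon>" using \<epsilon> by simp
    have w: "1 / \<epsilon> \<le> real w" "real w \<le> 1 / \<epsilon> + 1" unfolding w_def using inv0 by linarith+
    show "cmod (1 / of_real x * (\<Sum>n | n \<ge> 1 \<and> real n \<le> x. \<Prod>j=1..k. f j (a j * n + h j)))
      \<le> C * (sqrt (ln (1 / \<epsilon>)) * \<epsilon>)"
    proof (cases "w0 \<le> w")
      case False
      have "norm S \<le> (\<Sum>n=1..N. 1)"
        unfolding S_def using f_le assms(3)
        by (intro order_trans[OF norm_sum] sum_mono norm_prod_le_1) (simp add: trans_le_add2)
      then have "norm S / x \<le> 1" using N x3 by simp
      also have "1 \<le> 2 * real w0 * (s * \<epsilon>)"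
      proof -
        have "1 / \<epsilon> \<le> real w0" using w False by linarith
        then have "1 \<le> real w0 * \<epsilon> * 1" using \<epsilon> by (simp add: field_simps)
        also have "real w0 * \<epsilon> * 1 \<le> real w0 * \<epsilon> * (2 * s)"
          using s \<epsilon> by (intro mult_left_mono) auto
        finally show ?thesis by (simp add: mult_ac)
      qed
      also have "\<dots> \<le> C * (s * \<epsilon>)"
        unfolding C_def using C0 s \<epsilon> by (intro mult_right_mono) auto
      finally show ?thesis unfolding lhs s_def .
    next
      case True
      note par = params[OF True]
      have w192: "192 \<le> w" and wM: "M \<le> w" using par by auto
      have w0: "0 < real w" using w192 by simp
      have \<epsilon>w: "1 / real w \<le> \<epsilon>" using w(1) w0 \<epsilon> by (simp add: field_simps)
      have w\<epsilon>: "\<epsilon> \<le> 2 / real w"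
      proof -
        have "real w * \<epsilon> \<le> (1 / \<epsilon> + 1) * \<epsilon>" using w(2) \<epsilon> by (intro mult_right_mono) auto
        also have "\<dots> = 1 + \<epsilon>" using \<epsilon> by (simp add: distrib_right)
        also have "\<dots> \<le> 2" using \<epsilon>2 by simp
        finally show ?thesis using w0 by (simp add: field_simps)
      qed
      have lnx_w: "exp (real w - 1) \<le> ln x"
        using x_large w(2) by (intro order_trans[OF _ less_imp_le[OF x_large]]) simp
      define y where "y = x powr \<epsilon>"
      have x0: "x > 0" using x3 by simp
      have yw: "real w \<le> y"
      proof -
        have "exp (real w - 1) / real w = 1 / real w * exp (real w - 1)" by simp
        also have "\<dots> \<le> \<epsilon> * ln x" using \<epsilon>w lnx_w \<epsilon> by (intro mult_mono) auto
        finally have "exp (exp (real w - 1) / real w) \<le> y" using x0 by (simp add: y_def powr_def)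
        then show ?thesis using par by linarith
      qed
      have qM: "q j \<le> M" "a j \<le> M" if "j \<in> {1..k}" for j
        using member_le_sum[of j "{1..k}" q] member_le_sum[of j "{1..k}" a] that by (auto simp: M_def)
      have ahM: "a i * h j \<le> M" if "i \<in> {1..k}" "j \<in> {1..k}" for i j
      proof -
        have "a i * h j \<le> (\<Sum>j=1..k. a i * h j)" using that by (intro member_le_sum) auto
        also have "\<dots> \<le> (\<Sum>i=1..k. \<Sum>j=1..k. a i * h j)"
          using that by (intro member_le_sum[of i "{1..k}" "\<lambda>i. \<Sum>j=1..k. a i * h j"]) auto
        finally show ?thesis by (simp add: M_def)
      qed
      interpret pretentious_system k a h q chi t f w y
      proof
        show "2 * k \<le> w" using wM by (simp add: M_def)
        show "q j \<le> w" "a j \<le> w" if "j \<in> {1..k}" for j using qM[OF that] wM by auto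
        show "a i * h j \<le> w" if "i \<in> {1..k}" "j \<in> {1..k}" for i j using ahM[OF that] wM by simp
        show "4 \<le> w" using w192 by simp
      qed (use assms mult f_le yw in auto)

      have SL: "S = (\<Sum>n=1..N. \<Prod>j=1..k. f j (L j n))" by (simp add: S_def L_def)
      have log2x: "1 / \<epsilon> \<le> log 2 x"
      proof -
        have "ln x * ln 2 \<le> ln x * 1" using lnx ln_2_less_1 by (intro mult_left_mono) auto
        then have "ln x \<le> log 2 x" by (simp add: log_def le_divide_eq)
        moreover have "1 / \<epsilon> \<le> exp (1 / \<epsilon>)" using exp_ge_add_one_self[of "1 / \<epsilon>"] by linarith
        ultimately show ?thesis using x_large by linarith
      qed
      have x4: "4 \<le> x"
      proof -
        have "real w - 1 + 1 \<le> exp (real w - 1)" using exp_ge_add_one_self[of "real w - 1"] by linarith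
        then have "192 \<le> ln x" using lnx_w w192 by linarith
        then show ?thesis using ln_le_minus_one[OF x0] by linarith
      qed

      \<comment> \<open>The available \<open>x\<close> is split into two factors of size at most
        \<open>u\<close>: one for \<open>8 * Q * w ^ 3\<close>, one for the power of
        \<open>y\<close>.\<close>
      define u where "u = x powr (1 / 4)"
      have u0: "0 \<le> u" by (simp add: u_def)
      have uu: "u * u \<le> x"
      proof -
        have "u * u = x powr (1 / 2)" by (simp add: u_def powr_add[symmetric])
        also have "\<dots> \<le> x powr 1" using x3 by (intro powr_mono) auto
        finally show ?thesis using x0 by simp
      qed
      have ux: "u \<le> x"
      proof -
        have "u \<le> x powr 1" unfolding u_def using x3 by (intro powr_mono) auto
        then show ?thesis using x0 by simp
      qed
      have Qu: "8 * real Q * (real w)\<^sup>2 * real w \<le> u"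
      proof -
        have "(fact w :: nat) \<le> w ^ w" using fact_le_power[of w, where ?'a = nat] by simp
        then have "(fact w :: nat) ^ w \<le> (w ^ w) ^ w" by (rule power_mono) simp
        then have "real W \<le> real ((w ^ w) ^ w)" unfolding W_def by (rule of_nat_mono)
        also have "\<dots> = real w powr ((real w)\<^sup>2)"
          using w0 by (simp add: power_mult[symmetric] powr_realpow[symmetric] power2_eq_square)
        finally have "real W * real q0 * (real w) ^ 3 \<le> real w powr ((real w)\<^sup>2) * real q0 * real w powr 3"
          using w0 by (intro mult_mono) (auto simp: powr_numeral)
        also have "\<dots> = real q0 * real w powr ((real w)\<^sup>2 + 3)" by (simp add: powr_add)
        finally have "8 * real Q * (real w)\<^sup>2 * real w \<le> 8 * real q0 * real w powr ((real w)\<^sup>2 + 3)"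
          by (simp add: Q_def q0_def power2_eq_square power3_eq_cube mult_ac)
        also have "\<dots> \<le> exp (exp (real w - 1) / 4)" using par by blast
        also have "\<dots> \<le> u" using lnx_w x0 by (simp add: u_def powr_def)
        finally show ?thesis .
      qed
      have QN: "Q * w\<^sup>2 \<le> N"
      proof -
        have "real Q * (real w)\<^sup>2 * 1 \<le> real Q * (real w)\<^sup>2 * real w"
          using w192 by (intro mult_left_mono) auto
        then have "8 * (real Q * (real w)\<^sup>2) \<le> x" using Qu ux by linarith
        then have "real (Q * w\<^sup>2) \<le> real N" using N x4 by simp
        then show ?thesis by (simp only: of_nat_le_iff)
      qed
      \<comment> \<open>Here \<open>96 = 12 * 8\<close>: then
        \<open>12 * (B + 2) \<le> w / 8\<close>, and with \<open>\<epsilon> \<le> 2 / w\<close> the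
        power of \<open>y\<close> is at most \<open>x powr (1 / 4)\<close>. The subtraction is
        genuine because \<open>192 \<le> w\<close>.\<close>
      define B where "B = w div 96 - 2"
      have B2: "B + 2 = w div 96" using w192 by (simp add: B_def)
      have level: "8 * real Q * (real w)\<^sup>2 * y ^ (12 * (B + 2)) \<le> x / real w"
      proof -
        have y0: "0 < y" using x0 by (simp add: y_def)
        have "96 * (B + 2) \<le> w" unfolding B2 by simp
        then have "real (96 * (B + 2)) \<le> real w" by (rule of_nat_mono)
        then have "\<epsilon> * real (12 * (B + 2)) \<le> 2 / real w * (real w / 8)"
          using w\<epsilon> \<epsilon> by (intro mult_mono) auto
        then have le: "\<epsilon> * real (12 * (B + 2)) \<le> 1 / 4" using w0 by simp
        have "y ^ (12 * (B + 2)) = x powr (\<epsilon> * real (12 * (B + 2)))"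
          using y0 by (simp only: powr_realpow[symmetric] y_def powr_powr)
        also have "\<dots> \<le> u" unfolding u_def using le x3 by (intro powr_mono) auto
        finally have "8 * real Q * (real w)\<^sup>2 * real w * y ^ (12 * (B + 2)) \<le> u * u"
          using Qu u0 y0 by (intro mult_mono) auto
        then have "8 * real Q * (real w)\<^sup>2 * y ^ (12 * (B + 2)) * real w \<le> x"
          using uu by (simp add: mult_ac)
        then show ?thesis using w0 by (simp only: pos_le_divide_eq)
      qed
      have expB: "exp (exp (8 * real k) / 2 ^ B) - 1 \<le> 1 / real w"
      proof -
        have "w mod 96 < 96" by simp
        then have "w \<le> 96 * (B + 2) + 96"
          unfolding B2 using mult_div_mod_eq[of 96 w] by linarith
        then have "real w \<le> real (96 * (B + 2) + 96)" by (rule of_nat_mono)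
        then have "real w / 96 - 3 \<le> real B" by simp
        then have "2 powr (real w / 96 - 3) \<le> (2::real) powr real B" by (intro powr_mono) auto
        then have "exp (8 * real k) / 2 ^ B \<le> exp (8 * real k) / 2 powr (real w / 96 - 3)"
          by (intro divide_left_mono) (auto simp: powr_realpow)
        also have "\<dots> \<le> 1 / (2 * real w)" using par by blast
        finally have z: "exp (8 * real k) / 2 ^ B \<le> 1 / (2 * real w)" .
        \<comment> \<open>Prepares \<open>exp z \<le> 1 + 2 * z\<close>, used for
          \<open>0 \<le> z \<le> 1 / 2\<close>; its factor 2 explains the target
          \<open>1 / (2 * w)\<close>.\<close>
        moreover have "1 / (2 * real w) \<le> 1 / 2" using w192 by (simp add: divide_simps)
        ultimately have "exp (8 * real k) / 2 ^ B \<le> 1 / 2" by (rule order_trans)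
        then have "exp (exp (8 * real k) / 2 ^ B) \<le> 1 + 2 * (exp (8 * real k) / 2 ^ B)"
          by (intro real_exp_bound_lemma) (simp_all only: divide_nonneg_pos exp_ge_zero zero_less_power zero_less_numeral)
        also have "\<dots> \<le> 1 + 2 * (1 / (2 * real w))" using z by simp
        finally show ?thesis using w0 by simp
      qed
      have close': "(\<Sum>p | prime p \<and> y \<le> real p \<and> real p \<le> x. (1 - Re (F j p)) / real p) \<le> \<epsilon>\<^sup>2"
        if "j \<in> {1..k}" for j
      proof -
        have "pretentious_dist_trunc (f j) (twisted_character (chi j) (t j)) (x powr \<epsilon>) x \<le> \<epsilon>"
          using that by (intro order_trans[OF Max_ge close]) auto
        then show ?thesis unfolding pretentious_dist_trunc_def F_def y_def by (rule sqrt_le_D)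
      qed
      have "Max ((\<lambda>j. pretentious_dist (f j) (twisted_character (chi j) (t j)) (x powr \<epsilon>)) ` {1..k})
          \<in> (\<lambda>j. pretentious_dist (f j) (twisted_character (chi j) (t j)) (x powr \<epsilon>)) ` {1..k}"
        using assms(1) by (intro Max_in) auto
      then obtain j0 where j0: "j0 \<in> {1..k}"
        and "1 / \<epsilon> \<le> pretentious_dist (f j0) (twisted_character (chi j0) (t j0)) (x powr \<epsilon>)"
        using far by auto
      then have "1 / \<epsilon> \<le> sqrt (\<Sum>p | prime p \<and> real p \<le> y. (1 - Re (F j0 p)) / real p)"
        unfolding pretentious_dist_def F_def y_def by simp
      then have far': "(1 / \<epsilon>)\<^sup>2 \<le> (\<Sum>p | prime p \<and> real p \<le> y. (1 - Re (F j0 p)) / real p)"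
        using inv0 by (smt (verit) power_mono real_sqrt_ge_0_iff real_sqrt_pow2)
      have v: "a j + h j \<le> 2 ^ v" if "j \<in> {1..k}" for j
      proof -
        have "a j + h j \<le> v" unfolding v_def using that by (intro member_le_sum[of j "{1..k}" "\<lambda>j. a j + h j"]) auto
        also have "\<dots> \<le> 2 ^ v" by (simp add: less_imp_le)
        finally show ?thesis .
      qed
      have "norm S \<le> x * (C0 * (s * \<epsilon>))"
        unfolding SL C0_def A_def T_def s_def
        by (rule norm_sum_prod_f_le[OF \<epsilon> \<epsilon>2 y_def x4 log2x N(1) QN v w close' j0 far' level expB])
           (use par in auto)
      then have "norm S / x \<le> C0 * (s * \<epsilon>)" using x0 by (simp add: field_simps)
      also have "\<dots> \<le> C * (s * \<epsilon>)"
        unfolding C_def using s \<epsilon> by (intro mult_right_mono) auto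
      finally show ?thesis unfolding lhs s_def .
    qed
  qed
qed

end
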